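(* Let $n\ge1$, $0<\alpha<n$, $1<p,q,r<\infty$ with $\frac1p+\frac1q<1$ and $\frac1r=\frac1p+\frac1q-\frac{\alpha}{n}$, and let $b\in BMO$. Then for $i=1,2$ there is a constant $C$ independent of $b,f,g$ such that $$\|[BI_\alpha,b]_i(f,g)\|_{L^r(\mathbb R^n)}\le C\|b\|_{BMO}\|f\|_{L^p(\mathbb R^n)}\|g\|_{L^q(\mathbb R^n)}.$$
   Context: $BI_\alpha$ is the bilinear fractional integral $BI_\alpha(f,g)(x)=\int_{\mathbb R^n}\frac{f(x-y)g(x+y)}{|y|^{n-\alpha}}\,dy$. $BMO$ is the space of locally integrable $b$ on $\mathbb R^n$ with $\|b\|_{BMO}=\sup_Q \frac{1}{|Q|}\int_Q|b-b_Q|\,dx<\infty$, the supremum over cubes $Q$, $b_Q$ the average of $b$ over $Q$. For a bilinear operator $T$ and a function $b$, the bilinear commutators are $[T,b]_1(f,g)=T(bf,g)-bT(f,g)$ and $[T,b]_2(f,g)=T(f,bg)-bT(f,g)$. *)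

theory Defs
  imports "HOL-Analysis.Analysis"
begin

definition BI :: "real \<Rightarrow> ('a::euclidean_space \<Rightarrow> real) \<Rightarrow> ('a \<Rightarrow> real) \<Rightarrow> 'a \<Rightarrow> real" where
  "BI \<alpha> f g x = (\<integral>y. f (x - y) * g (x + y) / (norm y powr (real DIM('a) - \<alpha>)) \<partial>lebesgue)"

definition bcomm :: "nat \<Rightarrow> (('a \<Rightarrow> real) \<Rightarrow> ('a \<Rightarrow> real) \<Rightarrow> 'a \<Rightarrow> real)
     \<Rightarrow> ('a \<Rightarrow> real) \<Rightarrow> ('a \<Rightarrow> real) \<Rightarrow> ('a \<Rightarrow> real) \<Rightarrow> 'a \<Rightarrow> real" where
  "bcomm i T b f g x =
     (if i = 1 then T (\<lambda>y. b y * f y) g x - b x * T f g x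
      else T f (\<lambda>y. b y * g y) x - b x * T f g x)"

definition cube :: "'a::euclidean_space \<Rightarrow> real \<Rightarrow> 'a set" where
  "cube a h = cbox a (a + h *\<^sub>R One)"

definition avg :: "'a::euclidean_space set \<Rightarrow> ('a \<Rightarrow> real) \<Rightarrow> real" where
  "avg Q b = (\<integral>x\<in>Q. b x \<partial>lebesgue) / measure lebesgue Q"

definition mean_osc :: "('a::euclidean_space \<Rightarrow> real) \<Rightarrow> 'a set \<Rightarrow> real" where
  "mean_osc b Q = avg Q (\<lambda>x. \<bar>b x - avg Q b\<bar>)"

definition in_BMO :: "('a::euclidean_space \<Rightarrow> real) \<Rightarrow> bool" where
  "in_BMO b \<longleftrightarrow> b \<in> borel_measurable lebesgue
     \<and> (\<forall>a h. h > 0 \<longrightarrow> set_integrable lebesgue (cube a h) b)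
     \<and> bdd_above {mean_osc b (cube a h) | a h. h > 0}"

definition BMO_norm :: "('a::euclidean_space \<Rightarrow> real) \<Rightarrow> real" where
  "BMO_norm b = Sup {mean_osc b (cube a h) | a h. h > 0}"

definition in_Lp :: "real \<Rightarrow> ('a::euclidean_space \<Rightarrow> real) \<Rightarrow> bool" where
  "in_Lp p f \<longleftrightarrow> f \<in> borel_measurable lebesgue \<and> integrable lebesgue (\<lambda>x. \<bar>f x\<bar> powr p)"

definition Lp_norm :: "real \<Rightarrow> ('a::euclidean_space \<Rightarrow> real) \<Rightarrow> real" where
  "Lp_norm p f = (\<integral>x. \<bar>f x\<bar> powr p \<partial>lebesgue) powr (1 / p)"

end

theory Submission
  imports Defs
begin

text \<open>
  Write \<open>1/s = 1/p + 1/q\<close> and \<open>m = p/s\<close>, with conjugate exponent \<open>m' = q/s\<close>. Young's inequality gives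
  \<open>|b(x) - b(x-y)| |f(x-y)| |g(x+y)| \<le> |b(x) - b(x-y)|\<^sup>m |f(x-y)|\<^sup>m + |g(x+y)|\<^bsup>m'\<^esup>\<close>, which reduces the
  claim, tested against \<open>\<psi>\<close> in the dual of \<open>L\<^sup>r\<close>, to the linear form
  \<open>\<integral>\<integral> (1 + |b(x) - b(y)|\<^sup>m) \<phi>(y) \<psi>(x) |x-y|\<^bsup>\<alpha>-n\<^esup> dy dx\<close> with \<open>\<phi>\<close> in \<open>L\<^sup>s\<close>.
  Writing the kernel as an integral over radii \<open>t \<ge> |x-y|\<close> and comparing \<open>b\<close> with its means over
  \<open>B(x,t)\<close> and \<open>B(y,t)\<close>, which differ by a bounded amount, splits the form into two terms, each
  containing the oscillation of \<open>b\<close> about the centre of only one ball. By the John--Nirenberg bound on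
  all moments of the oscillation, each term is controlled by Hedberg's pointwise estimate through the
  maximal function of a power \<open>\<phi>\<^sup>\<tau>\<close>, \<open>1 < \<tau> < s\<close> (for the second term with the dual exponents of \<open>r\<close>
  and \<open>s\<close>). The exponents are never handled by Hoelder's inequality: all functions are normalised
  first, so that Young's inequality suffices. Everything is done with absolute values inside the
  integrals, so the bound also yields the almost everywhere absolute convergence of the integrals
  defining the commutator.
\<close>

section \<open>Vitali selection and the maximal function\<close>

text \<open>Since f and g sit at x - y and x + y, no single substitution straightens both; after
  Young's inequality each term contains only one of them, and one translation makes the kernel
  linear. The price is the power m > 1 of the oscillation of b, which John-Nirenberg absorbs since
  it controls all powers alike. What it does not control is b at the centre of a ball against the
  mean over that ball. Hence b(x) is compared with the mean over B(y,t), of which x is an ordinary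
  point, and b(y) with the mean over B(x,t); interchanging x and y turns the former into an operator
  acting on the test function \<psi>. Young's inequality is not homogeneous, which is why b, f, g
  are divided by slightly enlarged norms: the constants then depend only on the dimension, the
  exponents, \<alpha> and a fixed oscillation bound K, and scaling back restores the product of
  norms. The condition 1/p + 1/q < 1 means s > 1 and leaves room for \<tau>. The summand 1 beside
  |b(x) - b(y)|^m carries the integral without b through the same estimates.\<close>

lemma emeasure_cball_scale:
  fixes x y :: "'a::euclidean_space"
  assumes "0 \<le> t" "0 \<le> c"
  shows "emeasure lborel (cball x (c * t)) = ennreal (c ^ DIM('a)) * emeasure lborel (cball y t)"
proof -
  have "0 < unit_ball_vol (real DIM('a))" by simp
  then show ?thesis
    using assms by (simp add: emeasure_cball power_mult_distrib mult_ac flip: ennreal_mult)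
qed

text \<open>The selected balls are disjoint, so their masses under the measure with density
  \<open>h\<close> add up to at most the mass of \<open>G\<close>. \<open>G\<close> is the whole
  space for the weak type bound and a doubled ball in the stopping-time argument.\<close>

lemma vitali_selection:
  fixes E :: "'a::euclidean_space set" and t :: "'a \<Rightarrow> real" and h :: "'a \<Rightarrow> ennreal"
  assumes h[measurable]: "h \<in> borel_measurable borel"
    and t: "\<And>x. x \<in> E \<Longrightarrow> 0 < t x \<and> t x \<le> R"
    and big: "\<And>x. x \<in> E \<Longrightarrow> l * emeasure lborel (cball x (t x)) \<le> (\<integral>\<^sup>+y\<in>cball x (t x). h y \<partial>lborel)"
    and G: "\<And>x. x \<in> E \<Longrightarrow> cball x (t x) \<subseteq> G" "G \<in> sets borel"
  obtains J where "countable J" "J \<subseteq> E" "E \<subseteq> (\<Union>x\<in>J. cball x (5 * t x))"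
    "(\<integral>\<^sup>+x. l * emeasure lborel (cball x (t x)) \<partial>count_space J) \<le> (\<integral>\<^sup>+y\<in>G. h y \<partial>lborel)"
proof -
  have "E \<subseteq> (\<Union>x\<in>E. cball x (t x))"
  proof
    fix x assume "x \<in> E"
    then show "x \<in> (\<Union>x\<in>E. cball x (t x))" using t[of x] by (intro UN_I[of x]) auto
  qed
  then obtain J where J: "countable J" "J \<subseteq> E"
     "pairwise (\<lambda>i j. disjnt (cball i (t i)) (cball j (t j))) J"
     "E \<subseteq> (\<Union>i\<in>J. cball i (5 * t i))"
    by (rule Vitali_covering_lemma_cballs[OF _ t]) auto
  have disj: "disjoint_family_on (\<lambda>i. cball i (t i)) J"
    using J(3) by (auto simp: disjoint_family_on_def pairwise_def disjnt_def)
  have "(\<integral>\<^sup>+x. l * emeasure lborel (cball x (t x)) \<partial>count_space J)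
      \<le> (\<integral>\<^sup>+x. emeasure (density lborel h) (cball x (t x)) \<partial>count_space J)"
    using big J(2) by (intro nn_integral_mono) (auto simp: emeasure_density)
  also have "\<dots> = emeasure (density lborel h) (\<Union>x\<in>J. cball x (t x))"
    using J(1) disj by (subst emeasure_UN_countable) auto
  also have "\<dots> \<le> emeasure (density lborel h) G"
    using G J(2) by (intro emeasure_mono) auto
  also have "\<dots> = (\<integral>\<^sup>+y\<in>G. h y \<partial>lborel)"
    using G by (simp add: emeasure_density)
  finally show ?thesis by (rule that[OF J(1,2,4)])
qed

lemma nn_integral_UN_countable_le:
  assumes J: "countable J" and h[measurable]: "h \<in> borel_measurable M"
    and B[measurable]: "\<And>i. i \<in> J \<Longrightarrow> B i \<in> sets M"
  shows "(\<integral>\<^sup>+y\<in>(\<Union>i\<in>J. B i). h y \<partial>M) \<le> (\<integral>\<^sup>+i. (\<integral>\<^sup>+y\<in>B i. h y \<partial>M) \<partial>count_space J)"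
proof -
  have "(\<integral>\<^sup>+y\<in>(\<Union>i\<in>J. B i). h y \<partial>M) \<le> (\<integral>\<^sup>+y. (\<integral>\<^sup>+i. h y * indicator (B i) y \<partial>count_space J) \<partial>M)"
  proof (rule nn_integral_mono)
    fix y
    show "h y * indicator (\<Union>i\<in>J. B i) y \<le> (\<integral>\<^sup>+i. h y * indicator (B i) y \<partial>count_space J)"
    proof (cases "y \<in> (\<Union>i\<in>J. B i)")
      case True
      then obtain i where i: "i \<in> J" "y \<in> B i" by blast
      have "h y * indicator (\<Union>i\<in>J. B i) y = (\<integral>\<^sup>+j. h y * indicator {i} j \<partial>count_space J)"
        using i True by (simp add: nn_integral_cmult)
      also have "\<dots> \<le> (\<integral>\<^sup>+i. h y * indicator (B i) y \<partial>count_space J)"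
        using i by (intro nn_integral_mono) (auto split: split_indicator)
      finally show ?thesis .
    qed simp
  qed
  also have "\<dots> = (\<integral>\<^sup>+i. (\<integral>\<^sup>+y\<in>B i. h y \<partial>M) \<partial>count_space J)"
    using J B by (intro nn_integral_count_space_nn_integral) auto
  finally show ?thesis .
qed

text \<open>Only rational radii, so that measurability is immediate; this costs a factor of at most \<open>2\<^sup>n\<close>.\<close>
definition maxfun :: "('a::euclidean_space \<Rightarrow> ennreal) \<Rightarrow> 'a \<Rightarrow> ennreal" where
  "maxfun h x = (SUP t\<in>{t\<in>\<rat>. 0 < t}. (\<integral>\<^sup>+y\<in>cball x t. h y \<partial>lborel) / emeasure lborel (cball x t))"

text \<open>Centre, radius and point may all depend on the integration variable: rewritten as a
  condition on \<open>dist\<close>, the indicator is jointly measurable, as the later exchange of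
  integrals over balls and radii requires.\<close>

lemma measurable_cball_indicator [measurable (raw)]:
  fixes f g :: "'b \<Rightarrow> 'a::euclidean_space"
  assumes [measurable]: "f \<in> borel_measurable M" "g \<in> borel_measurable M" "t \<in> borel_measurable M"
  shows "(\<lambda>z. indicator (cball (f z) (t z)) (g z) :: ennreal) \<in> borel_measurable M"
    and "(\<lambda>z. indicator (cball (f z) (t z)) (g z) :: real) \<in> borel_measurable M"
proof -
  have *: "(\<lambda>z. indicator (cball (f z) (t z)) (g z)) = (\<lambda>z. if dist (f z) (g z) \<le> t z then 1 else 0 :: 'c::{zero_neq_one})"
    by (auto simp: fun_eq_iff)
  show "(\<lambda>z. indicator (cball (f z) (t z)) (g z) :: ennreal) \<in> borel_measurable M"
    "(\<lambda>z. indicator (cball (f z) (t z)) (g z) :: real) \<in> borel_measurable M"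
    unfolding * by measurable
qed

lemma measurable_maxfun [measurable]:
  assumes [measurable]: "h \<in> borel_measurable borel"
  shows "maxfun h \<in> borel_measurable borel"
proof -
  have "countable {t\<in>\<rat>. (0::real) < t}"
    by (rule countable_subset[OF _ countable_rat]) auto
  then show ?thesis
    unfolding maxfun_def[abs_def]
    by (intro borel_measurable_SUP) (auto simp: emeasure_cball)
qed

lemma emeasure_cball_pos: "0 < t \<Longrightarrow> 0 < emeasure lborel (cball (x::'a::euclidean_space) t)"
  by (simp add: emeasure_cball)

lemma ball_nn_integral_le_maxfun:
  fixes x :: "'a::euclidean_space"
  assumes "0 < t"
  shows "(\<integral>\<^sup>+y\<in>cball x t. h y \<partial>lborel) \<le> 2 ^ DIM('a) * maxfun h x * emeasure lborel (cball x t)"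
proof -
  obtain q where q: "q \<in> \<rat>" "t < q" "q < 2 * t"
    using Rats_dense_in_real[of t "2*t"] assms by auto
  have fin: "emeasure lborel (cball x q) \<noteq> top" "emeasure lborel (cball x q) \<noteq> 0"
    using q assms emeasure_cball_pos[of q x] emeasure_lborel_cball_finite[of x q] by auto
  have "(\<integral>\<^sup>+y\<in>cball x t. h y \<partial>lborel) \<le> (\<integral>\<^sup>+y\<in>cball x q. h y \<partial>lborel)"
    using q by (intro nn_integral_mono) (auto split: split_indicator)
  also have "\<dots> = (\<integral>\<^sup>+y\<in>cball x q. h y \<partial>lborel) / emeasure lborel (cball x q) * emeasure lborel (cball x q)"
    using fin by (simp add: ennreal_divide_times ennreal_divide_self less_top)
  also have "\<dots> \<le> maxfun h x * emeasure lborel (cball x q)"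
    unfolding maxfun_def using q assms by (intro mult_right_mono SUP_upper) auto
  also have "\<dots> \<le> maxfun h x * emeasure lborel (cball x (2 * t))"
    using q by (intro mult_left_mono emeasure_mono) auto
  also have "\<dots> = maxfun h x * (2 ^ DIM('a) * emeasure lborel (cball x t))"
    using assms emeasure_cball_scale[of t 2 x x] by (simp flip: ennreal_power)
  finally show ?thesis by (simp add: mult_ac)
qed

text \<open>Every point of the level set is the centre of a ball on which \<open>h\<close> has
  average at least \<open>l\<close>; the selected disjoint balls have total volume at most the
  integral of \<open>h\<close> divided by \<open>l\<close>, and enlarging them five times costs
  \<open>5 ^ DIM('a)\<close>.\<close>

lemma maxfun_weak_type:
  fixes h :: "'a::euclidean_space \<Rightarrow> ennreal"
  assumes h[measurable]: "h \<in> borel_measurable borel" and fin: "(\<integral>\<^sup>+y. h y \<partial>lborel) < top" and "0 < l"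
  shows "ennreal l * emeasure lborel {x. ennreal l < maxfun h x} \<le> 5 ^ DIM('a) * (\<integral>\<^sup>+y. h y \<partial>lborel)"
proof -
  define E where "E = {x. ennreal l < maxfun h x}"
  have "\<exists>t>0. ennreal l * emeasure lborel (cball x t) \<le> (\<integral>\<^sup>+y\<in>cball x t. h y \<partial>lborel)" if "x \<in> E" for x
  proof -
    obtain t where t: "0 < t" and "ennreal l < (\<integral>\<^sup>+y\<in>cball x t. h y \<partial>lborel) / emeasure lborel (cball x t)"
      using \<open>x \<in> E\<close> unfolding E_def maxfun_def by (auto simp: less_SUP_iff)
    then have "ennreal l * emeasure lborel (cball x t)
      \<le> (\<integral>\<^sup>+y\<in>cball x t. h y \<partial>lborel) / emeasure lborel (cball x t) * emeasure lborel (cball x t)"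
      by (intro mult_right_mono) auto
    also have "\<dots> = (\<integral>\<^sup>+y\<in>cball x t. h y \<partial>lborel)"
      using t emeasure_cball_pos[of t x] emeasure_lborel_cball_finite[of x t]
      by (simp add: ennreal_divide_times ennreal_divide_self less_top)
    finally show ?thesis using t by blast
  qed
  then obtain t where t: "\<And>x. x \<in> E \<Longrightarrow> 0 < t x"
      "\<And>x. x \<in> E \<Longrightarrow> ennreal l * emeasure lborel (cball x (t x)) \<le> (\<integral>\<^sup>+y\<in>cball x (t x). h y \<partial>lborel)"
    by metis
  define H where "H = enn2real (\<integral>\<^sup>+y. h y \<partial>lborel)"
  define V where "V = unit_ball_vol (real DIM('a))"
  have V: "0 < V" by (simp add: V_def)
  have H: "(\<integral>\<^sup>+y. h y \<partial>lborel) = ennreal H" "0 \<le> H" using fin by (auto simp: H_def less_top)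
  \<comment> \<open>Vitali selection needs bounded radii. A radius t > 1 satisfies t <= t^n, so l V
    t <= l V t^n <= H bounds it; the remaining radii are at most 1.\<close>
  define R where "R = max 1 (H / (l * V))"
  have "t x \<le> R" if "x \<in> E" for x
  proof (cases "t x \<le> 1")
    case False
    have "ennreal l * emeasure lborel (cball x (t x)) \<le> (\<integral>\<^sup>+y\<in>cball x (t x). h y \<partial>lborel)"
      using t that by blast
    also have "\<dots> \<le> (\<integral>\<^sup>+y. h y \<partial>lborel)"
      by (intro nn_integral_mono) (auto split: split_indicator)
    finally have "ennreal (l * (V * t x ^ DIM('a))) \<le> ennreal H"
      using False V \<open>0 < l\<close> by (simp add: emeasure_cball H ennreal_mult V_def)
    then have "l * (V * t x ^ DIM('a)) \<le> H" using H by simp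
    moreover have "t x ^ 1 \<le> t x ^ DIM('a)" using False by (intro power_increasing) (auto simp: Suc_leI)
    ultimately have "l * (V * t x) \<le> H" using V \<open>0 < l\<close>
      by (smt (verit) mult_left_mono power_one_right)
    then show ?thesis using V \<open>0 < l\<close> by (simp add: R_def field_simps le_max_iff_disj)
  qed (simp add: R_def)
  then have R: "0 < t x \<and> t x \<le> R" if "x \<in> E" for x
    using t that by blast
  obtain J where J: "countable J" "J \<subseteq> E" "E \<subseteq> (\<Union>x\<in>J. cball x (5 * t x))"
    "(\<integral>\<^sup>+x. ennreal l * emeasure lborel (cball x (t x)) \<partial>count_space J) \<le> (\<integral>\<^sup>+y\<in>UNIV. h y \<partial>lborel)"
    by (rule vitali_selection[OF h R t(2), where G=UNIV]) auto
  have "emeasure lborel E \<le> emeasure lborel (\<Union>x\<in>J. cball x (5 * t x))"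
    using J by (intro emeasure_mono) auto
  also have "\<dots> \<le> (\<integral>\<^sup>+x. emeasure lborel (cball x (5 * t x)) \<partial>count_space J)"
    using nn_integral_UN_countable_le[OF J(1), of "\<lambda>_. 1" lborel "\<lambda>x. cball x (5 * t x)"] J(1)
    by (simp add: nn_integral_indicator sets.countable_UN'' del: UN_simps)
  also have "\<dots> = (\<integral>\<^sup>+x. 5 ^ DIM('a) * emeasure lborel (cball x (t x)) \<partial>count_space J)"
  proof (intro nn_integral_cong)
    fix x assume "x \<in> space (count_space J)"
    then have "0 \<le> t x" using J t(1)[of x] by auto
    then show "emeasure lborel (cball x (5 * t x)) = 5 ^ DIM('a) * emeasure lborel (cball x (t x))"
      using emeasure_cball_scale[of "t x" 5 x x] by (simp flip: ennreal_power)
  qed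
  also have "\<dots> = 5 ^ DIM('a) * (\<integral>\<^sup>+x. emeasure lborel (cball x (t x)) \<partial>count_space J)"
    by (simp add: nn_integral_cmult)
  finally have "ennreal l * emeasure lborel E \<le> ennreal l * (5 ^ DIM('a) * (\<integral>\<^sup>+x. emeasure lborel (cball x (t x)) \<partial>count_space J))"
    by (intro mult_left_mono) auto
  also have "\<dots> = 5 ^ DIM('a) * (\<integral>\<^sup>+x. ennreal l * emeasure lborel (cball x (t x)) \<partial>count_space J)"
    by (simp add: nn_integral_cmult mult_ac)
  also have "\<dots> \<le> 5 ^ DIM('a) * (\<integral>\<^sup>+y. h y \<partial>lborel)"
    using J(4) by (intro mult_left_mono) auto
  finally show ?thesis unfolding E_def .
qed

section \<open>Power integrals, extended powers and the layer cake formula\<close>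

lemma nn_integral_powr_from_0:
  assumes "-1 < a" "0 \<le> c"
  shows "(\<integral>\<^sup>+x\<in>{0<..<c}. ennreal (x powr a) \<partial>lborel) = ennreal (c powr (a + 1) / (a + 1))"
  using nn_integral_has_integral_lebesgue'[of "{0<..<c}" "\<lambda>x. x powr a"]
    has_integral_powr_from_0[OF assms] by (simp add: has_integral_Icc_iff_Ioo)

lemma nn_integral_powr_to_inf:
  assumes "e < -1" "0 < a"
  shows "(\<integral>\<^sup>+x\<in>{a..}. ennreal (x powr e) \<partial>lborel) = ennreal (- (a powr (e + 1) / (e + 1)))"
  using nn_integral_has_integral_lebesgue'[of "{a..}" "\<lambda>x. x powr e"]
    has_integral_powr_to_inf[OF assms] by simp

text \<open>Powers with \<open>\<infinity>\<^sup>p = \<infinity>\<close>, so that a finite integral forces finiteness almost everywhere.\<close>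
definition epowr :: "ennreal \<Rightarrow> real \<Rightarrow> ennreal" where
  "epowr m p = (if m = top then top else ennreal (enn2real m powr p))"

lemma epowr_ennreal [simp]: "0 \<le> x \<Longrightarrow> epowr (ennreal x) p = ennreal (x powr p)"
  by (simp add: epowr_def)

lemma epowr_top [simp]: "epowr top p = top"
  by (simp add: epowr_def)

lemma epowr_mono: "0 \<le> p \<Longrightarrow> x \<le> y \<Longrightarrow> epowr x p \<le> epowr y p"
  by (cases x; cases y) (auto simp: top_unique intro!: ennreal_leI powr_mono2)

lemma measurable_epowr [measurable (raw)]:
  assumes [measurable]: "f \<in> borel_measurable M"
  shows "(\<lambda>x. epowr (f x) p) \<in> borel_measurable M"
  unfolding epowr_def by measurable

text \<open>For \<open>m = top\<close> the integral dominates k^p for every natural number k, so it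
  diverges, in agreement with the convention \<open>epowr top p = top\<close>.\<close>

lemma epowr_layer_cake:
  assumes "0 < p"
  shows "epowr m p = (\<integral>\<^sup>+l\<in>{0<..}. ennreal (p * l powr (p - 1)) * indicator {l. ennreal l < m} l \<partial>lborel)"
proof -
  have fin: "(\<integral>\<^sup>+l\<in>{0<..<c}. ennreal (p * l powr (p - 1)) \<partial>lborel) = ennreal (c powr p)" if "0 \<le> c" for c
  proof -
    have "(\<integral>\<^sup>+l\<in>{0<..<c}. ennreal (p * l powr (p - 1)) \<partial>lborel)
        = ennreal p * (\<integral>\<^sup>+l\<in>{0<..<c}. ennreal (l powr (p - 1)) \<partial>lborel)"
      using assms by (simp add: ennreal_mult nn_integral_cmult mult.assoc)
    also have "\<dots> = ennreal (c powr p)"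
      using assms that nn_integral_powr_from_0[of "p - 1" c] by (simp flip: ennreal_mult)
    finally show ?thesis .
  qed
  show ?thesis
  proof (cases m)
    case (real c)
    have "(\<integral>\<^sup>+l\<in>{0<..}. ennreal (p * l powr (p - 1)) * indicator {l. ennreal l < m} l \<partial>lborel)
       = (\<integral>\<^sup>+l\<in>{0<..<c}. ennreal (p * l powr (p - 1)) \<partial>lborel)"
      using real by (intro nn_integral_cong) (auto split: split_indicator simp: ennreal_less_iff)
    then show ?thesis using fin real by simp
  next
    case top
    have "ennreal (real n powr p) \<le> (\<integral>\<^sup>+l\<in>{0<..}. ennreal (p * l powr (p - 1)) * indicator {l. ennreal l < m} l \<partial>lborel)" for n :: nat
      unfolding fin[of "real n", OF of_nat_0_le_iff, symmetric] using top
      by (intro nn_integral_mono) (auto split: split_indicator)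
    moreover have "(SUP n::nat. ennreal (real n powr p)) = top"
    proof (rule ennreal_SUP_eq_top)
      fix k :: nat
      have "real k \<le> (real (nat \<lceil>real k powr (1/p)\<rceil>)) powr p"
      proof -
        have "real k = (real k powr (1/p)) powr p" using assms by (simp add: powr_powr)
        also have "\<dots> \<le> (real (nat \<lceil>real k powr (1/p)\<rceil>)) powr p"
          using assms by (intro powr_mono2) (auto simp: of_nat_ceiling)
        finally show ?thesis .
      qed
      then show "\<exists>i\<in>UNIV. of_nat k \<le> ennreal (real i powr p)"
        by (metis UNIV_I ennreal_leI ennreal_of_nat_eq_real_of_nat)
    qed
    ultimately have "top \<le> (\<integral>\<^sup>+l\<in>{0<..}. ennreal (p * l powr (p - 1)) * indicator {l. ennreal l < m} l \<partial>lborel)"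
      by (metis (no_types, lifting) SUP_least)
    then show ?thesis using top by (simp add: top_unique)
  qed
qed

section \<open>The strong type bound by interpolation\<close>

lemma maxfun_add_const_le:
  fixes h :: "'a::euclidean_space \<Rightarrow> ennreal"
  assumes [measurable]: "h1 \<in> borel_measurable borel"
    and le: "\<And>y. h y \<le> h1 y + c"
  shows "maxfun h x \<le> maxfun h1 x + c"
  unfolding maxfun_def
proof (rule SUP_least)
  fix t :: real assume t: "t \<in> {t\<in>\<rat>. 0 < t}"
  let ?e = "emeasure lborel (cball x t)"
  have e: "?e \<noteq> 0" "?e \<noteq> top"
    using t emeasure_cball_pos[of t x] emeasure_lborel_cball_finite[of x t] by auto
  have "(\<integral>\<^sup>+y\<in>cball x t. h y \<partial>lborel) \<le> (\<integral>\<^sup>+y. h1 y * indicator (cball x t) y + c * indicator (cball x t) y \<partial>lborel)"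
    using le by (intro nn_integral_mono) (auto split: split_indicator)
  also have "\<dots> = (\<integral>\<^sup>+y\<in>cball x t. h1 y \<partial>lborel) + c * ?e"
    by (subst nn_integral_add) (auto simp: nn_integral_cmult)
  finally have "(\<integral>\<^sup>+y\<in>cball x t. h y \<partial>lborel) / ?e \<le> ((\<integral>\<^sup>+y\<in>cball x t. h1 y \<partial>lborel) + c * ?e) / ?e"
    by (intro divide_right_mono_ennreal)
  also have "\<dots> = (\<integral>\<^sup>+y\<in>cball x t. h1 y \<partial>lborel) / ?e + c"
    using e by (simp add: add_divide_distrib_ennreal ennreal_mult_divide_eq)
  also have "\<dots> \<le> (SUP t\<in>{t\<in>\<rat>. 0 < t}. (\<integral>\<^sup>+y\<in>cball x t. h1 y \<partial>lborel) / emeasure lborel (cball x t)) + c"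
    using t by (intro add_right_mono SUP_upper)
  finally show "(\<integral>\<^sup>+y\<in>cball x t. h y \<partial>lborel) / ?e \<le> \<dots>" .
qed

text \<open>Cutting \<open>u\<close> at height l/2: the lower part contributes at most l/2 to any
  average, so the upper part has maximal function above l/2 and the weak type bound applies to it.
  The upper part is integrable because u <= (l/2)^(1-p) u^p where u > l/2.\<close>

lemma maxfun_level_set_le:
  fixes u :: "'a::euclidean_space \<Rightarrow> real"
  assumes [measurable]: "u \<in> borel_measurable borel" and u: "\<And>x. 0 \<le> u x"
    and "1 < p" and fin: "(\<integral>\<^sup>+x. ennreal (u x powr p) \<partial>lborel) < top" and "0 < l"
  shows "emeasure lborel {x. ennreal l < maxfun (\<lambda>x. ennreal (u x)) x}
     \<le> ennreal (2 * 5 ^ DIM('a) / l) * (\<integral>\<^sup>+x. ennreal (u x) * indicator {x. l / 2 < u x} x \<partial>lborel)"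
proof -
  define h1 where "h1 x = ennreal (u x) * indicator {x. l / 2 < u x} x" for x
  have [measurable]: "h1 \<in> borel_measurable borel" unfolding h1_def[abs_def] by measurable
  have h1_fin: "(\<integral>\<^sup>+x. h1 x \<partial>lborel) < top"
  proof -
    have "(\<integral>\<^sup>+x. h1 x \<partial>lborel) \<le> (\<integral>\<^sup>+x. ennreal ((l/2) powr (1 - p)) * ennreal (u x powr p) \<partial>lborel)"
    proof (rule nn_integral_mono)
      fix x
      show "h1 x \<le> ennreal ((l/2) powr (1 - p)) * ennreal (u x powr p)"
      proof (cases "l / 2 < u x")
        case True
        then have "u x = u x powr (1 - p) * u x powr p" using \<open>0 < l\<close> by (simp flip: powr_add)
        also have "\<dots> \<le> (l/2) powr (1 - p) * u x powr p"
          using True \<open>0 < l\<close> \<open>1 < p\<close> by (intro mult_right_mono powr_mono2') auto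
        finally show ?thesis using True u by (simp add: h1_def ennreal_leI flip: ennreal_mult)
      qed (simp add: h1_def)
    qed
    also have "\<dots> < top" using fin by (simp add: nn_integral_cmult ennreal_mult_less_top)
    finally show ?thesis .
  qed
  have "emeasure lborel {x. ennreal l < maxfun (\<lambda>x. ennreal (u x)) x} \<le> emeasure lborel {x. ennreal (l/2) < maxfun h1 x}"
  proof (intro emeasure_mono subsetI CollectI)
    fix x assume "x \<in> {x. ennreal l < maxfun (\<lambda>x. ennreal (u x)) x}"
    moreover have "maxfun (\<lambda>x. ennreal (u x)) x \<le> maxfun h1 x + ennreal (l/2)"
      by (intro maxfun_add_const_le) (auto simp: h1_def split: split_indicator intro: ennreal_leI)
    ultimately have "ennreal (l/2) + ennreal (l/2) < maxfun h1 x + ennreal (l/2)"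
      using \<open>0 < l\<close> by (simp flip: ennreal_plus)
    then show "ennreal (l/2) < maxfun h1 x"
      by (meson add_right_mono linorder_not_less)
  qed auto
  also have "\<dots> = ennreal (2 / l) * (ennreal (l / 2) * emeasure lborel {x. ennreal (l/2) < maxfun h1 x})"
    using \<open>0 < l\<close> by (simp add: mult.assoc[symmetric] flip: ennreal_mult)
  also have "\<dots> \<le> ennreal (2 / l) * (5 ^ DIM('a) * (\<integral>\<^sup>+x. h1 x \<partial>lborel))"
    using maxfun_weak_type[of h1 "l/2"] h1_fin \<open>0 < l\<close> by (intro mult_left_mono) auto
  also have "\<dots> = ennreal (2 * 5 ^ DIM('a) / l) * (\<integral>\<^sup>+x. h1 x \<partial>lborel)"
  proof -
    have "(5 ^ DIM('a) :: ennreal) = ennreal (5 ^ DIM('a))" by (simp flip: ennreal_power)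
    then show ?thesis using \<open>0 < l\<close> by (simp add: mult.assoc[symmetric] flip: ennreal_mult)
  qed
  finally show ?thesis unfolding h1_def .
qed

text \<open>Marcinkiewicz interpolation between the weak type bound and the trivial bound by the
  supremum. After Fubini the inner integral is that of l^(p-2) over 0 < l < 2 u(x), which converges
  because p > 1 and produces the factor 2^(p-1) / (p-1) of \<open>C\<close>.\<close>

lemma maxfun_strong_type:
  assumes "1 < p"
  obtains C :: real where "0 < C"
    "\<And>u :: 'a::euclidean_space \<Rightarrow> real. u \<in> borel_measurable borel \<Longrightarrow> (\<And>x. 0 \<le> u x) \<Longrightarrow>
       (\<integral>\<^sup>+x. epowr (maxfun (\<lambda>x. ennreal (u x)) x) p \<partial>lborel) \<le> ennreal C * (\<integral>\<^sup>+x. ennreal (u x powr p) \<partial>lborel)"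
proof -
  define D where "D = 2 * 5 ^ DIM('a) * p"
  define C where "C = D * (2 powr (p - 1) / (p - 1))"
  have "0 < D" "0 < C" using assms by (auto simp: D_def C_def)
  moreover have "(\<integral>\<^sup>+x. epowr (maxfun (\<lambda>x. ennreal (u x)) x) p \<partial>lborel) \<le> ennreal C * (\<integral>\<^sup>+x. ennreal (u x powr p) \<partial>lborel)"
    if [measurable]: "u \<in> borel_measurable borel" and u: "\<And>x. 0 \<le> u x" for u :: "'a \<Rightarrow> real"
  proof (cases "(\<integral>\<^sup>+x. ennreal (u x powr p) \<partial>lborel) < top")
    case False
    then have "(\<integral>\<^sup>+x. ennreal (u x powr p) \<partial>lborel) = top" by (simp add: less_top[symmetric])
    then show ?thesis using \<open>0 < C\<close> by (simp add: ennreal_mult_top)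
  next
    case fin: True
    let ?m = "maxfun (\<lambda>x. ennreal (u x))"
    have m: "?m \<in> borel_measurable borel" by measurable
    have "(\<integral>\<^sup>+x. epowr (?m x) p \<partial>lborel)
      = (\<integral>\<^sup>+x. (\<integral>\<^sup>+l\<in>{0<..}. ennreal (p * l powr (p - 1)) * indicator {l. ennreal l < ?m x} l \<partial>lborel) \<partial>lborel)"
      using assms by (simp add: epowr_layer_cake)
    also have "\<dots> = (\<integral>\<^sup>+l. (\<integral>\<^sup>+x. ennreal (p * l powr (p - 1)) * indicator {l. ennreal l < ?m x} l * indicator {0<..} l \<partial>lborel) \<partial>lborel)"
      using m by (intro lborel_pair.Fubini') measurable
    also have "\<dots> = (\<integral>\<^sup>+l. ennreal (p * l powr (p - 1)) * indicator {0<..} l * emeasure lborel {x. ennreal l < ?m x} \<partial>lborel)"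
    proof (rule nn_integral_cong)
      fix l :: real
      have "(\<integral>\<^sup>+x. ennreal (p * l powr (p - 1)) * indicator {l. ennreal l < ?m x} l * indicator {0<..} l \<partial>lborel)
        = (\<integral>\<^sup>+x. ennreal (p * l powr (p - 1)) * indicator {0<..} l * indicator {x. ennreal l < ?m x} x \<partial>lborel)"
        by (intro nn_integral_cong) (auto split: split_indicator)
      also have "\<dots> = ennreal (p * l powr (p - 1)) * indicator {0<..} l * emeasure lborel {x. ennreal l < ?m x}"
        using m by (subst nn_integral_cmult_indicator) auto
      finally show "(\<integral>\<^sup>+x. ennreal (p * l powr (p - 1)) * indicator {l. ennreal l < ?m x} l * indicator {0<..} l \<partial>lborel) = \<dots>" .
    qed
    also have "\<dots> \<le> (\<integral>\<^sup>+l. (\<integral>\<^sup>+x. ennreal (D * l powr (p - 2)) * indicator {0<..} l * (ennreal (u x) * indicator {x. l / 2 < u x} x) \<partial>lborel) \<partial>lborel)"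
    proof (rule nn_integral_mono)
      fix l :: real
      show "ennreal (p * l powr (p - 1)) * indicator {0<..} l * emeasure lborel {x. ennreal l < ?m x}
        \<le> (\<integral>\<^sup>+x. ennreal (D * l powr (p - 2)) * indicator {0<..} l * (ennreal (u x) * indicator {x. l / 2 < u x} x) \<partial>lborel)"
      proof (cases "0 < l")
        case True
        have "ennreal (p * l powr (p - 1)) * emeasure lborel {x. ennreal l < ?m x}
          \<le> ennreal (p * l powr (p - 1)) * (ennreal (2 * 5 ^ DIM('a) / l) * (\<integral>\<^sup>+x. ennreal (u x) * indicator {x. l / 2 < u x} x \<partial>lborel))"
          by (intro mult_left_mono maxfun_level_set_le[OF _ u assms fin True]) auto
        also have "ennreal (p * l powr (p - 1)) * (ennreal (2 * 5 ^ DIM('a) / l) * K) = ennreal (D * l powr (p - 2)) * K" for K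
        proof -
          have "l powr (p - 1) / l = l powr (p - 2)" using True by (simp add: powr_diff field_simps power2_eq_square)
          then have "p * l powr (p - 1) * (2 * 5 ^ DIM('a) / l) = D * l powr (p - 2)"
            unfolding D_def by (metis (no_types, opaque_lifting) mult.commute mult.left_commute times_divide_eq_right)
          then show ?thesis using True assms by (simp add: mult.assoc[symmetric] flip: ennreal_mult)
        qed
        finally show ?thesis using True by (simp add: nn_integral_cmult)
      qed simp
    qed
    also have "\<dots> = (\<integral>\<^sup>+x. (\<integral>\<^sup>+l. ennreal (D * l powr (p - 2)) * indicator {0<..} l * (ennreal (u x) * indicator {x. l / 2 < u x} x) \<partial>lborel) \<partial>lborel)"
      by (intro lborel_pair.Fubini') measurable
    also have "\<dots> = (\<integral>\<^sup>+x. ennreal C * ennreal (u x powr p) \<partial>lborel)"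
    proof (rule nn_integral_cong)
      fix x
      have "(\<integral>\<^sup>+l. ennreal (D * l powr (p - 2)) * indicator {0<..} l * (ennreal (u x) * indicator {x. l / 2 < u x} x) \<partial>lborel)
          = (\<integral>\<^sup>+l. ennreal (D * u x) * (ennreal (l powr (p - 2)) * indicator {0<..<2 * u x} l) \<partial>lborel)"
        using \<open>0 < D\<close> u by (intro nn_integral_cong) (auto split: split_indicator simp: mult_ac simp flip: ennreal_mult)
      also have "\<dots> = ennreal (D * u x) * ennreal ((2 * u x) powr (p - 1) / (p - 1))"
        using assms u nn_integral_powr_from_0[of "p - 2" "2 * u x"] by (simp add: nn_integral_cmult)
      also have "\<dots> = ennreal C * ennreal (u x powr p)"
      proof -
        have "u x * u x powr (p - 1) = u x powr p" using u[of x] by (cases "u x = 0") (auto simp: powr_diff)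
        then have "D * u x * ((2 * u x) powr (p - 1) / (p - 1)) = C * u x powr p"
          using u by (simp add: powr_mult C_def mult_ac)
        then show ?thesis using \<open>0 < D\<close> \<open>0 < C\<close> u assms by (simp flip: ennreal_mult)
      qed
      finally show "(\<integral>\<^sup>+l. ennreal (D * l powr (p - 2)) * indicator {0<..} l * (ennreal (u x) * indicator {x. l / 2 < u x} x) \<partial>lborel)
         = ennreal C * ennreal (u x powr p)" .
    qed
    finally show ?thesis by (simp add: nn_integral_cmult)
  qed
  ultimately show ?thesis using that by blast
qed

section \<open>Mean oscillation on balls\<close>

lemma powr_add_le:
  fixes a b p :: real
  assumes "0 \<le> a" "0 \<le> b" "0 \<le> p"
  shows "(a + b) powr p \<le> 2 powr p * (a powr p + b powr p)"
proof -
  have "(a + b) powr p \<le> (2 * max a b) powr p"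
    using assms by (intro powr_mono2) auto
  also have "\<dots> = 2 powr p * max a b powr p" using assms by (simp add: powr_mult)
  also have "\<dots> \<le> 2 powr p * (a powr p + b powr p)"
    by (intro mult_left_mono) (auto simp: max_def)
  finally show ?thesis .
qed

definition ball_avg :: "('a::euclidean_space \<Rightarrow> real) \<Rightarrow> 'a \<Rightarrow> real \<Rightarrow> real" where
  "ball_avg b x t = (\<integral>y. indicator (cball x t) y * b y \<partial>lborel) / measure lborel (cball x t)"

definition loc_integrable :: "('a::euclidean_space \<Rightarrow> real) \<Rightarrow> bool" where
  "loc_integrable b \<longleftrightarrow> b \<in> borel_measurable borel \<and> (\<forall>x t. integrable lborel (\<lambda>y. indicator (cball x t) y * b y))"

text \<open>Bounded mean oscillation on balls with an explicit bound \<open>K\<close> in place of a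
  supremum over cubes. Constants obtained under this predicate depend on \<open>K\<close> but not on
  \<open>b\<close>.\<close>

definition ball_osc_le :: "real \<Rightarrow> ('a::euclidean_space \<Rightarrow> real) \<Rightarrow> bool" where
  "ball_osc_le K b \<longleftrightarrow> loc_integrable b \<and> (\<forall>x t. 0 < t \<longrightarrow>
     (\<integral>\<^sup>+y\<in>cball x t. ennreal \<bar>b y - ball_avg b x t\<bar> \<partial>lborel) \<le> ennreal K * emeasure lborel (cball x t))"

lemma loc_integrableD:
  assumes "loc_integrable b"
  shows "b \<in> borel_measurable borel" "integrable lborel (\<lambda>y. indicator (cball x t) y * b y)"
  using assms by (auto simp: loc_integrable_def)

lemma ball_osc_leD:
  assumes "ball_osc_le K b"
  shows "loc_integrable b" "b \<in> borel_measurable borel"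
    "0 < t \<Longrightarrow> (\<integral>\<^sup>+y\<in>cball x t. ennreal \<bar>b y - ball_avg b x t\<bar> \<partial>lborel) \<le> ennreal K * emeasure lborel (cball x t)"
  using assms by (auto simp: ball_osc_le_def loc_integrable_def)

lemma integrable_indicator_cball: "integrable lborel (indicat_real (cball (x::'a::euclidean_space) t))"
  by (intro integrable_real_indicator) (use emeasure_lborel_cball_finite[of x t] in \<open>auto simp: less_top\<close>)

lemma emeasure_cball_eq_measure: "emeasure lborel (cball (x::'a::euclidean_space) t) = ennreal (measure lborel (cball x t))"
  by (intro emeasure_eq_ennreal_measure) (use emeasure_lborel_cball_finite[of x t] in auto)

lemma ball_avg_minus_le:
  fixes x :: "'a::euclidean_space"
  assumes b: "loc_integrable b" and t: "0 < t"
  shows "ennreal \<bar>ball_avg b x t - c\<bar> * emeasure lborel (cball x t) \<le> (\<integral>\<^sup>+y\<in>cball x t. ennreal \<bar>b y - c\<bar> \<partial>lborel)"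
proof -
  let ?m = "measure lborel (cball x t)"
  have m: "0 < ?m" using t by simp
  have int: "integrable lborel (\<lambda>y. indicator (cball x t) y * (b y - c))"
    using loc_integrableD(2)[OF b, of x t] integrable_indicator_cball[of x t]
    by (simp add: right_diff_distrib)
  have "(\<integral>y. indicator (cball x t) y * (b y - c) \<partial>lborel) = (ball_avg b x t - c) * ?m"
    using loc_integrableD(2)[OF b, of x t] integrable_indicator_cball[of x t] m
    by (simp add: right_diff_distrib ball_avg_def field_simps)
  then have "ennreal \<bar>ball_avg b x t - c\<bar> * emeasure lborel (cball x t) = ennreal (norm (\<integral>y. indicator (cball x t) y * (b y - c) \<partial>lborel))"
    using m by (simp add: emeasure_cball_eq_measure abs_mult flip: ennreal_mult)
  also have "\<dots> \<le> (\<integral>\<^sup>+y. ennreal (norm (indicator (cball x t) y * (b y - c))) \<partial>lborel)"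
    by (rule integral_norm_bound_ennreal[OF int])
  also have "\<dots> = (\<integral>\<^sup>+y\<in>cball x t. ennreal \<bar>b y - c\<bar> \<partial>lborel)"
    by (intro nn_integral_cong) (auto split: split_indicator)
  finally show ?thesis .
qed

text \<open>Up to the factor 2 the mean is as good as any other constant \<open>c\<close>; this
  permits comparison with a truncated mean or with the mean over a surrounding cube.\<close>

lemma ball_osc_le_const:
  fixes x :: "'a::euclidean_space"
  assumes b: "loc_integrable b" and t: "0 < t"
  shows "(\<integral>\<^sup>+y\<in>cball x t. ennreal \<bar>b y - ball_avg b x t\<bar> \<partial>lborel) \<le> 2 * (\<integral>\<^sup>+y\<in>cball x t. ennreal \<bar>b y - c\<bar> \<partial>lborel)"
proof -
  have [measurable]: "b \<in> borel_measurable borel" using b by (rule loc_integrableD)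
  have "(\<integral>\<^sup>+y\<in>cball x t. ennreal \<bar>b y - ball_avg b x t\<bar> \<partial>lborel)
     \<le> (\<integral>\<^sup>+y. ennreal \<bar>b y - c\<bar> * indicator (cball x t) y + ennreal \<bar>ball_avg b x t - c\<bar> * indicator (cball x t) y \<partial>lborel)"
    by (intro nn_integral_mono) (auto split: split_indicator simp flip: ennreal_plus intro!: ennreal_leI)
  also have "\<dots> = (\<integral>\<^sup>+y\<in>cball x t. ennreal \<bar>b y - c\<bar> \<partial>lborel) + ennreal \<bar>ball_avg b x t - c\<bar> * emeasure lborel (cball x t)"
    by (subst nn_integral_add) (auto simp: nn_integral_cmult)
  also have "\<dots> \<le> (\<integral>\<^sup>+y\<in>cball x t. ennreal \<bar>b y - c\<bar> \<partial>lborel) + (\<integral>\<^sup>+y\<in>cball x t. ennreal \<bar>b y - c\<bar> \<partial>lborel)"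
    by (intro add_left_mono ball_avg_minus_le b t)
  finally show ?thesis by (simp add: mult_2)
qed

section \<open>Truncation\<close>

definition trunc :: "real \<Rightarrow> real \<Rightarrow> real" where
  "trunc N y = max (- N) (min N y)"

lemma abs_trunc_le: "0 \<le> N \<Longrightarrow> \<bar>trunc N y\<bar> \<le> N" "0 \<le> N \<Longrightarrow> \<bar>trunc N y\<bar> \<le> \<bar>y\<bar>"
  and trunc_diff_le: "\<bar>trunc N y - trunc N z\<bar> \<le> \<bar>y - z\<bar>"
  by (auto simp: trunc_def max_def min_def)

lemma loc_integrable_trunc:
  assumes b: "loc_integrable b" and "0 \<le> N"
  shows "loc_integrable (\<lambda>y. trunc N (b y))"
  unfolding loc_integrable_def
proof (intro conjI allI)
  have [measurable]: "b \<in> borel_measurable borel" using b by (rule loc_integrableD)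
  show "(\<lambda>y. trunc N (b y)) \<in> borel_measurable borel" unfolding trunc_def by measurable
  then have [measurable]: "(\<lambda>y. trunc N (b y)) \<in> borel_measurable borel" .
  fix x t
  show "integrable lborel (\<lambda>y. indicator (cball x t) y * trunc N (b y))"
    using loc_integrableD(2)[OF b, of x t]
    by (rule Bochner_Integration.integrable_bound)
      (auto split: split_indicator intro!: abs_trunc_le assms)
qed

text \<open>Truncation is 1-Lipschitz, so the truncated mean serves as comparison constant; passing
  from it to the mean of the truncation costs the factor 2, whatever \<open>N\<close> is.\<close>

lemma ball_osc_le_trunc:
  assumes b: "ball_osc_le K b" and "0 \<le> N" "0 \<le> K"
  shows "ball_osc_le (2 * K) (\<lambda>y. trunc N (b y))"
  unfolding ball_osc_le_def
proof (intro conjI allI impI)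
  have loc: "loc_integrable (\<lambda>y. trunc N (b y))"
    by (rule loc_integrable_trunc[OF ball_osc_leD(1)[OF b] \<open>0 \<le> N\<close>])
  then show "loc_integrable (\<lambda>y. trunc N (b y))" .
  fix x and t :: real assume t: "0 < t"
  have "(\<integral>\<^sup>+y\<in>cball x t. ennreal \<bar>trunc N (b y) - ball_avg (\<lambda>y. trunc N (b y)) x t\<bar> \<partial>lborel)
    \<le> 2 * (\<integral>\<^sup>+y\<in>cball x t. ennreal \<bar>trunc N (b y) - trunc N (ball_avg b x t)\<bar> \<partial>lborel)"
    by (rule ball_osc_le_const[OF loc t])
  also have "\<dots> \<le> 2 * (\<integral>\<^sup>+y\<in>cball x t. ennreal \<bar>b y - ball_avg b x t\<bar> \<partial>lborel)"
    by (intro mult_left_mono nn_integral_mono mult_right_mono ennreal_leI trunc_diff_le) auto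
  also have "\<dots> \<le> 2 * (ennreal K * emeasure lborel (cball x t))"
    by (intro mult_left_mono ball_osc_leD(3)[OF b t]) auto
  finally show "(\<integral>\<^sup>+y\<in>cball x t. ennreal \<bar>trunc N (b y) - ball_avg (\<lambda>y. trunc N (b y)) x t\<bar> \<partial>lborel)
     \<le> ennreal (2 * K) * emeasure lborel (cball x t)"
    using \<open>0 \<le> K\<close> by (simp add: ennreal_mult mult.assoc)
qed

section \<open>Lebesgue differentiation\<close>

lemma corner_cube_subset_cball:
  fixes x :: "'a::euclidean_space"
  assumes "0 \<le> h"
  shows "cbox x (x + h *\<^sub>R One) \<subseteq> cball x (real DIM('a) * h)"
proof
  fix y assume y: "y \<in> cbox x (x + h *\<^sub>R One)"
  have "dist x y = norm (y - x)" by (simp add: dist_norm norm_minus_commute)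
  also have "\<dots> \<le> (\<Sum>i\<in>Basis. \<bar>(y - x) \<bullet> i\<bar>)" by (rule norm_le_l1)
  also have "\<dots> \<le> (\<Sum>i\<in>(Basis::'a set). h)"
  proof (rule sum_mono)
    fix i :: 'a assume "i \<in> Basis"
    then show "\<bar>(y - x) \<bullet> i\<bar> \<le> h"
      using y by (auto simp: mem_box inner_simps abs_le_iff)
  qed
  finally show "y \<in> cball x (real DIM('a) * h)" by simp
qed

text \<open>Lebesgue differentiation over cubes that have x as a corner. Such a cube of side h lies
  in the ball of radius n h about x, whose volume is V n^n times that of the cube; this ratio is the
  constant in front of \<open>l\<close>. The contrapositive is what gets used: where no small ball
  has a large average, |b - c| is bounded almost everywhere.\<close>

lemma AE_large_value_large_ball_average:
  fixes b :: "'a::euclidean_space \<Rightarrow> real"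
  assumes b: "loc_integrable b"
  shows "AE x in lborel. \<forall>l t0. 0 < l \<longrightarrow> 0 < t0 \<longrightarrow>
    unit_ball_vol (real DIM('a)) * real DIM('a) ^ DIM('a) * l < \<bar>b x - c\<bar> \<longrightarrow>
     (\<exists>t. 0 < t \<and> t \<le> t0 \<and> ennreal l * emeasure lborel (cball x t) < (\<integral>\<^sup>+y\<in>cball x t. ennreal \<bar>b y - c\<bar> \<partial>lborel))"
proof -
  define f where "f y = \<bar>b y - c\<bar>" for y
  define n where "n = real DIM('a)"
  define V where "V = unit_ball_vol (real DIM('a))"
  have pos: "0 < n" "0 < V" by (auto simp: n_def V_def)
  have [measurable]: "b \<in> borel_measurable borel" using b by (rule loc_integrableD)
  have f_int: "f integrable_on cbox u v" for u v
  proof -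
    obtain r where r: "cbox u v \<subseteq> cball 0 r"
      using bounded_subset_ballD[OF bounded_cbox, of u v 0] ball_subset_cball by blast
    have "integrable lborel (\<lambda>y. indicator (cball 0 r) y * (b y - c))"
      using loc_integrableD(2)[OF b, of 0 r] integrable_indicator_cball[of "0::'a" r]
      by (simp add: right_diff_distrib)
    then have "integrable lborel (\<lambda>y. indicat_real (cbox u v) y *\<^sub>R f y)"
      by (rule Bochner_Integration.integrable_bound)
        (use subsetD[OF r] in \<open>auto simp: f_def split: split_indicator intro!: AE_I2\<close>)
    then show ?thesis
      using set_borel_integral_eq_integral(1)[of "cbox u v" f] by (simp add: set_integrable_def)
  qed
  obtain Z where Z: "negligible Z"
    "\<And>x e. \<lbrakk>x \<notin> Z; 0 < e\<rbrakk> \<Longrightarrow> \<exists>d>0. \<forall>h. 0 < h \<and> h < d \<longrightarrow>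
        norm (integral (cbox x (x + h *\<^sub>R One)) f /\<^sub>R h ^ DIM('a) - f x) < e"
    using integrable_ccontinuous_explicit[OF f_int] by blast
  have "\<exists>t. 0 < t \<and> t \<le> t0 \<and> ennreal l * emeasure lborel (cball x t) < (\<integral>\<^sup>+y\<in>cball x t. ennreal (f y) \<partial>lborel)"
    if x: "x \<notin> Z" and l: "0 < l" and t0: "0 < t0" and big: "V * n ^ DIM('a) * l < f x" for x l t0
  proof -
    obtain d where d: "0 < d" "\<And>h. 0 < h \<Longrightarrow> h < d \<Longrightarrow>
        norm (integral (cbox x (x + h *\<^sub>R One)) f /\<^sub>R h ^ DIM('a) - f x) < f x - V * n ^ DIM('a) * l"
      using Z(2)[OF x, of "f x - V * n ^ DIM('a) * l"] big by auto
    define h where "h = min (d / 2) (t0 / n)"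
    have h: "0 < h" "h < d" "n * h \<le> t0" using d t0 pos by (auto simp: h_def min_def field_simps)
    let ?I = "integral (cbox x (x + h *\<^sub>R One)) f"
    have "V * n ^ DIM('a) * l < ?I / h ^ DIM('a)"
      using d(2)[OF h(1,2)] by (simp add: field_simps)
    then have I: "l * (V * (n * h) ^ DIM('a)) < ?I" using h by (simp add: field_simps power_mult_distrib)
    have "ennreal l * emeasure lborel (cball x (n * h)) = ennreal (l * (V * (n * h) ^ DIM('a)))"
      using h pos l by (simp add: emeasure_cball V_def flip: ennreal_mult)
    also have "\<dots> < ennreal ?I"
      using I l pos h by (subst ennreal_less_iff) auto
    also have "\<dots> = (\<integral>\<^sup>+y\<in>cbox x (x + h *\<^sub>R One). ennreal (f y) \<partial>lborel)"
      by (rule nn_integral_has_integral_lebesgue'[OF _ integrable_integral[OF f_int], symmetric]) (simp add: f_def)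
    also have "\<dots> \<le> (\<integral>\<^sup>+y\<in>cball x (n * h). ennreal (f y) \<partial>lborel)"
      using corner_cube_subset_cball[of h x] h
      by (intro nn_integral_mono) (auto split: split_indicator simp: n_def)
    finally show ?thesis using h pos by (intro exI[of _ "n * h"]) auto
  qed
  moreover have "AE x in lborel. x \<notin> Z"
    using Z(1) AE_not_in[of Z lebesgue] by (simp add: negligible_iff_null_sets AE_completion_iff)
  ultimately show ?thesis
    unfolding f_def n_def V_def by (auto elim!: eventually_mono)
qed

section \<open>Moments of the oscillation (John--Nirenberg)\<close>

definition moment_le :: "('a::euclidean_space \<Rightarrow> real) \<Rightarrow> real \<Rightarrow> real \<Rightarrow> bool" where
  "moment_le b P A \<longleftrightarrow> (\<forall>x t. 0 < t \<longrightarrow>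
     (\<integral>\<^sup>+y\<in>cball x t. ennreal (\<bar>b y - ball_avg b x t\<bar> powr P) \<partial>lborel) \<le> ennreal A * emeasure lborel (cball x t))"

lemma ennreal_cancel_cball:
  fixes x :: "'a::euclidean_space"
  assumes "ennreal a * emeasure lborel (cball x t) \<le> ennreal c * emeasure lborel (cball x t)" "0 < t" "0 \<le> c"
  shows "a \<le> c"
proof (rule ccontr)
  assume "\<not> a \<le> c"
  then have "ennreal c * emeasure lborel (cball x t) < ennreal a * emeasure lborel (cball x t)"
    using assms by (simp add: emeasure_cball_eq_measure ennreal_less_iff flip: ennreal_mult)
  then show False using assms(1) by simp
qed

text \<open>
  One stopping-time step: the set where \<open>b\<close> is far from its mean is covered by balls of small total
  measure on which the mean of \<open>b\<close> moves by at most \<open>l\<close>, so the same moment bound \<open>A\<close> can be reused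
  there with the factor \<open>1/2\<close>.
\<close>
lemma moment_improve:
  fixes b :: "'a::euclidean_space \<Rightarrow> real"
  defines "\<Gamma> \<equiv> unit_ball_vol (real DIM('a)) * real DIM('a) ^ DIM('a)"
  assumes b: "ball_osc_le K b" and K: "0 < K" and P: "0 < P" and A: "0 \<le> A" "moment_le b P A"
    and l: "l = 2 * 4 powr P * 10 ^ DIM('a) * K"
  shows "moment_le b P (2 powr P * ((\<Gamma> * l) powr P + (K * 2 ^ DIM('a)) powr P) + l powr P / 2 + A / 2)"
  unfolding moment_le_def
proof (intro allI impI)
  fix x0 :: 'a and t0 :: real assume t0: "0 < t0"
  have loc: "loc_integrable b" and [measurable]: "b \<in> borel_measurable borel"
    using ball_osc_leD[OF b] by auto
  define n where "n = DIM('a)"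
  have l_pos: "0 < l" using K by (simp add: l)
  have \<Gamma>_pos: "0 \<le> \<Gamma>" by (simp add: \<Gamma>_def)
  define em where "em x t = emeasure lborel (cball x t)" for x :: 'a and t
  \<comment> \<open>The doubled ball contains \<open>cball x t\<close> for all x in the original
    ball and all t <= t0, so every ball of the stopping argument is measured against one
    constant.\<close>
  define c where "c = ball_avg b x0 (2 * t0)"
  define h where "h y = ennreal \<bar>b y - c\<bar>" for y
  define hP where "hP y = ennreal (\<bar>b y - c\<bar> powr P)" for y
  have [measurable]: "h \<in> borel_measurable borel" "hP \<in> borel_measurable borel"
    unfolding h_def[abs_def] hP_def[abs_def] by measurable
  have em_scale: "em x (k * t) = ennreal (k ^ n) * em y t" if "0 \<le> t" "0 \<le> k" for x y t k
    unfolding em_def n_def by (rule emeasure_cball_scale[OF that])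
  have hBs: "(\<integral>\<^sup>+y\<in>cball x0 (2 * t0). h y \<partial>lborel) \<le> ennreal (K * 2 ^ n) * em x0 t0"
    using ball_osc_leD(3)[OF b, of "2 * t0" x0] t0 em_scale[of t0 2 x0 x0] K
    by (simp add: h_def c_def em_def ennreal_mult mult.assoc)
  \<comment> \<open>The bad points. In the rest of \<open>cball x0 t0\<close> the differentiation
    lemma gives |b - c| <= \<Gamma> l almost everywhere.\<close>
  define E where "E = {x \<in> cball x0 t0. \<exists>t. 0 < t \<and> t \<le> t0 \<and> ennreal l * em x t < (\<integral>\<^sup>+y\<in>cball x t. h y \<partial>lborel)}"
  have sub: "cball x t \<subseteq> cball x0 (2 * t0)" if "x \<in> cball x0 t0" "t \<le> t0" for x t
    using that by (auto simp: subset_iff) (smt (verit) dist_triangle)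
  have "\<exists>t. 0 < t \<and> 5 * t \<le> t0 \<and> ennreal l * em x t \<le> (\<integral>\<^sup>+y\<in>cball x t. h y \<partial>lborel) \<and>
      (\<integral>\<^sup>+y\<in>cball x (5 * t). h y \<partial>lborel) \<le> ennreal l * em x (5 * t)" if "x \<in> E" for x
  proof -
    \<comment> \<open>a radius within a factor 5 of the supremum of those with large average: five times it is no longer such a radius\<close>
    define S where "S = {t. 0 < t \<and> t \<le> t0 \<and> ennreal l * em x t < (\<integral>\<^sup>+y\<in>cball x t. h y \<partial>lborel)}"
    have x: "x \<in> cball x0 t0" using \<open>x \<in> E\<close> by (simp add: E_def)
    \<comment> \<open>If 5 t > t0, the ball is comparable to the doubled one: the average of
      \<open>h\<close> over it is at most 10^n K, and \<open>l\<close> is at least that.\<close>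
    have small: "5 * t \<le> t0" if "t \<in> S" for t
    proof (rule ccontr)
      assume *: "\<not> 5 * t \<le> t0"
      have t: "0 < t" "t \<le> t0" using that by (auto simp: S_def)
      have "ennreal l * em x t < (\<integral>\<^sup>+y\<in>cball x t. h y \<partial>lborel)" using that by (simp add: S_def)
      also have "\<dots> \<le> (\<integral>\<^sup>+y\<in>cball x0 (2 * t0). h y \<partial>lborel)"
        using sub[OF x t(2)] by (intro nn_integral_mono) (auto split: split_indicator)
      also have "\<dots> \<le> ennreal (K * 2 ^ n) * em x0 t0" by (rule hBs)
      also have "\<dots> \<le> ennreal (K * 2 ^ n) * em x0 (5 * t)"
        using * unfolding em_def by (intro mult_left_mono emeasure_mono) auto
      also have "\<dots> = ennreal (K * 2 ^ n * 5 ^ n) * em x t"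
        using t K by (subst em_scale[of t 5 x0 x]) (auto simp: ennreal_mult mult.assoc)
      also have "\<dots> \<le> ennreal l * em x t"
      proof (intro mult_right_mono ennreal_leI)
        have "(2::real) ^ n * 5 ^ n = 10 ^ n" by (simp flip: power_mult_distrib)
        moreover have "1 \<le> 2 * (4::real) powr P" using P ge_one_powr_ge_zero[of 4 P] by linarith
        then have "1 * (10 ^ n * K) \<le> 2 * (4::real) powr P * (10 ^ n * K)"
          using K by (intro mult_right_mono) auto
        ultimately show "K * 2 ^ n * 5 ^ n \<le> l" by (simp add: l n_def mult_ac)
      qed auto
      finally show False by simp
    qed
    have S: "S \<noteq> {}" "bdd_above S" using \<open>x \<in> E\<close> by (auto simp: E_def S_def bdd_above_def)
    obtain s where "s \<in> S" using S by blast
    then have "0 < s" "s \<le> Sup S" using cSup_upper[OF _ S(2)] by (auto simp: S_def)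
    then have "Sup S / 5 < Sup S" by simp
    then obtain t where t: "t \<in> S" "Sup S / 5 < t" using less_cSupE[of "Sup S / 5" S] S by auto
    have "5 * t \<notin> S" using t cSup_upper[OF _ S(2), of "5 * t"] by auto
    then have "(\<integral>\<^sup>+y\<in>cball x (5 * t). h y \<partial>lborel) \<le> ennreal l * em x (5 * t)"
      using small[OF t(1)] t(1) by (auto simp: S_def not_less)
    then show ?thesis using t small[OF t(1)] by (intro exI[of _ t]) (auto simp: S_def)
  qed
  then have "\<forall>x\<in>E. \<exists>t. 0 < t \<and> 5 * t \<le> t0 \<and> ennreal l * em x t \<le> (\<integral>\<^sup>+y\<in>cball x t. h y \<partial>lborel) \<and>
      (\<integral>\<^sup>+y\<in>cball x (5 * t). h y \<partial>lborel) \<le> ennreal l * em x (5 * t)" by blast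
  from bchoice[OF this] obtain t where t: "\<And>x. x \<in> E \<Longrightarrow> 0 < t x" "\<And>x. x \<in> E \<Longrightarrow> 5 * t x \<le> t0"
    "\<And>x. x \<in> E \<Longrightarrow> ennreal l * em x (t x) \<le> (\<integral>\<^sup>+y\<in>cball x (t x). h y \<partial>lborel)"
    "\<And>x. x \<in> E \<Longrightarrow> (\<integral>\<^sup>+y\<in>cball x (5 * t x). h y \<partial>lborel) \<le> ennreal l * em x (5 * t x)"
    by auto
  have t_le: "0 < t x \<and> t x \<le> t0" if "x \<in> E" for x using t(1,2)[OF that] by auto
  have t_sub: "cball x (t x) \<subseteq> cball x0 (2 * t0)" if "x \<in> E" for x
    using sub[of x "t x"] t_le[OF that] that by (simp add: E_def)
  obtain J where J: "countable J" "J \<subseteq> E" "E \<subseteq> (\<Union>x\<in>J. cball x (5 * t x))"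
    "(\<integral>\<^sup>+x. ennreal l * em x (t x) \<partial>count_space J) \<le> (\<integral>\<^sup>+y\<in>cball x0 (2 * t0). h y \<partial>lborel)"
    unfolding em_def
    by (rule vitali_selection[OF _ t_le t(3)[unfolded em_def] t_sub]) auto
  \<comment> \<open>Bounds the average of |b - c|^P over an enlarged ball: the moment bound
    \<open>A\<close> about the ball's own mean, plus the shift of at most \<open>l\<close> from that
    mean to \<open>c\<close>.\<close>
  define Q where "Q = 2 powr P * (A + l powr P)"
  have Q: "0 \<le> Q" using A by (simp add: Q_def)
  have each: "(\<integral>\<^sup>+y\<in>cball x (5 * t x). hP y \<partial>lborel) \<le> ennreal (Q * 5 ^ n) * em x (t x)" if "x \<in> J" for x
  proof -
    have x: "x \<in> E" "0 < 5 * t x" using that J(2) t(1) by auto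
    define d where "d = ball_avg b x (5 * t x)"
    \<comment> \<open>The fivefold radius is no longer a bad one, which keeps the mean over the
      enlarged ball within \<open>l\<close> of \<open>c\<close>.\<close>
    have "ennreal \<bar>d - c\<bar> * em x (5 * t x) \<le> ennreal l * em x (5 * t x)"
      using ball_avg_minus_le[OF loc x(2), of x c] t(4)[OF x(1)] by (simp add: em_def d_def h_def)
    then have d: "\<bar>d - c\<bar> \<le> l"
      using x(2) l_pos ennreal_cancel_cball[of "\<bar>d - c\<bar>" x "5 * t x" l] by (simp add: em_def)
    have "(\<integral>\<^sup>+y\<in>cball x (5 * t x). hP y \<partial>lborel)
      \<le> (\<integral>\<^sup>+y. ennreal (2 powr P) * (ennreal (\<bar>b y - d\<bar> powr P) * indicator (cball x (5 * t x)) y)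
             + ennreal (2 powr P * l powr P) * indicator (cball x (5 * t x)) y \<partial>lborel)"
    proof (rule nn_integral_mono)
      fix y
      have "\<bar>b y - c\<bar> powr P \<le> (\<bar>b y - d\<bar> + l) powr P"
        using d P by (intro powr_mono2) auto
      also have "\<dots> \<le> 2 powr P * (\<bar>b y - d\<bar> powr P + l powr P)"
        using l_pos P by (intro powr_add_le) auto
      finally have "hP y \<le> ennreal (2 powr P * (\<bar>b y - d\<bar> powr P) + 2 powr P * l powr P)"
        unfolding hP_def by (intro ennreal_leI) (simp add: distrib_left)
      then show "hP y * indicator (cball x (5 * t x)) y \<le> ennreal (2 powr P) * (ennreal (\<bar>b y - d\<bar> powr P) * indicator (cball x (5 * t x)) y)
             + ennreal (2 powr P * l powr P) * indicator (cball x (5 * t x)) y"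
        by (auto split: split_indicator simp: ennreal_mult)
    qed
    also have "\<dots> = ennreal (2 powr P) * (\<integral>\<^sup>+y\<in>cball x (5 * t x). ennreal (\<bar>b y - d\<bar> powr P) \<partial>lborel) + ennreal (2 powr P * l powr P) * em x (5 * t x)"
      unfolding em_def by (subst nn_integral_add) (auto simp: nn_integral_cmult)
    also have "\<dots> \<le> ennreal (2 powr P) * (ennreal A * em x (5 * t x)) + ennreal (2 powr P * l powr P) * em x (5 * t x)"
      using A(2) x(2) by (intro add_right_mono mult_left_mono) (auto simp: moment_le_def d_def em_def)
    also have "\<dots> = ennreal Q * em x (5 * t x)"
      using A by (simp add: Q_def distrib_left ennreal_mult mult.assoc distrib_right)
    also have "\<dots> = ennreal (Q * 5 ^ n) * em x (t x)"
      using x(2) Q by (subst em_scale[of "t x" 5 x x]) (auto simp: ennreal_mult mult.assoc)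
    finally show ?thesis .
  qed
  have tail: "(\<integral>\<^sup>+y\<in>(\<Union>x\<in>J. cball x (5 * t x)). hP y \<partial>lborel) \<le> ennreal (Q * 10 ^ n * K / l) * em x0 t0"
  proof -
    have "(\<integral>\<^sup>+y\<in>(\<Union>x\<in>J. cball x (5 * t x)). hP y \<partial>lborel) \<le> (\<integral>\<^sup>+x. (\<integral>\<^sup>+y\<in>cball x (5 * t x). hP y \<partial>lborel) \<partial>count_space J)"
      by (intro nn_integral_UN_countable_le J) auto
    also have "\<dots> \<le> (\<integral>\<^sup>+x. ennreal (Q * 5 ^ n / l) * (ennreal l * em x (t x)) \<partial>count_space J)"
    proof (intro nn_integral_mono)
      fix x assume x: "x \<in> space (count_space J)"
      have "ennreal (Q * 5 ^ n / l) * (ennreal l * em x (t x)) = ennreal (Q * 5 ^ n) * em x (t x)"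
        using l_pos Q by (simp add: mult.assoc[symmetric] flip: ennreal_mult)
      then show "(\<integral>\<^sup>+y\<in>cball x (5 * t x). hP y \<partial>lborel) \<le> ennreal (Q * 5 ^ n / l) * (ennreal l * em x (t x))"
        using each x by simp
    qed
    also have "\<dots> = ennreal (Q * 5 ^ n / l) * (\<integral>\<^sup>+x. ennreal l * em x (t x) \<partial>count_space J)"
      by (simp add: nn_integral_cmult)
    also have "\<dots> \<le> ennreal (Q * 5 ^ n / l) * (ennreal (K * 2 ^ n) * em x0 t0)"
      using order_trans[OF J(4) hBs] by (intro mult_left_mono) auto
    also have "\<dots> = ennreal (Q * 10 ^ n * K / l) * em x0 t0"
    proof -
      have "(5::real) ^ n * 2 ^ n = 10 ^ n" by (simp flip: power_mult_distrib)
      then have "Q * 5 ^ n / l * (K * 2 ^ n) = Q * 10 ^ n * K / l" by (simp add: field_simps)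
      then have "ennreal (Q * 5 ^ n / l) * ennreal (K * 2 ^ n) = ennreal (Q * 10 ^ n * K / l)"
        using Q l_pos K by (subst ennreal_mult[symmetric]) auto
      then show ?thesis by (simp add: mult.assoc[symmetric])
    qed
    finally show ?thesis .
  qed
  have main: "(\<integral>\<^sup>+y\<in>cball x0 t0. hP y \<partial>lborel) \<le> ennreal ((\<Gamma> * l) powr P + Q * 10 ^ n * K / l) * em x0 t0"
  proof -
    let ?U = "\<Union>x\<in>J. cball x (5 * t x)"
    have [measurable]: "?U \<in> sets borel" using J(1) by auto
    \<comment> \<open>The fivefold balls cover \<open>E\<close>, so a point outside their union is
      not bad and satisfies the almost everywhere bound.\<close>
    have "AE y in lborel. hP y * indicator (cball x0 t0) y
       \<le> ennreal ((\<Gamma> * l) powr P) * indicator (cball x0 t0) y + hP y * indicator ?U y"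
      using AE_large_value_large_ball_average[OF loc, of c]
    proof eventually_elim
      case (elim y)
      show ?case
      proof (cases "y \<in> cball x0 t0 \<and> y \<notin> ?U")
        case True
        then have "y \<notin> E" using J(3) by blast
        then have "\<not> (\<exists>t. 0 < t \<and> t \<le> t0 \<and> ennreal l * em y t < (\<integral>\<^sup>+z\<in>cball y t. h z \<partial>lborel))"
          using True by (auto simp: E_def)
        then have "\<not> \<Gamma> * l < \<bar>b y - c\<bar>"
          using elim l_pos t0 unfolding \<Gamma>_def em_def h_def by blast
        then have "\<bar>b y - c\<bar> powr P \<le> (\<Gamma> * l) powr P" using P by (intro powr_mono2) auto
        then show ?thesis using True by (simp add: hP_def ennreal_leI)
      next
        case False
        then show ?thesis by (cases "y \<in> cball x0 t0") (auto split: split_indicator)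
      qed
    qed
    then have "(\<integral>\<^sup>+y\<in>cball x0 t0. hP y \<partial>lborel)
      \<le> (\<integral>\<^sup>+y. ennreal ((\<Gamma> * l) powr P) * indicator (cball x0 t0) y + hP y * indicator ?U y \<partial>lborel)"
      by (rule nn_integral_mono_AE)
    also have "\<dots> = ennreal ((\<Gamma> * l) powr P) * em x0 t0 + (\<integral>\<^sup>+y\<in>?U. hP y \<partial>lborel)"
      unfolding em_def by (subst nn_integral_add) (auto simp: nn_integral_cmult)
    also have "\<dots> \<le> ennreal ((\<Gamma> * l) powr P) * em x0 t0 + ennreal (Q * 10 ^ n * K / l) * em x0 t0"
      by (intro add_left_mono tail)
    also have "\<dots> = ennreal ((\<Gamma> * l) powr P + Q * 10 ^ n * K / l) * em x0 t0"
      using Q K l_pos by (simp add: distrib_right)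
    finally show ?thesis .
  qed
  \<comment> \<open>The moment refers to the mean over the ball itself, so \<open>c\<close> is
    finally exchanged for \<open>d\<close>.\<close>
  define d where "d = ball_avg b x0 t0"
  have d: "\<bar>d - c\<bar> \<le> K * 2 ^ n"
  proof -
    have "ennreal \<bar>d - c\<bar> * em x0 t0 \<le> (\<integral>\<^sup>+y\<in>cball x0 t0. h y \<partial>lborel)"
      using ball_avg_minus_le[OF loc t0, of x0 c] by (simp add: em_def d_def h_def)
    also have "\<dots> \<le> (\<integral>\<^sup>+y\<in>cball x0 (2 * t0). h y \<partial>lborel)"
      using t0 by (intro nn_integral_mono) (auto split: split_indicator)
    also note hBs
    finally show ?thesis using t0 K ennreal_cancel_cball[of "\<bar>d - c\<bar>" x0 t0 "K * 2 ^ n"] by (simp add: em_def)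
  qed
  have "(\<integral>\<^sup>+y\<in>cball x0 t0. ennreal (\<bar>b y - d\<bar> powr P) \<partial>lborel)
     \<le> (\<integral>\<^sup>+y. ennreal (2 powr P) * (hP y * indicator (cball x0 t0) y) + ennreal (2 powr P * (K * 2 ^ n) powr P) * indicator (cball x0 t0) y \<partial>lborel)"
  proof (rule nn_integral_mono)
    fix y
    have "\<bar>b y - d\<bar> powr P \<le> (\<bar>b y - c\<bar> + K * 2 ^ n) powr P"
      using d P by (intro powr_mono2) auto
    also have "\<dots> \<le> 2 powr P * (\<bar>b y - c\<bar> powr P + (K * 2 ^ n) powr P)"
      using K P by (intro powr_add_le) auto
    finally have "ennreal (\<bar>b y - d\<bar> powr P) \<le> ennreal (2 powr P * (\<bar>b y - c\<bar> powr P) + 2 powr P * (K * 2 ^ n) powr P)"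
      by (intro ennreal_leI) (simp add: distrib_left)
    then show "ennreal (\<bar>b y - d\<bar> powr P) * indicator (cball x0 t0) y
      \<le> ennreal (2 powr P) * (hP y * indicator (cball x0 t0) y) + ennreal (2 powr P * (K * 2 ^ n) powr P) * indicator (cball x0 t0) y"
      by (auto split: split_indicator simp: ennreal_mult hP_def)
  qed
  also have "\<dots> = ennreal (2 powr P) * (\<integral>\<^sup>+y\<in>cball x0 t0. hP y \<partial>lborel) + ennreal (2 powr P * (K * 2 ^ n) powr P) * em x0 t0"
    unfolding em_def by (subst nn_integral_add) (auto simp: nn_integral_cmult)
  also have "\<dots> \<le> ennreal (2 powr P) * (ennreal ((\<Gamma> * l) powr P + Q * 10 ^ n * K / l) * em x0 t0) + ennreal (2 powr P * (K * 2 ^ n) powr P) * em x0 t0"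
    by (intro add_right_mono mult_left_mono main) auto
  also have "\<dots> = ennreal (2 powr P * ((\<Gamma> * l) powr P + Q * 10 ^ n * K / l) + 2 powr P * (K * 2 ^ n) powr P) * em x0 t0"
    using Q K l_pos by (subst ennreal_plus) (auto simp: ennreal_mult mult.assoc distrib_right)
  \<comment> \<open>The value of \<open>l\<close> is made for this step: 2^P * 2^P * 10^n * K / l =
    1/2, so \<open>A\<close> comes back with the factor 1/2.\<close>
  also have "2 powr P * ((\<Gamma> * l) powr P + Q * 10 ^ n * K / l) + 2 powr P * (K * 2 ^ n) powr P
     = 2 powr P * ((\<Gamma> * l) powr P + (K * 2 ^ n) powr P) + l powr P / 2 + A / 2"
  proof -
    have "(4::real) powr P = 2 powr P * 2 powr P" by (simp flip: powr_mult)
    then have "2 powr P * (2 powr P * (10 ^ n * K / l)) = (1::real) / 2"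
      using K by (simp add: l n_def)
    then have "2 powr P * (Q * 10 ^ n * K / l) = (A + l powr P) / 2"
      unfolding Q_def by (metis (no_types, opaque_lifting) mult.commute mult.left_commute times_divide_eq_right mult_1)
    then show ?thesis by (simp add: distrib_left add_divide_distrib)
  qed
  finally show "(\<integral>\<^sup>+y\<in>cball x0 t0. ennreal (\<bar>b y - ball_avg b x0 t0\<bar> powr P) \<partial>lborel)
      \<le> ennreal (2 powr P * ((\<Gamma> * l) powr P + (K * 2 ^ DIM('a)) powr P) + l powr P / 2 + A / 2) * emeasure lborel (cball x0 t0)"
    by (simp add: d_def em_def n_def)
qed

text \<open>The improvement A -> C0 + A/2 has the fixed point 2 C0 and pushes every larger
  admissible bound towards it. Boundedness of \<open>b\<close> only supplies some finite admissible
  bound, (2 N)^P, so the result does not depend on \<open>N\<close>.\<close>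

lemma moment_bounded:
  assumes K: "0 < K" and P: "0 < P"
  obtains C :: real where "0 < C"
    "\<And>(b :: 'a::euclidean_space \<Rightarrow> real) N. ball_osc_le K b \<Longrightarrow> (\<And>y. \<bar>b y\<bar> \<le> N) \<Longrightarrow> moment_le b P C"
proof -
  define l where "l = 2 * 4 powr P * 10 ^ DIM('a) * K"
  define C0 where "C0 = 2 powr P * ((unit_ball_vol (real DIM('a)) * real DIM('a) ^ DIM('a) * l) powr P + (K * 2 ^ DIM('a)) powr P) + l powr P / 2"
  have C0: "0 \<le> C0" by (simp add: C0_def)
  have "moment_le b P (2 * C0 + 1)" if b: "ball_osc_le K b" and N: "\<And>y. \<bar>b y\<bar> \<le> N" for b :: "'a \<Rightarrow> real" and N
  proof -
    have step: "moment_le b P (C0 + A / 2)" if "0 \<le> A" "moment_le b P A" for A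
      using moment_improve[OF b K P that l_def] by (simp add: C0_def)
    define S where "S = {A. 0 \<le> A \<and> moment_le b P A}"
    have "(2 * N) powr P \<in> S"
      unfolding S_def moment_le_def
    proof (intro CollectI conjI allI impI)
      fix x and t :: real assume t: "0 < t"
      have loc: "loc_integrable b" using ball_osc_leD(1)[OF b] .
      have "ennreal \<bar>ball_avg b x t - 0\<bar> * emeasure lborel (cball x t) \<le> (\<integral>\<^sup>+y\<in>cball x t. ennreal \<bar>b y - 0\<bar> \<partial>lborel)"
        by (rule ball_avg_minus_le[OF loc t])
      also have "\<dots> \<le> (\<integral>\<^sup>+y\<in>cball x t. ennreal N \<partial>lborel)"
        using N by (intro nn_integral_mono mult_right_mono ennreal_leI) auto
      finally have "\<bar>ball_avg b x t\<bar> \<le> N"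
        using N[of 0] t ennreal_cancel_cball[of "\<bar>ball_avg b x t\<bar>" x t N] by (simp add: nn_integral_cmult)
      then have *: "\<bar>b y - ball_avg b x t\<bar> powr P \<le> (2 * N) powr P" for y
        using N[of y] P by (intro powr_mono2) auto
      have "(\<integral>\<^sup>+y\<in>cball x t. ennreal (\<bar>b y - ball_avg b x t\<bar> powr P) \<partial>lborel) \<le> (\<integral>\<^sup>+y\<in>cball x t. ennreal ((2 * N) powr P) \<partial>lborel)"
        using * by (intro nn_integral_mono mult_right_mono ennreal_leI) auto
      then show "(\<integral>\<^sup>+y\<in>cball x t. ennreal (\<bar>b y - ball_avg b x t\<bar> powr P) \<partial>lborel) \<le> ennreal ((2 * N) powr P) * emeasure lborel (cball x t)"
        by (simp add: nn_integral_cmult)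
    qed simp
    then have S: "S \<noteq> {}" "bdd_below S" by blast (auto simp: S_def bdd_below_def)
    have "\<exists>A\<in>S. A < 2 * C0 + 1"
    proof (cases "Inf S \<le> 2 * C0")
      case True
      then show ?thesis using cInf_less_iff[OF S, of "2 * C0 + 1"] by auto
    next
      \<comment> \<open>If the infimum exceeded 2 C0, an admissible A below 2 Inf S - 2 C0 would be
        improved to C0 + A/2 < Inf S.\<close>
      case False
      then obtain A where A: "A \<in> S" "A < 2 * Inf S - 2 * C0"
        using cInf_less_iff[OF S, of "2 * Inf S - 2 * C0"] by auto
      then have "C0 + A / 2 \<in> S" using step C0 by (auto simp: S_def)
      from cInf_lower[OF this S(2)] A(2) show ?thesis by simp
    qed
    then obtain A where A: "0 \<le> A" "moment_le b P A" "A < 2 * C0 + 1" by (auto simp: S_def)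
    show ?thesis unfolding moment_le_def
    proof (intro allI impI)
      fix x and t :: real assume "0 < t"
      then have "(\<integral>\<^sup>+y\<in>cball x t. ennreal (\<bar>b y - ball_avg b x t\<bar> powr P) \<partial>lborel) \<le> ennreal A * emeasure lborel (cball x t)"
        using A(2) by (simp add: moment_le_def)
      also have "\<dots> \<le> ennreal (2 * C0 + 1) * emeasure lborel (cball x t)"
        using A by (intro mult_right_mono ennreal_leI) auto
      finally show "(\<integral>\<^sup>+y\<in>cball x t. ennreal (\<bar>b y - ball_avg b x t\<bar> powr P) \<partial>lborel) \<le> ennreal (2 * C0 + 1) * emeasure lborel (cball x t)" .
    qed
  qed
  with C0 that[of "2 * C0 + 1"] show ?thesis by auto
qed

text \<open>Truncations are bounded and satisfy the oscillation bound 2 K at every height, so one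
  \<open>C\<close> serves all of them. Their means converge by dominated convergence, and Fatou's
  lemma passes the moment bound to \<open>b\<close>.\<close>

lemma john_nirenberg_moment:
  assumes K: "0 < K" and P: "0 < P"
  obtains C :: real where "0 < C" "\<And>b :: 'a::euclidean_space \<Rightarrow> real. ball_osc_le K b \<Longrightarrow> moment_le b P C"
proof -
  obtain C :: real where C: "0 < C"
    "\<And>(b :: 'a \<Rightarrow> real) N. ball_osc_le (2 * K) b \<Longrightarrow> (\<And>y. \<bar>b y\<bar> \<le> N) \<Longrightarrow> moment_le b P C"
    using moment_bounded[of "2 * K" P] K P by auto
  have "moment_le b P C" if b: "ball_osc_le K b" for b :: "'a \<Rightarrow> real"
    unfolding moment_le_def
  proof (intro allI impI)
    fix x :: 'a and t :: real assume t: "0 < t"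
    have loc: "loc_integrable b" and bm[measurable]: "b \<in> borel_measurable borel" using ball_osc_leD[OF b] by auto
    define c where "c N = (\<lambda>y. trunc (real N) (b y))" for N :: nat
    have cm[measurable]: "c N \<in> borel_measurable borel" for N
      using loc_integrableD(1)[OF loc_integrable_trunc[OF loc, of "real N"]] by (simp add: c_def)
    have c_lim: "(\<lambda>N. c N y) \<longlonglongrightarrow> b y" for y
    proof (rule tendsto_eventually)
      have "eventually (\<lambda>N. N \<ge> nat \<lceil>\<bar>b y\<bar>\<rceil>) sequentially" by (rule eventually_ge_at_top)
      then show "eventually (\<lambda>N. c N y = b y) sequentially"
      proof eventually_elim
        case (elim N)
        then have "\<bar>b y\<bar> \<le> real N" by linarith
        then show ?case by (auto simp: c_def trunc_def max_def min_def)
      qed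
    qed
    have avg_lim: "(\<lambda>N. ball_avg (c N) x t) \<longlonglongrightarrow> ball_avg b x t"
      unfolding ball_avg_def
    proof (intro tendsto_divide tendsto_const)
      show "(\<lambda>N. \<integral>y. indicator (cball x t) y * c N y \<partial>lborel) \<longlonglongrightarrow> (\<integral>y. indicator (cball x t) y * b y \<partial>lborel)"
      proof (rule integral_dominated_convergence[where w="\<lambda>y. \<bar>indicator (cball x t) y * b y\<bar>"])
        show "integrable lborel (\<lambda>y. \<bar>indicator (cball x t) y * b y\<bar>)"
          using loc_integrableD(2)[OF loc] by (rule integrable_abs)
        show "AE y in lborel. (\<lambda>N. indicator (cball x t) y * c N y) \<longlonglongrightarrow> indicator (cball x t) y * b y"
          by (intro AE_I2 tendsto_mult tendsto_const c_lim)
        show "AE y in lborel. norm (indicator (cball x t) y * c N y) \<le> \<bar>indicator (cball x t) y * b y\<bar>" for N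
          by (intro AE_I2) (auto simp: c_def abs_mult intro!: mult_left_mono abs_trunc_le)
      qed auto
    qed (use t in simp)
    define F where "F N y = ennreal (\<bar>c N y - ball_avg (c N) x t\<bar> powr P) * indicator (cball x t) y" for N y
    have F_lim: "(\<lambda>N. F N y) \<longlonglongrightarrow> ennreal (\<bar>b y - ball_avg b x t\<bar> powr P) * indicator (cball x t) y" for y
    proof -
      have "(\<lambda>N. \<bar>c N y - ball_avg (c N) x t\<bar> powr P) \<longlonglongrightarrow> \<bar>b y - ball_avg b x t\<bar> powr P"
        using P by (intro tendsto_powr' tendsto_rabs tendsto_diff c_lim avg_lim tendsto_const) auto
      then show ?thesis unfolding F_def by (auto split: split_indicator intro: tendsto_ennrealI)
    qed
    have "(\<integral>\<^sup>+y\<in>cball x t. ennreal (\<bar>b y - ball_avg b x t\<bar> powr P) \<partial>lborel) = (\<integral>\<^sup>+y. liminf (\<lambda>N. F N y) \<partial>lborel)"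
      using lim_imp_Liminf[OF _ F_lim] by (intro nn_integral_cong) simp
    also have "\<dots> \<le> liminf (\<lambda>N. \<integral>\<^sup>+y. F N y \<partial>lborel)"
      by (intro nn_integral_liminf) (simp add: F_def)
    also have "\<dots> \<le> liminf (\<lambda>N::nat. ennreal C * emeasure lborel (cball x t))"
    proof (intro Liminf_mono always_eventually allI)
      fix N
      have "moment_le (c N) P C"
        unfolding c_def by (rule C(2)[OF ball_osc_le_trunc[OF b]]) (use K abs_trunc_le(1)[of "real N"] in auto)
      then show "(\<integral>\<^sup>+y. F N y \<partial>lborel) \<le> ennreal C * emeasure lborel (cball x t)"
        using t by (simp add: moment_le_def F_def)
    qed
    also have "\<dots> = ennreal C * emeasure lborel (cball x t)" by (simp add: Liminf_const)
    finally show "(\<integral>\<^sup>+y\<in>cball x t. ennreal (\<bar>b y - ball_avg b x t\<bar> powr P) \<partial>lborel) \<le> ennreal C * emeasure lborel (cball x t)" .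
  qed
  with C(1) that show ?thesis by blast
qed

section \<open>Oscillation about the centre of a single ball\<close>

lemma ball_avg_near:
  fixes b :: "'a::euclidean_space \<Rightarrow> real"
  assumes b: "ball_osc_le K b" and K: "0 \<le> K" and t: "0 < t" and xy: "dist x y \<le> t"
  shows "\<bar>ball_avg b x t - ball_avg b y t\<bar> \<le> 2 * (2 ^ DIM('a) * K)"
proof -
  \<comment> \<open>The ball of radius 2 t about x contains both balls and has 2^n times their
    volume, so each mean lies within 2^n K of this one.\<close>
  define c where "c = ball_avg b x (2 * t)"
  have *: "\<bar>ball_avg b z t - c\<bar> \<le> 2 ^ DIM('a) * K" if "dist x z \<le> t" for z
  proof -
    have sub: "cball z t \<subseteq> cball x (2 * t)"
      using that by (auto simp: subset_iff) (smt (verit) dist_triangle)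
    have "ennreal \<bar>ball_avg b z t - c\<bar> * emeasure lborel (cball z t) \<le> (\<integral>\<^sup>+y\<in>cball z t. ennreal \<bar>b y - c\<bar> \<partial>lborel)"
      by (rule ball_avg_minus_le[OF ball_osc_leD(1)[OF b] t])
    also have "\<dots> \<le> (\<integral>\<^sup>+y\<in>cball x (2 * t). ennreal \<bar>b y - c\<bar> \<partial>lborel)"
      using sub by (intro nn_integral_mono) (auto split: split_indicator)
    also have "\<dots> \<le> ennreal K * emeasure lborel (cball x (2 * t))"
      using ball_osc_leD(3)[OF b, of "2 * t" x] t by (simp add: c_def)
    also have "\<dots> = ennreal (2 ^ DIM('a) * K) * emeasure lborel (cball z t)"
      using emeasure_cball_scale[of t 2 x z] t K by (simp add: ennreal_mult mult_ac)
    finally show ?thesis by (rule ennreal_cancel_cball) (use t K in auto)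
  qed
  show ?thesis using *[of x] *[of y] xy t by simp
qed

text \<open>The summand 1 retains the part of the integrand without \<open>b\<close>, so that a
  single estimate covers the fractional integral and the oscillation.\<close>

definition osc_weight :: "('a::euclidean_space \<Rightarrow> real) \<Rightarrow> real \<Rightarrow> 'a \<Rightarrow> real \<Rightarrow> 'a \<Rightarrow> real" where
  "osc_weight b m x t y = 1 + \<bar>b y - ball_avg b x t\<bar> powr m"

lemma osc_weight_ge_1: "1 \<le> osc_weight b m x t y"
  by (simp add: osc_weight_def)

lemma measurable_ball_avg [measurable (raw)]:
  fixes b :: "'a::euclidean_space \<Rightarrow> real"
  assumes [measurable]: "b \<in> borel_measurable borel" "f \<in> borel_measurable M" "t \<in> borel_measurable M"
  shows "(\<lambda>z. ball_avg b (f z) (t z)) \<in> borel_measurable M"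
proof -
  have *: "measure lborel (cball x t) = (if 0 \<le> t then unit_ball_vol (real DIM('a)) * t ^ DIM('a) else 0)" for x :: 'a and t
    by (auto simp: content_cball)
  show ?thesis unfolding ball_avg_def * by measurable
qed

lemma measurable_osc_weight [measurable (raw)]:
  fixes b :: "'a::euclidean_space \<Rightarrow> real"
  assumes [measurable]: "b \<in> borel_measurable borel" "f \<in> borel_measurable M" "t \<in> borel_measurable M" "g \<in> borel_measurable M"
  shows "(\<lambda>z. osc_weight b m (f z) (t z) (g z)) \<in> borel_measurable M"
  unfolding osc_weight_def by measurable

text \<open>b(x) - b(y) is split as b(x) minus the mean over B(y,t), plus the difference of the two
  means, plus the mean over B(x,t) minus b(y). In this arrangement \<open>b\<close> is never
  compared at a centre with the mean about that centre, so both weights have bounded moments over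
  their balls. The middle term is at most \<open>k\<close>.\<close>

lemma oscillation_le_osc_weight:
  assumes K: "0 < K" and m: "0 < m"
  obtains D :: real where "0 < D"
    "\<And>(b :: 'a::euclidean_space \<Rightarrow> real) x y t. ball_osc_le K b \<Longrightarrow> 0 < t \<Longrightarrow> dist x y \<le> t \<Longrightarrow>
       1 + \<bar>b x - b y\<bar> powr m \<le> D * (osc_weight b m x t y + osc_weight b m y t x)"
proof -
  define k where "k = 2 * (2 ^ DIM('a) * K)"
  define D where "D = 1 + 4 powr m + 2 powr m * k powr m"
  have "0 < D" by (simp add: D_def add_pos_nonneg)
  have "1 + \<bar>b x - b y\<bar> powr m \<le> D * (osc_weight b m x t y + osc_weight b m y t x)"
    if b: "ball_osc_le K b" and t: "0 < t" and xy: "dist x y \<le> t" for b :: "'a \<Rightarrow> real" and x y t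
  proof -
    define u v where "u = \<bar>b y - ball_avg b x t\<bar>" and "v = \<bar>b x - ball_avg b y t\<bar>"
    have uv: "0 \<le> u" "0 \<le> v" "0 \<le> k" using K by (auto simp: u_def v_def k_def)
    have "\<bar>ball_avg b x t - ball_avg b y t\<bar> \<le> k"
      unfolding k_def using ball_avg_near[OF b _ t xy] K by simp
    then have "\<bar>b x - b y\<bar> powr m \<le> ((u + v) + k) powr m"
      using m by (intro powr_mono2) (auto simp: u_def v_def)
    also have "\<dots> \<le> 2 powr m * ((u + v) powr m + k powr m)"
      using uv m by (intro powr_add_le) auto
    also have "\<dots> \<le> 2 powr m * (2 powr m * (u powr m + v powr m) + k powr m)"
      using uv m by (intro mult_left_mono add_right_mono powr_add_le) auto
    also have "\<dots> = 4 powr m * (u powr m + v powr m) + 2 powr m * k powr m"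
      by (simp add: distrib_left mult.assoc[symmetric] flip: powr_mult)
    finally have "1 + \<bar>b x - b y\<bar> powr m \<le> 1 + (4 powr m * (u powr m + v powr m) + 2 powr m * k powr m)" by simp
    also have "\<dots> \<le> D * 1 + D * (u powr m + v powr m)"
    proof -
      have "4 powr m * (u powr m + v powr m) \<le> D * (u powr m + v powr m)"
        by (intro mult_right_mono) (auto simp: D_def)
      moreover have "1 + 2 powr m * k powr m \<le> D" by (simp add: D_def)
      ultimately show ?thesis by linarith
    qed
    also have "\<dots> \<le> D * (osc_weight b m x t y + osc_weight b m y t x)"
      using \<open>0 < D\<close> by (simp add: osc_weight_def u_def v_def distrib_left)
    finally show ?thesis .
  qed
  with \<open>0 < D\<close> that show ?thesis by blast
qed

lemma osc_weight_moment:
  assumes K: "0 < K" and m: "0 < m" and P: "0 < P"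
  obtains C :: real where "0 < C"
    "\<And>(b :: 'a::euclidean_space \<Rightarrow> real) x t. ball_osc_le K b \<Longrightarrow> 0 < t \<Longrightarrow>
       (\<integral>\<^sup>+y\<in>cball x t. ennreal (osc_weight b m x t y powr P) \<partial>lborel) \<le> ennreal C * emeasure lborel (cball x t)"
proof -
  obtain C :: real where C: "0 < C" "\<And>b :: 'a \<Rightarrow> real. ball_osc_le K b \<Longrightarrow> moment_le b (m * P) C"
    using john_nirenberg_moment[OF K, of "m * P"] m P by auto
  have "(\<integral>\<^sup>+y\<in>cball x t. ennreal (osc_weight b m x t y powr P) \<partial>lborel) \<le> ennreal (2 powr P * (1 + C)) * emeasure lborel (cball x t)"
    if b: "ball_osc_le K b" and t: "0 < t" for b :: "'a \<Rightarrow> real" and x t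
  proof -
    have [measurable]: "b \<in> borel_measurable borel" using ball_osc_leD[OF b] by auto
    have "(\<integral>\<^sup>+y\<in>cball x t. ennreal (osc_weight b m x t y powr P) \<partial>lborel)
      \<le> (\<integral>\<^sup>+y. ennreal (2 powr P) * (indicator (cball x t) y + ennreal (\<bar>b y - ball_avg b x t\<bar> powr (m * P)) * indicator (cball x t) y) \<partial>lborel)"
    proof (rule nn_integral_mono)
      fix y
      have "osc_weight b m x t y powr P \<le> 2 powr P * (1 + \<bar>b y - ball_avg b x t\<bar> powr (m * P))"
        using powr_add_le[of 1 "\<bar>b y - ball_avg b x t\<bar> powr m" P] P by (simp add: osc_weight_def powr_powr)
      then have "ennreal (osc_weight b m x t y powr P) \<le> ennreal (2 powr P) * (1 + ennreal (\<bar>b y - ball_avg b x t\<bar> powr (m * P)))"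
        by (simp add: ennreal_leI flip: ennreal_plus ennreal_1 ennreal_mult)
      then show "ennreal (osc_weight b m x t y powr P) * indicator (cball x t) y
         \<le> ennreal (2 powr P) * (indicator (cball x t) y + ennreal (\<bar>b y - ball_avg b x t\<bar> powr (m * P)) * indicator (cball x t) y)"
        by (auto split: split_indicator)
    qed
    also have "\<dots> = ennreal (2 powr P) * (emeasure lborel (cball x t) + (\<integral>\<^sup>+y\<in>cball x t. ennreal (\<bar>b y - ball_avg b x t\<bar> powr (m * P)) \<partial>lborel))"
      by (subst nn_integral_cmult) (auto simp: nn_integral_add)
    also have "\<dots> \<le> ennreal (2 powr P) * (emeasure lborel (cball x t) + ennreal C * emeasure lborel (cball x t))"
      using C(2)[OF b] t by (intro mult_left_mono add_left_mono) (auto simp: moment_le_def)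
    also have "\<dots> = ennreal (2 powr P * (1 + C)) * emeasure lborel (cball x t)"
      using C(1) by (simp add: ennreal_mult distrib_left distrib_right mult.assoc)
    finally show ?thesis .
  qed
  with that[of "2 powr P * (1 + C)"] C(1) show ?thesis by auto
qed

text \<open>Young's inequality for u/a and w, multiplied by a, with the factors 1/s and (s-1)/s
  dropped. The free parameter \<open>a\<close> does the work of Hoelder's inequality: chosen as the
  size of \<open>u\<close>, it makes both terms scale like \<open>u\<close>.\<close>

lemma weighted_young:
  fixes a w u :: real
  assumes "1 < s" "0 < a" "0 \<le> w" "0 \<le> u"
  shows "w * u \<le> a * w powr (s / (s - 1)) + a powr (1 - s) * u powr s"
proof -
  have conj: "1 / s + 1 / (s / (s - 1)) = 1" "1 < s / (s - 1)" using assms by (auto simp: field_simps)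
  have "w * u = a * ((u / a) * w)" using assms by simp
  also have "\<dots> \<le> a * ((u / a) powr s / s + w powr (s / (s - 1)) / (s / (s - 1)))"
    using assms conj by (intro mult_left_mono Youngs_inequality) auto
  also have "\<dots> \<le> a * ((u / a) powr s + w powr (s / (s - 1)))"
  proof (intro mult_left_mono add_mono)
    show "(u / a) powr s / s \<le> (u / a) powr s" 
      using assms mult_left_mono[of 1 s "(u / a) powr s"] by (subst pos_divide_le_eq) auto
    show "w powr (s / (s - 1)) / (s / (s - 1)) \<le> w powr (s / (s - 1))"
      using conj(2) mult_left_mono[of 1 "s / (s - 1)" "w powr (s / (s - 1))"] by (subst pos_divide_le_eq) auto
  qed (use assms in auto)
  also have "\<dots> = a * w powr (s / (s - 1)) + a powr (1 - s) * u powr s"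
    using assms by (simp add: powr_divide powr_diff distrib_left)
  finally show ?thesis .
qed

text \<open>Separates the weight, whose moment is bounded, from \<open>\<phi>\<close>; afterwards
  only the ball integral of a power of \<open>\<phi>\<close> remains.\<close>

lemma weighted_ball_integral_le:
  fixes b :: "'a::euclidean_space \<Rightarrow> real"
  assumes [measurable]: "b \<in> borel_measurable borel" "\<phi> \<in> borel_measurable borel" and \<phi>: "\<And>x. 0 \<le> \<phi> x"
    and s: "1 < s" and a: "0 < a" and Cpos: "0 < C"
    and C: "(\<integral>\<^sup>+y\<in>cball x t. ennreal (osc_weight b m x t y powr (s / (s - 1))) \<partial>lborel) \<le> ennreal C * emeasure lborel (cball x t)"
  shows "(\<integral>\<^sup>+y\<in>cball x t. ennreal (osc_weight b m x t y * \<phi> y) \<partial>lborel)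
     \<le> ennreal (a * C) * emeasure lborel (cball x t) + ennreal (a powr (1 - s)) * (\<integral>\<^sup>+y\<in>cball x t. ennreal (\<phi> y powr s) \<partial>lborel)"
proof -
  have w: "0 \<le> osc_weight b m x t y" for y using osc_weight_ge_1[of b m x t y] by linarith
  have "(\<integral>\<^sup>+y\<in>cball x t. ennreal (osc_weight b m x t y * \<phi> y) \<partial>lborel)
    \<le> (\<integral>\<^sup>+y. ennreal a * (ennreal (osc_weight b m x t y powr (s / (s - 1))) * indicator (cball x t) y)
         + ennreal (a powr (1 - s)) * (ennreal (\<phi> y powr s) * indicator (cball x t) y) \<partial>lborel)"
  proof (rule nn_integral_mono)
    fix y
    have "ennreal (osc_weight b m x t y * \<phi> y) \<le> ennreal (a * osc_weight b m x t y powr (s / (s - 1)) + a powr (1 - s) * \<phi> y powr s)"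
      by (intro ennreal_leI weighted_young s a w \<phi>)
    then show "ennreal (osc_weight b m x t y * \<phi> y) * indicator (cball x t) y
       \<le> ennreal a * (ennreal (osc_weight b m x t y powr (s / (s - 1))) * indicator (cball x t) y)
         + ennreal (a powr (1 - s)) * (ennreal (\<phi> y powr s) * indicator (cball x t) y)"
      using a by (auto split: split_indicator simp: ennreal_mult)
  qed
  also have "\<dots> = ennreal a * (\<integral>\<^sup>+y\<in>cball x t. ennreal (osc_weight b m x t y powr (s / (s - 1))) \<partial>lborel)
     + ennreal (a powr (1 - s)) * (\<integral>\<^sup>+y\<in>cball x t. ennreal (\<phi> y powr s) \<partial>lborel)"
    by (subst nn_integral_add) (auto simp: nn_integral_cmult)
  also have "\<dots> \<le> ennreal a * (ennreal C * emeasure lborel (cball x t))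
     + ennreal (a powr (1 - s)) * (\<integral>\<^sup>+y\<in>cball x t. ennreal (\<phi> y powr s) \<partial>lborel)"
    by (intro add_right_mono mult_left_mono C) auto
  finally show ?thesis using a Cpos by (simp add: ennreal_mult mult.assoc)
qed

section \<open>A Hedberg estimate\<close>

text \<open>With 1 in place of \<open>osc_weight\<close> this is, for \<alpha> < n, the Riesz
  potential of \<open>\<phi>\<close> divided by n - \<alpha>, since the radii t >= |x - y| integrate
  to the kernel. The weight depends on \<open>t\<close>, which is why the integral over radii is
  kept.\<close>

definition hedberg_op :: "real \<Rightarrow> real \<Rightarrow> ('a::euclidean_space \<Rightarrow> real) \<Rightarrow> ('a \<Rightarrow> real) \<Rightarrow> 'a \<Rightarrow> ennreal" where
  "hedberg_op \<alpha> m b \<phi> x = (\<integral>\<^sup>+t\<in>{0<..}. ennreal (t powr (\<alpha> - real DIM('a) - 1)) *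
      (\<integral>\<^sup>+y\<in>cball x t. ennreal (osc_weight b m x t y * \<phi> y) \<partial>lborel) \<partial>lborel)"

lemma measurable_hedberg_op [measurable]:
  fixes b :: "'a::euclidean_space \<Rightarrow> real"
  assumes [measurable]: "b \<in> borel_measurable borel" "\<phi> \<in> borel_measurable borel"
  shows "hedberg_op \<alpha> m b \<phi> \<in> borel_measurable borel"
  unfolding hedberg_op_def[abs_def] by measurable

text \<open>Small radii use the maximal function of \<phi>^\<tau> and give G(t) <= C3 a t^n; large
  radii use the norm of \<phi> and give G(t) <= C4 t^(n - n/s). Splitting the radius integral where
  a t^n = t^(n - n/s) yields a^(s/r). Here \<open>a\<close> is a positive upper bound rather than
  the value itself, so that a vanishing maximal function can be handled by letting \<open>a\<close>
  tend to 0.\<close>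

lemma hedberg_pointwise:
  fixes b :: "'a::euclidean_space \<Rightarrow> real" and \<alpha> s r \<tau> :: real
  defines "n \<equiv> real DIM('a)" and "V \<equiv> unit_ball_vol (real DIM('a))"
  assumes \<alpha>: "0 < \<alpha>" and s: "1 < s" and r: "1 < r" and rs: "1 / r = 1 / s - \<alpha> / n" and \<tau>: "1 < \<tau>"
    and [measurable]: "b \<in> borel_measurable borel" "\<phi> \<in> borel_measurable borel" and \<phi>: "\<And>x. 0 \<le> \<phi> x"
    and \<phi>_int: "(\<integral>\<^sup>+x. ennreal (\<phi> x powr s) \<partial>lborel) \<le> 1"
    and C1: "0 < C1" "\<And>t. 0 < t \<Longrightarrow> (\<integral>\<^sup>+y\<in>cball x t. ennreal (osc_weight b m x t y powr (\<tau> / (\<tau> - 1))) \<partial>lborel) \<le> ennreal C1 * emeasure lborel (cball x t)"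
    and C2: "0 < C2" "\<And>t. 0 < t \<Longrightarrow> (\<integral>\<^sup>+y\<in>cball x t. ennreal (osc_weight b m x t y powr (s / (s - 1))) \<partial>lborel) \<le> ennreal C2 * emeasure lborel (cball x t)"
    and a: "0 < a" "maxfun (\<lambda>y. ennreal (\<phi> y powr \<tau>)) x \<le> ennreal (a powr \<tau>)"
  shows "hedberg_op \<alpha> m b \<phi> x \<le> ennreal (((C1 + 2 ^ DIM('a)) * V / \<alpha> + (C2 * V + 1) * r / n) * a powr (s / r))"
proof -
  define G where "G t = (\<integral>\<^sup>+y\<in>cball x t. ennreal (osc_weight b m x t y * \<phi> y) \<partial>lborel)" for t
  define C3 where "C3 = (C1 + 2 ^ DIM('a)) * V"
  define C4 where "C4 = C2 * V + 1"
  have pos: "0 < n" "0 < V" by (auto simp: n_def V_def)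
  have C34: "0 < C3" "0 < C4" using C1(1) C2(1) pos by (auto simp: C3_def C4_def add_pos_pos)
  have em: "emeasure lborel (cball x t) = ennreal (V * t powr n)" if "0 < t" for t
    using that by (simp add: emeasure_cball V_def n_def powr_realpow)
  have small: "G t \<le> ennreal (C3 * a * t powr n)" if t: "0 < t" for t
  proof -
    have "(\<integral>\<^sup>+y\<in>cball x t. ennreal (\<phi> y powr \<tau>) \<partial>lborel) \<le> 2 ^ DIM('a) * maxfun (\<lambda>y. ennreal (\<phi> y powr \<tau>)) x * emeasure lborel (cball x t)"
      by (rule ball_nn_integral_le_maxfun[OF t])
    also have "\<dots> \<le> ennreal (2 ^ DIM('a)) * ennreal (a powr \<tau>) * emeasure lborel (cball x t)"
      using a(2) by (intro mult_right_mono mult_mono) (auto simp flip: ennreal_power)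
    finally have I: "(\<integral>\<^sup>+y\<in>cball x t. ennreal (\<phi> y powr \<tau>) \<partial>lborel) \<le> ennreal (2 ^ DIM('a) * a powr \<tau> * (V * t powr n))"
      using pos by (simp add: em[OF t] flip: ennreal_mult)
    \<comment> \<open>Exponent \<tau> with parameter \<open>a\<close>: the average of \<phi>^\<tau>
      is at most 2^n a^\<tau>, so both terms are multiples of a t^n.\<close>
    have "G t \<le> ennreal (a * C1) * emeasure lborel (cball x t) + ennreal (a powr (1 - \<tau>)) * (\<integral>\<^sup>+y\<in>cball x t. ennreal (\<phi> y powr \<tau>) \<partial>lborel)"
      unfolding G_def by (intro weighted_ball_integral_le \<tau> a C1 t \<phi>) auto
    also have "\<dots> \<le> ennreal (a * C1) * ennreal (V * t powr n) + ennreal (a powr (1 - \<tau>)) * ennreal (2 ^ DIM('a) * a powr \<tau> * (V * t powr n))"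
      unfolding em[OF t] by (intro add_left_mono mult_left_mono I) auto
    also have "\<dots> = ennreal (a * C1 * (V * t powr n) + a powr (1 - \<tau>) * (2 ^ DIM('a) * a powr \<tau> * (V * t powr n)))"
      using a(1) C1(1) pos by (simp flip: ennreal_mult ennreal_plus)
    also have "a * C1 * (V * t powr n) + a powr (1 - \<tau>) * (2 ^ DIM('a) * a powr \<tau> * (V * t powr n)) = C3 * a * t powr n"
    proof -
      have "a powr (1 - \<tau>) * a powr \<tau> = a" using a(1) by (simp flip: powr_add)
      then have "a powr (1 - \<tau>) * (2 ^ DIM('a) * a powr \<tau> * (V * t powr n)) = a * (2 ^ DIM('a) * (V * t powr n))"
        by (metis (no_types, opaque_lifting) mult.assoc mult.left_commute)
      then show ?thesis by (simp add: C3_def algebra_simps)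
    qed
    finally show ?thesis .
  qed
  have large: "G t \<le> ennreal (C4 * t powr (n - n / s))" if t: "0 < t" for t
  proof -
    have I: "(\<integral>\<^sup>+y\<in>cball x t. ennreal (\<phi> y powr s) \<partial>lborel) \<le> 1"
      by (rule order_trans[OF nn_integral_mono \<phi>_int]) (auto split: split_indicator)
    \<comment> \<open>The parameter t^(-n/s) balances Young's inequality: t^(-n/s) t^n and
      t^((-n/s)(1-s)) both equal t^(n - n/s).\<close>
    have "G t \<le> ennreal (t powr (- n / s) * C2) * emeasure lborel (cball x t) + ennreal ((t powr (- n / s)) powr (1 - s)) * (\<integral>\<^sup>+y\<in>cball x t. ennreal (\<phi> y powr s) \<partial>lborel)"
      unfolding G_def using t by (intro weighted_ball_integral_le s C2 \<phi>) auto
    also have "\<dots> \<le> ennreal (t powr (- n / s) * C2) * ennreal (V * t powr n) + ennreal ((t powr (- n / s)) powr (1 - s)) * 1"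
      unfolding em[OF t] by (intro add_left_mono mult_left_mono I) auto
    also have "\<dots> = ennreal (t powr (- n / s) * C2 * (V * t powr n) + (t powr (- n / s)) powr (1 - s))"
      using C2(1) pos by (simp flip: ennreal_mult ennreal_plus)
    also have "t powr (- n / s) * C2 * (V * t powr n) + (t powr (- n / s)) powr (1 - s) = C4 * t powr (n - n / s)"
    proof -
      have "t powr (- n / s) * t powr n = t powr (n - n / s)" by (simp flip: powr_add)
      moreover have "(t powr (- n / s)) powr (1 - s) = t powr (n - n / s)"
      proof -
        have "- n / s * (1 - s) = n - n / s" using s by (simp add: field_simps)
        then show ?thesis by (simp only: powr_powr)
      qed
      moreover have "t powr (- n / s) * C2 * (V * t powr n) = C2 * V * (t powr (- n / s) * t powr n)" by (simp only: mult_ac)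
      ultimately show ?thesis by (simp add: C4_def distrib_right)
    qed
    finally show ?thesis .
  qed
  \<comment> \<open>the radius at which the two bounds on \<open>G\<close> balance\<close>
  define \<delta> where "\<delta> = a powr (- s / n)"
  have \<delta>: "0 < \<delta>" using a by (simp add: \<delta>_def)
  have "hedberg_op \<alpha> m b \<phi> x = (\<integral>\<^sup>+t\<in>{0<..}. ennreal (t powr (\<alpha> - n - 1)) * G t \<partial>lborel)"
    by (simp add: hedberg_op_def G_def n_def)
  also have "\<dots> \<le> (\<integral>\<^sup>+t. ennreal (C3 * a) * (ennreal (t powr (\<alpha> - 1)) * indicator {0<..<\<delta>} t)
       + ennreal C4 * (ennreal (t powr (- n / r - 1)) * indicator {\<delta>..} t) \<partial>lborel)"
  proof (rule nn_integral_mono)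
    fix t :: real
    consider "t \<le> 0" | "0 < t" "t < \<delta>" | "\<delta> \<le> t" "0 < t" by linarith
    then show "ennreal (t powr (\<alpha> - n - 1)) * G t * indicator {0<..} t \<le>
        ennreal (C3 * a) * (ennreal (t powr (\<alpha> - 1)) * indicator {0<..<\<delta>} t)
       + ennreal C4 * (ennreal (t powr (- n / r - 1)) * indicator {\<delta>..} t)"
    proof cases
      case 2
      have "ennreal (t powr (\<alpha> - n - 1)) * G t \<le> ennreal (t powr (\<alpha> - n - 1)) * ennreal (C3 * a * t powr n)"
        by (intro mult_left_mono small 2) auto
      also have "\<dots> = ennreal (C3 * a * (t powr (\<alpha> - n - 1) * t powr n))"
        using C34 a by (simp add: mult_ac flip: ennreal_mult)
      also have "t powr (\<alpha> - n - 1) * t powr n = t powr (\<alpha> - 1)" by (simp flip: powr_add)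
      finally show ?thesis using 2 C34 a by (simp add: ennreal_mult)
    next
      case 3
      have "ennreal (t powr (\<alpha> - n - 1)) * G t \<le> ennreal (t powr (\<alpha> - n - 1)) * ennreal (C4 * t powr (n - n / s))"
        by (intro mult_left_mono large 3) auto
      also have "\<dots> = ennreal (C4 * (t powr (\<alpha> - n - 1) * t powr (n - n / s)))"
        using C34 a by (simp add: mult_ac flip: ennreal_mult)
      \<comment> \<open>By n/r = n/s - \<alpha> the exponent is below -1, which makes the integral
        over large radii converge.\<close>
      also have "t powr (\<alpha> - n - 1) * t powr (n - n / s) = t powr (- n / r - 1)"
      proof -
        have "n * (1 / r) = n * (1 / s - \<alpha> / n)" using rs by simp
        then have "n / r = n / s - \<alpha>" using pos by (simp add: right_diff_distrib)
        then have "\<alpha> - n - 1 + (n - n / s) = - n / r - 1" by simp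
        then show ?thesis by (metis powr_add)
      qed
      finally show ?thesis using 3 C34 a by (simp add: ennreal_mult)
    qed auto
  qed
  also have "\<dots> = ennreal (C3 * a) * (\<integral>\<^sup>+t\<in>{0<..<\<delta>}. ennreal (t powr (\<alpha> - 1)) \<partial>lborel)
       + ennreal C4 * (\<integral>\<^sup>+t\<in>{\<delta>..}. ennreal (t powr (- n / r - 1)) \<partial>lborel)"
    by (subst nn_integral_add) (auto simp: nn_integral_cmult)
  also have "\<dots> = ennreal (C3 * a) * ennreal (\<delta> powr \<alpha> / \<alpha>) + ennreal C4 * ennreal (\<delta> powr (- n / r) * r / n)"
  proof -
    have "- (\<delta> powr (- n / r - 1 + 1) / (- n / r - 1 + 1)) = \<delta> powr (- n / r) * r / n"
      using pos r by (simp add: field_simps)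
    then show ?thesis
      using nn_integral_powr_from_0[of "\<alpha> - 1" \<delta>] nn_integral_powr_to_inf[of "- n / r - 1" \<delta>] \<alpha> \<delta> pos r by simp
  qed
  also have "\<dots> = ennreal (C3 * a * (\<delta> powr \<alpha> / \<alpha>) + C4 * (\<delta> powr (- n / r) * r / n))"
    using C34 a pos r \<alpha> by (simp flip: ennreal_mult ennreal_plus)
  also have "C3 * a * (\<delta> powr \<alpha> / \<alpha>) + C4 * (\<delta> powr (- n / r) * r / n) = (C3 / \<alpha> + C4 * r / n) * a powr (s / r)"
  proof -
    have "s * (1 / r) = s * (1 / s - \<alpha> / n)" using rs by simp
    then have "s / r = 1 + (- s / n) * \<alpha>" using s by (simp add: right_diff_distrib)
    moreover have "a * \<delta> powr \<alpha> = a powr 1 * a powr ((- s / n) * \<alpha>)" using a by (simp add: \<delta>_def powr_powr)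
    ultimately have 1: "a * \<delta> powr \<alpha> = a powr (s / r)" by (simp only: powr_add)
    have 2: "\<delta> powr (- n / r) = a powr (s / r)" using pos by (simp add: \<delta>_def powr_powr)
    have 3: "C3 * a * (\<delta> powr \<alpha> / \<alpha>) = C3 / \<alpha> * (a * \<delta> powr \<alpha>)" by simp
    show ?thesis unfolding 3 unfolding 1 2 by (simp add: ring_distribs mult_ac)
  qed
  finally show ?thesis by (simp add: C3_def C4_def)
qed

text \<open>As s/\<tau> > 1, the maximal theorem in L^(s/\<tau>) applies to \<phi>^\<tau> and bounds
  the result by the integral of \<phi>^s. With a = M^(1/\<tau>), where M is the maximal function,
  the r-th power of the pointwise bound is a multiple of M^(s/\<tau>).\<close>

lemma hedberg_strong_type:
  fixes \<alpha> s r :: real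
  assumes \<alpha>: "0 < \<alpha>" and s: "1 < s" and r: "1 < r" and rs: "1 / r = 1 / s - \<alpha> / real DIM('a::euclidean_space)"
    and K: "0 < K" and m: "0 < m"
  obtains C :: real where "0 < C"
    "\<And>b \<phi> :: 'a \<Rightarrow> real. ball_osc_le K b \<Longrightarrow> \<phi> \<in> borel_measurable borel \<Longrightarrow> (\<And>x. 0 \<le> \<phi> x) \<Longrightarrow>
      (\<integral>\<^sup>+x. ennreal (\<phi> x powr s) \<partial>lborel) \<le> 1 \<Longrightarrow> (\<integral>\<^sup>+x. epowr (hedberg_op \<alpha> m b \<phi> x) r \<partial>lborel) \<le> ennreal C"
proof -
  \<comment> \<open>The midpoint of 1 and s; what matters is 1 < \<tau> < s.\<close>
  define \<tau> where "\<tau> = (1 + s) / 2"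
  have \<tau>: "1 < \<tau>" "\<tau> < s" using s by (auto simp: \<tau>_def)
  have st: "1 < s / \<tau>" "0 < \<tau> / (\<tau> - 1)" "0 < s / (s - 1)" using \<tau> s by auto
  obtain C1 :: real where C1: "0 < C1"
    "\<And>(b :: 'a \<Rightarrow> real) x t. ball_osc_le K b \<Longrightarrow> 0 < t \<Longrightarrow>
       (\<integral>\<^sup>+y\<in>cball x t. ennreal (osc_weight b m x t y powr (\<tau> / (\<tau> - 1))) \<partial>lborel) \<le> ennreal C1 * emeasure lborel (cball x t)"
    using osc_weight_moment[OF K m st(2)] by blast
  obtain C2 :: real where C2: "0 < C2"
    "\<And>(b :: 'a \<Rightarrow> real) x t. ball_osc_le K b \<Longrightarrow> 0 < t \<Longrightarrow>
       (\<integral>\<^sup>+y\<in>cball x t. ennreal (osc_weight b m x t y powr (s / (s - 1))) \<partial>lborel) \<le> ennreal C2 * emeasure lborel (cball x t)"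
    using osc_weight_moment[OF K m st(3)] by blast
  obtain C3 :: real where C3: "0 < C3"
    "\<And>u :: 'a \<Rightarrow> real. u \<in> borel_measurable borel \<Longrightarrow> (\<And>x. 0 \<le> u x) \<Longrightarrow>
       (\<integral>\<^sup>+x. epowr (maxfun (\<lambda>x. ennreal (u x)) x) (s / \<tau>) \<partial>lborel) \<le> ennreal C3 * (\<integral>\<^sup>+x. ennreal (u x powr (s / \<tau>)) \<partial>lborel)"
    using maxfun_strong_type[OF st(1)] by blast
  define C5 where "C5 = (C1 + 2 ^ DIM('a)) * unit_ball_vol (real DIM('a)) / \<alpha> + (C2 * unit_ball_vol (real DIM('a)) + 1) * r / real DIM('a)"
  have C5: "0 < C5" unfolding C5_def using C1(1) C2(1) \<alpha> r by (intro add_pos_pos divide_pos_pos mult_pos_pos) auto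
  have "(\<integral>\<^sup>+x. epowr (hedberg_op \<alpha> m b \<phi> x) r \<partial>lborel) \<le> ennreal (C5 powr r * C3)"
    if b: "ball_osc_le K b" and [measurable]: "\<phi> \<in> borel_measurable borel" and \<phi>: "\<And>x. 0 \<le> \<phi> x"
      and \<phi>_int: "(\<integral>\<^sup>+x. ennreal (\<phi> x powr s) \<partial>lborel) \<le> 1" for b \<phi> :: "'a \<Rightarrow> real"
  proof -
    have [measurable]: "b \<in> borel_measurable borel" using ball_osc_leD[OF b] by auto
    let ?M = "maxfun (\<lambda>y. ennreal (\<phi> y powr \<tau>))"
    have pt: "epowr (hedberg_op \<alpha> m b \<phi> x) r \<le> ennreal (C5 powr r * a powr s)"
      if a: "0 < a" "?M x \<le> ennreal (a powr \<tau>)" for a x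
    proof -
      have "hedberg_op \<alpha> m b \<phi> x \<le> ennreal (C5 * a powr (s / r))"
        unfolding C5_def by (rule hedberg_pointwise[OF \<alpha> s r rs \<tau>(1) _ _ \<phi> \<phi>_int C1(1) C1(2)[OF b] C2(1) C2(2)[OF b] a]) auto
      then have "epowr (hedberg_op \<alpha> m b \<phi> x) r \<le> epowr (ennreal (C5 * a powr (s / r))) r"
        using r by (intro epowr_mono) auto
      also have "\<dots> = ennreal (C5 powr r * a powr s)"
        using C5 a r by (simp add: powr_mult powr_powr)
      finally show ?thesis .
    qed
    have "epowr (hedberg_op \<alpha> m b \<phi> x) r \<le> ennreal (C5 powr r) * epowr (?M x) (s / \<tau>)" for x
    proof (cases "?M x")
      case (real M)
      show ?thesis
      proof (cases "M = 0")
        case False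
        with real have M: "0 < M" by simp
        have "epowr (hedberg_op \<alpha> m b \<phi> x) r \<le> ennreal (C5 powr r * (M powr (1 / \<tau>)) powr s)"
          using M \<tau> real by (intro pt) (auto simp: powr_powr)
        then show ?thesis using real by (simp add: powr_powr ennreal_mult)
      next
        case True
        have "epowr (hedberg_op \<alpha> m b \<phi> x) r \<le> 0"
        proof (rule ennreal_le_epsilon)
          fix e :: real assume e: "0 < e"
          \<comment> \<open>When M = 0 every a > 0 is admissible, and a = (e / C5^r)^(1/s) turns the
            bound into exactly \<open>e\<close>.\<close>
          have "epowr (hedberg_op \<alpha> m b \<phi> x) r \<le> ennreal (C5 powr r * ((e / C5 powr r) powr (1 / s)) powr s)"
            using e C5 real True by (intro pt) auto
          then show "epowr (hedberg_op \<alpha> m b \<phi> x) r \<le> 0 + ennreal e"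
            using e C5 s by (simp add: powr_powr)
        qed
        then show ?thesis by simp
      qed
    next
      case top
      then show ?thesis using C5 by (simp add: ennreal_mult_top)
    qed
    then have "(\<integral>\<^sup>+x. epowr (hedberg_op \<alpha> m b \<phi> x) r \<partial>lborel) \<le> (\<integral>\<^sup>+x. ennreal (C5 powr r) * epowr (?M x) (s / \<tau>) \<partial>lborel)"
      by (intro nn_integral_mono)
    also have "\<dots> = ennreal (C5 powr r) * (\<integral>\<^sup>+x. epowr (?M x) (s / \<tau>) \<partial>lborel)"
      by (intro nn_integral_cmult) auto
    also have "\<dots> \<le> ennreal (C5 powr r) * (ennreal C3 * (\<integral>\<^sup>+x. ennreal ((\<phi> x powr \<tau>) powr (s / \<tau>)) \<partial>lborel))"
      by (intro mult_left_mono C3(2)) auto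
    also have "\<dots> \<le> ennreal (C5 powr r) * (ennreal C3 * 1)"
      using \<phi>_int \<tau> by (intro mult_left_mono) (auto simp: powr_powr)
    finally show ?thesis using C3(1) by (simp add: ennreal_mult)
  qed
  with that[of "C5 powr r * C3"] C5 C3(1) show ?thesis by auto
qed

section \<open>The bilinear form with oscillation weight\<close>

lemma riesz_kernel_eq_nn_integral:
  fixes \<alpha> n d :: real
  assumes "\<alpha> < n" "0 < d"
  shows "ennreal (d powr (\<alpha> - n)) = ennreal (n - \<alpha>) * (\<integral>\<^sup>+t\<in>{d..}. ennreal (t powr (\<alpha> - n - 1)) \<partial>lborel)"
proof -
  have "(n - \<alpha>) * - (d powr (\<alpha> - n) / (\<alpha> - n)) = d powr (\<alpha> - n)"
    using assms by (simp add: field_simps)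
  moreover have "0 \<le> - (d powr (\<alpha> - n) / (\<alpha> - n))" using assms by (simp add: divide_nonneg_neg)
  ultimately show ?thesis
    using assms by (subst nn_integral_powr_to_inf) (auto simp flip: ennreal_mult)
qed

definition osc_form :: "real \<Rightarrow> real \<Rightarrow> ('a::euclidean_space \<Rightarrow> real) \<Rightarrow> ('a \<Rightarrow> real) \<Rightarrow> ('a \<Rightarrow> real) \<Rightarrow> ennreal" where
  "osc_form \<alpha> m b \<phi> \<psi> = (\<integral>\<^sup>+x. (\<integral>\<^sup>+y. ennreal ((1 + \<bar>b x - b y\<bar> powr m) * \<phi> y * \<psi> x * norm (x - y) powr (\<alpha> - real DIM('a))) \<partial>lborel) \<partial>lborel)"

lemma hedberg_op_Fubini:
  fixes b :: "'a::euclidean_space \<Rightarrow> real"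
  assumes [measurable]: "b \<in> borel_measurable borel" "\<phi> \<in> borel_measurable borel"
  shows "hedberg_op \<alpha> m b \<phi> x = (\<integral>\<^sup>+y. (\<integral>\<^sup>+t. ennreal (t powr (\<alpha> - real DIM('a) - 1)) *
      (ennreal (osc_weight b m x t y * \<phi> y) * indicator (cball x t) y) * indicator {0<..} t \<partial>lborel) \<partial>lborel)"
proof -
  have "hedberg_op \<alpha> m b \<phi> x = (\<integral>\<^sup>+t. (\<integral>\<^sup>+y. ennreal (t powr (\<alpha> - real DIM('a) - 1)) *
      (ennreal (osc_weight b m x t y * \<phi> y) * indicator (cball x t) y) * indicator {0<..} t \<partial>lborel) \<partial>lborel)"
    unfolding hedberg_op_def by (simp add: nn_integral_cmult nn_integral_multc)
  also have "\<dots> = (\<integral>\<^sup>+y. (\<integral>\<^sup>+t. ennreal (t powr (\<alpha> - real DIM('a) - 1)) *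
      (ennreal (osc_weight b m x t y * \<phi> y) * indicator (cball x t) y) * indicator {0<..} t \<partial>lborel) \<partial>lborel)"
    by (intro lborel_pair.Fubini') measurable
  finally show ?thesis .
qed

text \<open>For each radius t >= |x - y| the oscillation is split with that very \<open>t\<close>,
  so no single radius has to be chosen. In the second term y is the centre of the ball, and
  exchanging the order of integration exhibits it as the operator applied to
  \<open>\<psi>\<close>.\<close>

lemma osc_form_le_hedberg_op:
  fixes b \<phi> \<psi> :: "'a::euclidean_space \<Rightarrow> real"
  assumes \<alpha>: "\<alpha> < real DIM('a)" and [measurable]: "b \<in> borel_measurable borel" "\<phi> \<in> borel_measurable borel" "\<psi> \<in> borel_measurable borel"
    and \<phi>: "\<And>x. 0 \<le> \<phi> x" and \<psi>: "\<And>x. 0 \<le> \<psi> x" and D: "0 < D"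
    "\<And>x y t. 0 < t \<Longrightarrow> dist x y \<le> t \<Longrightarrow> 1 + \<bar>b x - b y\<bar> powr m \<le> D * (osc_weight b m x t y + osc_weight b m y t x)"
  shows "osc_form \<alpha> m b \<phi> \<psi> \<le> ennreal ((real DIM('a) - \<alpha>) * D) *
     ((\<integral>\<^sup>+x. ennreal (\<psi> x) * hedberg_op \<alpha> m b \<phi> x \<partial>lborel) + (\<integral>\<^sup>+x. ennreal (\<phi> x) * hedberg_op \<alpha> m b \<psi> x \<partial>lborel))"
proof -
  define n where "n = real DIM('a)"
  define H where "H u x y = (\<integral>\<^sup>+t. ennreal (t powr (\<alpha> - n - 1)) *
      (ennreal (osc_weight b m x t y * u y) * indicator (cball x t) y) * indicator {0<..} t \<partial>lborel)" for u and x y :: 'a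
  have [measurable]: "(\<lambda>(x, y). H u x y) \<in> borel_measurable (borel \<Otimes>\<^sub>M borel)" "H u x \<in> borel_measurable borel"
    if [measurable]: "u \<in> borel_measurable borel" for u x
    unfolding H_def[abs_def] by measurable
  have w: "0 \<le> osc_weight b m x t y" for x t y using osc_weight_ge_1[of b m x t y] by linarith
  let ?c = "ennreal ((n - \<alpha>) * D)"
  have pt: "ennreal ((1 + \<bar>b x - b y\<bar> powr m) * \<phi> y * \<psi> x * norm (x - y) powr (\<alpha> - n))
     \<le> ?c * (ennreal (\<psi> x) * H \<phi> x y + ennreal (\<phi> y) * H \<psi> y x)" for x y
  \<comment> \<open>On the diagonal the left side is 0, because \<open>0 powr e = 0\<close>.\<close>
  proof (cases "x = y")
    case False
    define k where "k = (1 + \<bar>b x - b y\<bar> powr m) * \<phi> y * \<psi> x"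
    have k: "0 \<le> k" unfolding k_def using \<phi> \<psi> by (simp add: add_nonneg_nonneg)
    have d: "0 < dist x y" using False by simp
    have "ennreal (k * norm (x - y) powr (\<alpha> - n)) = ennreal k * ennreal (dist x y powr (\<alpha> - n))"
      using k by (simp add: ennreal_mult dist_norm)
    also have "\<dots> = ennreal k * (ennreal (n - \<alpha>) * (\<integral>\<^sup>+t\<in>{dist x y..}. ennreal (t powr (\<alpha> - n - 1)) \<partial>lborel))"
      using \<alpha> d by (subst riesz_kernel_eq_nn_integral) (auto simp: n_def)
    also have "\<dots> = (\<integral>\<^sup>+t. ennreal (n - \<alpha>) * (ennreal (t powr (\<alpha> - n - 1)) * (ennreal k * indicator {dist x y..} t)) \<partial>lborel)"
      by (simp add: nn_integral_cmult[symmetric] mult_ac)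
    also have "\<dots> \<le> (\<integral>\<^sup>+t. ?c * (ennreal (\<psi> x) * (ennreal (t powr (\<alpha> - n - 1)) *
           (ennreal (osc_weight b m x t y * \<phi> y) * indicator (cball x t) y) * indicator {0<..} t) +
         ennreal (\<phi> y) * (ennreal (t powr (\<alpha> - n - 1)) *
           (ennreal (osc_weight b m y t x * \<psi> x) * indicator (cball y t) x) * indicator {0<..} t)) \<partial>lborel)"
    proof (rule nn_integral_mono)
      fix t :: real
      let ?u = "t powr (\<alpha> - n - 1)" and ?A = "osc_weight b m x t y" and ?B = "osc_weight b m y t x"
      show "ennreal (n - \<alpha>) * (ennreal ?u * (ennreal k * indicator {dist x y..} t)) \<le>
        ?c * (ennreal (\<psi> x) * (ennreal ?u * (ennreal (?A * \<phi> y) * indicator (cball x t) y) * indicator {0<..} t) +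
         ennreal (\<phi> y) * (ennreal ?u * (ennreal (?B * \<psi> x) * indicator (cball y t) x) * indicator {0<..} t))"
      proof (cases "dist x y \<le> t")
        case True
        then have t: "0 < t" using d by linarith
        have "k = (1 + \<bar>b x - b y\<bar> powr m) * (\<phi> y * \<psi> x)" by (simp add: k_def mult_ac)
        also have "\<dots> \<le> D * (?A + ?B) * (\<phi> y * \<psi> x)"
          by (intro mult_right_mono D(2) t True mult_nonneg_nonneg \<phi> \<psi>)
        finally have "(n - \<alpha>) * (?u * k) \<le> (n - \<alpha>) * (?u * (D * (?A + ?B) * (\<phi> y * \<psi> x)))"
          using \<alpha> by (intro mult_left_mono) (auto simp: n_def)
        also have "\<dots> = (n - \<alpha>) * D * (\<psi> x * (?u * (?A * \<phi> y)) + \<phi> y * (?u * (?B * \<psi> x)))"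
          by (simp add: algebra_simps)
        finally have "ennreal ((n - \<alpha>) * (?u * k)) \<le> ennreal ((n - \<alpha>) * D * (\<psi> x * (?u * (?A * \<phi> y)) + \<phi> y * (?u * (?B * \<psi> x))))"
          by (rule ennreal_leI)
        moreover have "ennreal ((n - \<alpha>) * (?u * k)) = ennreal (n - \<alpha>) * (ennreal ?u * ennreal k)"
          using \<alpha> k by (simp add: ennreal_mult n_def)
        moreover have "ennreal ((n - \<alpha>) * D * (\<psi> x * (?u * (?A * \<phi> y)) + \<phi> y * (?u * (?B * \<psi> x))))
          = ?c * (ennreal (\<psi> x) * (ennreal ?u * ennreal (?A * \<phi> y)) + ennreal (\<phi> y) * (ennreal ?u * ennreal (?B * \<psi> x)))"
          using \<alpha> D(1) \<phi>[of y] \<psi>[of x] w[of x t y] w[of y t x] by (simp add: ennreal_mult n_def)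
        ultimately show ?thesis using True t by (simp add: dist_commute)
      qed simp
    qed
    also have "\<dots> = ?c * (ennreal (\<psi> x) * H \<phi> x y + ennreal (\<phi> y) * H \<psi> y x)"
      unfolding H_def by (simp add: nn_integral_cmult nn_integral_add)
    finally show ?thesis unfolding k_def .
  qed simp
  have "osc_form \<alpha> m b \<phi> \<psi> \<le> (\<integral>\<^sup>+x. (\<integral>\<^sup>+y. ?c * (ennreal (\<psi> x) * H \<phi> x y + ennreal (\<phi> y) * H \<psi> y x) \<partial>lborel) \<partial>lborel)"
    unfolding osc_form_def n_def[symmetric] by (intro nn_integral_mono pt)
  also have "\<dots> = ?c * ((\<integral>\<^sup>+x. (\<integral>\<^sup>+y. ennreal (\<psi> x) * H \<phi> x y \<partial>lborel) \<partial>lborel) + (\<integral>\<^sup>+x. (\<integral>\<^sup>+y. ennreal (\<phi> y) * H \<psi> y x \<partial>lborel) \<partial>lborel))"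
    by (simp add: nn_integral_cmult nn_integral_add)
  also have "(\<integral>\<^sup>+x. (\<integral>\<^sup>+y. ennreal (\<phi> y) * H \<psi> y x \<partial>lborel) \<partial>lborel) = (\<integral>\<^sup>+y. (\<integral>\<^sup>+x. ennreal (\<phi> y) * H \<psi> y x \<partial>lborel) \<partial>lborel)"
    by (intro lborel_pair.Fubini') measurable
  also have "\<dots> = (\<integral>\<^sup>+y. ennreal (\<phi> y) * hedberg_op \<alpha> m b \<psi> y \<partial>lborel)"
    by (simp add: nn_integral_cmult hedberg_op_Fubini H_def n_def)
  also have "(\<integral>\<^sup>+x. (\<integral>\<^sup>+y. ennreal (\<psi> x) * H \<phi> x y \<partial>lborel) \<partial>lborel) = (\<integral>\<^sup>+x. ennreal (\<psi> x) * hedberg_op \<alpha> m b \<phi> x \<partial>lborel)"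
    by (simp add: nn_integral_cmult hedberg_op_Fubini H_def n_def)
  finally show ?thesis by (simp add: n_def)
qed

lemma young_ennreal:
  assumes "1 < r" "0 \<le> w"
  shows "ennreal w * U \<le> ennreal (w powr (r / (r - 1))) + epowr U r"
proof (cases U)
  case (real u)
  then show ?thesis
    using weighted_young[of r 1 w u] assms by (simp flip: ennreal_mult ennreal_plus)
qed simp

text \<open>The relation between s and r passes to the conjugate exponents: 1/s' = 1/r' -
  \<alpha>/n. So the operator takes L^s to L^r and also L^r' to L^s', and each of the two pairings
  is between conjugate exponents.\<close>

lemma osc_form_bounded:
  fixes \<alpha> s r :: real
  assumes \<alpha>: "0 < \<alpha>" "\<alpha> < real DIM('a::euclidean_space)" and s: "1 < s" and r: "1 < r"
    and rs: "1 / r = 1 / s - \<alpha> / real DIM('a)" and K: "0 < K" and m: "0 < m"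
  obtains C :: real where "0 < C"
    "\<And>b \<phi> \<psi> :: 'a \<Rightarrow> real. ball_osc_le K b \<Longrightarrow> \<phi> \<in> borel_measurable borel \<Longrightarrow> (\<And>x. 0 \<le> \<phi> x) \<Longrightarrow>
      (\<integral>\<^sup>+x. ennreal (\<phi> x powr s) \<partial>lborel) \<le> 1 \<Longrightarrow> \<psi> \<in> borel_measurable borel \<Longrightarrow> (\<And>x. 0 \<le> \<psi> x) \<Longrightarrow>
      (\<integral>\<^sup>+x. ennreal (\<psi> x powr (r / (r - 1))) \<partial>lborel) \<le> 1 \<Longrightarrow> osc_form \<alpha> m b \<phi> \<psi> \<le> ennreal C"
proof -
  define r' s' where "r' = r / (r - 1)" and "s' = s / (s - 1)"
  have conj: "1 < r'" "1 < s'" "s' / (s' - 1) = s" using r s by (auto simp: r'_def s'_def field_simps)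
  have "1 / r' = 1 - 1 / r" "1 / s' = 1 - 1 / s" using r s by (auto simp: r'_def s'_def field_simps)
  then have rs': "1 / s' = 1 / r' - \<alpha> / real DIM('a)" using rs by simp
  obtain D :: real where D: "0 < D"
    "\<And>(b :: 'a \<Rightarrow> real) x y t. ball_osc_le K b \<Longrightarrow> 0 < t \<Longrightarrow> dist x y \<le> t \<Longrightarrow>
       1 + \<bar>b x - b y\<bar> powr m \<le> D * (osc_weight b m x t y + osc_weight b m y t x)"
    using oscillation_le_osc_weight[OF K m] by blast
  obtain C1 :: real where C1: "0 < C1"
    "\<And>b \<phi> :: 'a \<Rightarrow> real. ball_osc_le K b \<Longrightarrow> \<phi> \<in> borel_measurable borel \<Longrightarrow> (\<And>x. 0 \<le> \<phi> x) \<Longrightarrow>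
      (\<integral>\<^sup>+x. ennreal (\<phi> x powr s) \<partial>lborel) \<le> 1 \<Longrightarrow> (\<integral>\<^sup>+x. epowr (hedberg_op \<alpha> m b \<phi> x) r \<partial>lborel) \<le> ennreal C1"
    using hedberg_strong_type[OF \<alpha>(1) s r rs K m] by blast
  obtain C2 :: real where C2: "0 < C2"
    "\<And>b \<phi> :: 'a \<Rightarrow> real. ball_osc_le K b \<Longrightarrow> \<phi> \<in> borel_measurable borel \<Longrightarrow> (\<And>x. 0 \<le> \<phi> x) \<Longrightarrow>
      (\<integral>\<^sup>+x. ennreal (\<phi> x powr r') \<partial>lborel) \<le> 1 \<Longrightarrow> (\<integral>\<^sup>+x. epowr (hedberg_op \<alpha> m b \<phi> x) s' \<partial>lborel) \<le> ennreal C2"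
    using hedberg_strong_type[OF \<alpha>(1) conj(1,2) rs' K m] by blast
  define C where "C = (real DIM('a) - \<alpha>) * D * ((1 + C1) + (1 + C2))"
  have "0 < C" unfolding C_def using \<alpha> D(1) C1(1) C2(1) by (intro mult_pos_pos) auto
  moreover have "osc_form \<alpha> m b \<phi> \<psi> \<le> ennreal C"
    if b: "ball_osc_le K b" and [measurable]: "\<phi> \<in> borel_measurable borel" and \<phi>: "\<And>x. 0 \<le> \<phi> x"
      "(\<integral>\<^sup>+x. ennreal (\<phi> x powr s) \<partial>lborel) \<le> 1" and [measurable]: "\<psi> \<in> borel_measurable borel" and \<psi>: "\<And>x. 0 \<le> \<psi> x"
      "(\<integral>\<^sup>+x. ennreal (\<psi> x powr (r / (r - 1))) \<partial>lborel) \<le> 1" for b \<phi> \<psi> :: "'a \<Rightarrow> real"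
  proof -
    have [measurable]: "b \<in> borel_measurable borel" using ball_osc_leD[OF b] by auto
    have "(\<integral>\<^sup>+x. ennreal (\<psi> x) * hedberg_op \<alpha> m b \<phi> x \<partial>lborel)
      \<le> (\<integral>\<^sup>+x. ennreal (\<psi> x powr (r / (r - 1))) + epowr (hedberg_op \<alpha> m b \<phi> x) r \<partial>lborel)"
      by (intro nn_integral_mono young_ennreal r \<psi>)
    also have "\<dots> = (\<integral>\<^sup>+x. ennreal (\<psi> x powr (r / (r - 1))) \<partial>lborel) + (\<integral>\<^sup>+x. epowr (hedberg_op \<alpha> m b \<phi> x) r \<partial>lborel)"
      by (intro nn_integral_add) auto
    also have "\<dots> \<le> 1 + ennreal C1" by (intro add_mono \<psi> C1(2) b \<phi>) auto
    finally have 1: "(\<integral>\<^sup>+x. ennreal (\<psi> x) * hedberg_op \<alpha> m b \<phi> x \<partial>lborel) \<le> ennreal (1 + C1)" using C1(1) by simp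
    have "(\<integral>\<^sup>+x. ennreal (\<phi> x) * hedberg_op \<alpha> m b \<psi> x \<partial>lborel)
      \<le> (\<integral>\<^sup>+x. ennreal (\<phi> x powr (s' / (s' - 1))) + epowr (hedberg_op \<alpha> m b \<psi> x) s' \<partial>lborel)"
      by (intro nn_integral_mono young_ennreal conj \<phi>)
    also have "\<dots> = (\<integral>\<^sup>+x. ennreal (\<phi> x powr s) \<partial>lborel) + (\<integral>\<^sup>+x. epowr (hedberg_op \<alpha> m b \<psi> x) s' \<partial>lborel)"
      unfolding conj(3) by (intro nn_integral_add) auto
    also have "\<dots> \<le> 1 + ennreal C2" by (intro add_mono \<phi> C2(2) b \<psi>[folded r'_def]) auto
    finally have 2: "(\<integral>\<^sup>+x. ennreal (\<phi> x) * hedberg_op \<alpha> m b \<psi> x \<partial>lborel) \<le> ennreal (1 + C2)" using C2(1) by simp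
    have "osc_form \<alpha> m b \<phi> \<psi> \<le> ennreal ((real DIM('a) - \<alpha>) * D) *
     ((\<integral>\<^sup>+x. ennreal (\<psi> x) * hedberg_op \<alpha> m b \<phi> x \<partial>lborel) + (\<integral>\<^sup>+x. ennreal (\<phi> x) * hedberg_op \<alpha> m b \<psi> x \<partial>lborel))"
      by (rule osc_form_le_hedberg_op[OF \<alpha>(2) _ _ _ \<phi>(1) \<psi>(1) D(1) D(2)[OF b]]) auto
    also have "\<dots> \<le> ennreal ((real DIM('a) - \<alpha>) * D) * (ennreal (1 + C1) + ennreal (1 + C2))"
      by (intro mult_left_mono add_mono 1 2) auto
    also have "\<dots> = ennreal C"
      unfolding C_def using C1(1) C2(1) D(1) \<alpha> by (simp flip: ennreal_plus ennreal_mult)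
    finally show ?thesis .
  qed
  ultimately show ?thesis using that by blast
qed

section \<open>Duality and the absolute commutator\<close>

lemma nn_integral_lborel_shift:
  fixes h :: "'a::euclidean_space \<Rightarrow> ennreal"
  assumes [measurable]: "h \<in> borel_measurable borel"
  shows "(\<integral>\<^sup>+y. h (x - y) \<partial>lborel) = (\<integral>\<^sup>+y. h y \<partial>lborel)" (is ?A)
    and "(\<integral>\<^sup>+y. h (x + y) \<partial>lborel) = (\<integral>\<^sup>+y. h y \<partial>lborel)" (is ?B)
proof -
  have "(\<integral>\<^sup>+y. h y \<partial>distr lborel borel (\<lambda>y. x + c *\<^sub>R y)) = (\<integral>\<^sup>+y. h y \<partial>lborel)" if "\<bar>c\<bar> = 1" for c
  proof -
    have "c \<noteq> 0" using that by auto
    then show ?thesis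
      using that arg_cong[OF lborel_affine[of c x], of "\<lambda>M. integral\<^sup>N M h"] by (simp add: density_1)
  qed
  from this[of "-1"] this[of 1] show ?A ?B by (simp_all add: nn_integral_distr)
qed

text \<open>Testing against the extremal function of Hoelder's inequality, a multiple of T^(r-1). As
  the integral of T^r is not known to be finite beforehand, \<open>T\<close> is first cut off in
  height and in support; monotone convergence removes the cut.\<close>

lemma dual_bound:
  fixes T :: "'a::euclidean_space \<Rightarrow> ennreal"
  assumes [measurable]: "T \<in> borel_measurable borel" and r: "1 < r" and C: "0 < C"
    and dual: "\<And>\<psi>. \<psi> \<in> borel_measurable borel \<Longrightarrow> (\<And>x. 0 \<le> \<psi> x) \<Longrightarrow> (\<integral>\<^sup>+x. ennreal (\<psi> x powr (r / (r - 1))) \<partial>lborel) \<le> 1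
       \<Longrightarrow> (\<integral>\<^sup>+x. ennreal (\<psi> x) * T x \<partial>lborel) \<le> ennreal C"
  shows "(\<integral>\<^sup>+x. epowr (T x) r \<partial>lborel) \<le> ennreal (C powr r)"
proof -
  define S where "S N x = enn2real (min (T x) (of_nat N)) * indicator (cball 0 (real N)) x" for N :: nat and x
  have [measurable]: "S N \<in> borel_measurable borel" for N unfolding S_def[abs_def] by measurable
  have S0: "0 \<le> S N x" for N x by (simp add: S_def)
  have fin: "min (T x) (of_nat N) < top" for x N
    by (metis ennreal_of_nat_eq_real_of_nat ennreal_less_top min_less_iff_disj)
  have S_T: "ennreal (S N x) \<le> T x" for N x
    using fin[of x N] by (auto simp: S_def split: split_indicator)
  have S_N: "S N x \<le> real N * indicator (cball 0 (real N)) x" for N x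
  proof -
    have "enn2real (min (T x) (of_nat N)) \<le> enn2real (ennreal (real N))"
      by (intro enn2real_mono) (auto simp: ennreal_of_nat_eq_real_of_nat)
    then show ?thesis by (auto simp: S_def split: split_indicator)
  qed
  have bound: "(\<integral>\<^sup>+x. ennreal (S N x powr r) \<partial>lborel) \<le> ennreal (C powr r)" for N
  proof -
    have "(\<integral>\<^sup>+x. ennreal (S N x powr r) \<partial>lborel) \<le> (\<integral>\<^sup>+x. ennreal (real N powr r) * indicator (cball 0 (real N)) (x::'a) \<partial>lborel)"
    proof (rule nn_integral_mono)
      fix x :: 'a
      have "S N x powr r \<le> (real N * indicator (cball 0 (real N)) x) powr r"
        using r S0 S_N by (intro powr_mono2) auto
      then show "ennreal (S N x powr r) \<le> ennreal (real N powr r) * indicator (cball 0 (real N)) x"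
        using r by (auto split: split_indicator intro: ennreal_leI)
    qed
    also have "\<dots> < top"
      using emeasure_lborel_cball_finite[of "0::'a" "real N"] by (simp add: nn_integral_cmult ennreal_mult_less_top less_top)
    finally obtain j where j: "(\<integral>\<^sup>+x. ennreal (S N x powr r) \<partial>lborel) = ennreal j" "0 \<le> j"
      by (cases "\<integral>\<^sup>+x. ennreal (S N x powr r) \<partial>lborel") auto
    show ?thesis
    proof (cases "j = 0")
      case False
      then have jp: "0 < j" using j by simp
      \<comment> \<open>The factor j^(-(r-1)/r) normalises the (r-1)-th power of \<open>S N\<close>
        in L^(r/(r-1)); pairing with \<open>S N\<close> then gives j^(1 - (r-1)/r) =
        j^(1/r).\<close>
      define \<psi> where "\<psi> x = j powr (- (r - 1) / r) * S N x powr (r - 1)" for x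
      have [measurable]: "\<psi> \<in> borel_measurable borel" unfolding \<psi>_def[abs_def] by measurable
      have \<psi>_powr: "\<psi> x powr (r / (r - 1)) = (1 / j) * S N x powr r" for x
      proof -
        have e: "- (r - 1) / r * (r / (r - 1)) = -1" "(r - 1) * (r / (r - 1)) = r" using r by (auto simp: field_simps)
        have "(j powr (- (r - 1) / r)) powr (r / (r - 1)) = 1 / j"
          unfolding powr_powr e(1) using jp by (simp add: powr_minus divide_inverse)
        moreover have "(S N x powr (r - 1)) powr (r / (r - 1)) = S N x powr r" unfolding powr_powr e(2) ..
        ultimately show ?thesis unfolding \<psi>_def by (subst powr_mult) auto
      qed
      have "(\<integral>\<^sup>+x. ennreal (\<psi> x powr (r / (r - 1))) \<partial>lborel) = (\<integral>\<^sup>+x. ennreal (1 / j) * ennreal (S N x powr r) \<partial>lborel)"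
        unfolding \<psi>_powr using jp by (intro nn_integral_cong ennreal_mult) auto
      also have "\<dots> = ennreal (1 / j) * ennreal j"
        by (subst nn_integral_cmult) (auto simp: j)
      also have "\<dots> = 1" using jp by (simp flip: ennreal_mult)
      finally have "(\<integral>\<^sup>+x. ennreal (\<psi> x) * T x \<partial>lborel) \<le> ennreal C"
        by (intro dual) (auto simp: \<psi>_def)
      moreover have "(\<integral>\<^sup>+x. ennreal (j powr (- (r - 1) / r)) * ennreal (S N x powr r) \<partial>lborel) \<le> (\<integral>\<^sup>+x. ennreal (\<psi> x) * T x \<partial>lborel)"
      proof (rule nn_integral_mono)
        fix x
        have "S N x powr r = S N x powr (r - 1) * S N x"
          using S0[of N x] by (cases "S N x = 0") (auto simp: powr_diff)
        then have "ennreal (j powr (- (r - 1) / r)) * ennreal (S N x powr r) = ennreal (\<psi> x) * ennreal (S N x)"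
          using S0[of N x] by (simp add: \<psi>_def mult.assoc flip: ennreal_mult)
        also have "\<dots> \<le> ennreal (\<psi> x) * T x" by (intro mult_left_mono S_T) auto
        finally show "ennreal (j powr (- (r - 1) / r)) * ennreal (S N x powr r) \<le> ennreal (\<psi> x) * T x" .
      qed
      ultimately have "ennreal (j powr (- (r - 1) / r)) * ennreal j \<le> ennreal C"
        by (simp add: nn_integral_cmult j)
      then have "j powr (- (r - 1) / r) * j \<le> C" using C j by (simp flip: ennreal_mult)
      moreover have "j powr (- (r - 1) / r) * j = j powr (1 / r)"
      proof -
        have "- (r - 1) / r + 1 = 1 / r" using r by (simp add: field_simps)
        then have "j powr (1 / r) = j powr (- (r - 1) / r) * j powr 1" by (metis powr_add)
        then show ?thesis using jp by simp
      qed
      ultimately have "(j powr (1 / r)) powr r \<le> C powr r" using r by (intro powr_mono2) auto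
      then show ?thesis using j jp r by (simp add: powr_powr ennreal_leI)
    qed (simp add: j)
  qed
  have mono: "S N x \<le> S M x" if "N \<le> M" for N M x
  proof -
    have "enn2real (min (T x) (of_nat N)) \<le> enn2real (min (T x) (of_nat M))"
      using that fin by (intro enn2real_mono min.mono) auto
    then show ?thesis using that by (auto simp: S_def split: split_indicator)
  qed
  have "epowr (T x) r \<le> (SUP N. ennreal (S N x powr r))" for x
  proof (cases "T x")
    case (real u)
    obtain N :: nat where N: "max u (norm x) \<le> real N" using real_arch_simple by blast
    then have "ennreal u \<le> of_nat N" by (simp add: ennreal_of_nat_eq_real_of_nat ennreal_leI)
    then have "S N x = u" using real N by (simp add: S_def min_absorb1)
    then have "epowr (T x) r = ennreal (S N x powr r)" using real by simp
    then show ?thesis using SUP_upper[of N UNIV "\<lambda>N. ennreal (S N x powr r)"] by simp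
  next
    case top
    have sup_top: "(SUP N. ennreal (S N x powr r)) = top"
    proof (rule ennreal_SUP_eq_top)
      fix k :: nat
      obtain N :: nat where N: "max (max 1 (real k)) (norm x) \<le> real N" using real_arch_simple by blast
      have "S N x = real N" using top N by (simp add: S_def ennreal_of_nat_eq_real_of_nat)
      moreover have "real N powr 1 \<le> real N powr r" using r N by (intro powr_mono) auto
      ultimately have "of_nat k \<le> ennreal (S N x powr r)"
        using N by (simp add: ennreal_of_nat_eq_real_of_nat ennreal_leI)
      then show "\<exists>i\<in>UNIV. of_nat k \<le> ennreal (S i x powr r)" by blast
    qed
    show ?thesis unfolding sup_top by simp
  qed
  then have "(\<integral>\<^sup>+x. epowr (T x) r \<partial>lborel) \<le> (\<integral>\<^sup>+x. (SUP N. ennreal (S N x powr r)) \<partial>lborel)"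
    by (intro nn_integral_mono)
  also have "\<dots> = (SUP N. (\<integral>\<^sup>+x. ennreal (S N x powr r) \<partial>lborel))"
    using r S0 mono by (intro nn_integral_monotone_convergence_SUP)
      (auto simp: incseq_def le_fun_def intro!: ennreal_leI powr_mono2)
  also have "\<dots> \<le> ennreal (C powr r)" by (intro SUP_least bound)
  finally show ?thesis .
qed

text \<open>Dominates the integrand of BI(f,g) and that of the first commutator at once; where it is
  finite, both integrals converge absolutely.\<close>

definition abs_comm :: "real \<Rightarrow> ('a::euclidean_space \<Rightarrow> real) \<Rightarrow> ('a \<Rightarrow> real) \<Rightarrow> ('a \<Rightarrow> real) \<Rightarrow> 'a \<Rightarrow> ennreal" where
  "abs_comm \<alpha> b f g x = (\<integral>\<^sup>+y. ennreal ((1 + \<bar>b x - b (x - y)\<bar>) * \<bar>f (x - y)\<bar> * \<bar>g (x + y)\<bar> * norm y powr (\<alpha> - real DIM('a))) \<partial>lborel)"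

lemma measurable_abs_comm [measurable]:
  fixes b f g :: "'a::euclidean_space \<Rightarrow> real"
  assumes [measurable]: "b \<in> borel_measurable borel" "f \<in> borel_measurable borel" "g \<in> borel_measurable borel"
  shows "abs_comm \<alpha> b f g \<in> borel_measurable borel"
  unfolding abs_comm_def[abs_def] by measurable

text \<open>The substitutions z = x - y in the term with \<open>f\<close> and z = x + y in the term
  with \<open>g\<close> bring both to the linear form. The oscillation at x - y is assigned to the
  factor \<open>f\<close>, which lives at the same point.\<close>

lemma nn_integral_abs_comm_le:
  fixes b f g :: "'a::euclidean_space \<Rightarrow> real"
  assumes [measurable]: "b \<in> borel_measurable borel" "f \<in> borel_measurable borel" "g \<in> borel_measurable borel" "\<psi> \<in> borel_measurable borel"
    and \<psi>: "\<And>x. 0 \<le> \<psi> x" and m: "1 < m"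
  shows "(\<integral>\<^sup>+x. ennreal (\<psi> x) * abs_comm \<alpha> b f g x \<partial>lborel)
     \<le> osc_form \<alpha> m b (\<lambda>y. \<bar>f y\<bar> powr m) \<psi> + 2 * osc_form \<alpha> m b (\<lambda>y. \<bar>g y\<bar> powr (m / (m - 1))) \<psi>"
proof -
  define n where "n = real DIM('a)"
  define F where "F u x z = ennreal ((1 + \<bar>b x - b z\<bar> powr m) * u z * \<psi> x * norm (x - z) powr (\<alpha> - n))" for u and x z :: 'a
  have [measurable]: "(\<lambda>(x, y). F u x y) \<in> borel_measurable (borel \<Otimes>\<^sub>M borel)" "F u x \<in> borel_measurable borel"
    if [measurable]: "u \<in> borel_measurable borel" for u x
    unfolding F_def[abs_def] by measurable
  let ?f = "\<lambda>y. \<bar>f y\<bar> powr m" and ?g = "\<lambda>y. \<bar>g y\<bar> powr (m / (m - 1))"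
  have pt: "ennreal (\<psi> x) * ennreal ((1 + \<bar>b x - b (x - y)\<bar>) * \<bar>f (x - y)\<bar> * \<bar>g (x + y)\<bar> * norm y powr (\<alpha> - n))
     \<le> F ?f x (x - y) + 2 * F ?g x (x + y)" for x y
  proof -
    define d u v k where "d = \<bar>b x - b (x - y)\<bar>" and "u = \<bar>f (x - y)\<bar>" and "v = \<bar>g (x + y)\<bar>" and "k = norm y powr (\<alpha> - n)"
    have nn: "0 \<le> d" "0 \<le> u" "0 \<le> v" "0 \<le> k" by (auto simp: d_def u_def v_def k_def)
    \<comment> \<open>Young's inequality for u v serves the summand 1, and for (d u) v the
      oscillation; together they produce the factor 2 in front of the power of
      \<open>v\<close>.\<close>
    have y1: "v * u \<le> v powr (m / (m - 1)) + u powr m" "v * (d * u) \<le> v powr (m / (m - 1)) + (d * u) powr m"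
      using weighted_young[of m 1 v u] weighted_young[of m 1 v "d * u"] nn m by simp_all
    have "(1 + d) * u * v \<le> (1 + d powr m) * u powr m + 2 * v powr (m / (m - 1))"
      using y1 nn by (simp add: powr_mult algebra_simps)
    \<comment> \<open>The weight with b(x + y) is at least 1 and is inserted only to give the second
      term the shape of \<open>osc_form\<close>.\<close>
    also have "\<dots> \<le> (1 + d powr m) * u powr m + 2 * ((1 + \<bar>b x - b (x + y)\<bar> powr m) * v powr (m / (m - 1)))"
      by (simp add: algebra_simps)
    finally have "\<psi> x * ((1 + d) * u * v * k) \<le> \<psi> x * (((1 + d powr m) * u powr m + 2 * ((1 + \<bar>b x - b (x + y)\<bar> powr m) * v powr (m / (m - 1)))) * k)"
      using \<psi> nn by (intro mult_left_mono mult_right_mono) auto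
    also have "\<dots> = (1 + d powr m) * u powr m * \<psi> x * k + 2 * ((1 + \<bar>b x - b (x + y)\<bar> powr m) * v powr (m / (m - 1)) * \<psi> x * k)"
      by (simp add: algebra_simps)
    finally have "ennreal (\<psi> x * ((1 + d) * u * v * k)) \<le> ennreal \<dots>" by (rule ennreal_leI)
    then show ?thesis
      using \<psi>[of x] nn unfolding F_def d_def[symmetric] u_def[symmetric] v_def[symmetric] k_def[symmetric]
      by (simp add: ennreal_mult k_def)
  qed
  have "(\<integral>\<^sup>+x. ennreal (\<psi> x) * abs_comm \<alpha> b f g x \<partial>lborel)
     = (\<integral>\<^sup>+x. (\<integral>\<^sup>+y. ennreal (\<psi> x) * ennreal ((1 + \<bar>b x - b (x - y)\<bar>) * \<bar>f (x - y)\<bar> * \<bar>g (x + y)\<bar> * norm y powr (\<alpha> - n)) \<partial>lborel) \<partial>lborel)"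
    unfolding abs_comm_def n_def by (simp add: nn_integral_cmult)
  also have "\<dots> \<le> (\<integral>\<^sup>+x. (\<integral>\<^sup>+y. F ?f x (x - y) + 2 * F ?g x (x + y) \<partial>lborel) \<partial>lborel)"
    by (intro nn_integral_mono pt)
  also have "\<dots> = (\<integral>\<^sup>+x. (\<integral>\<^sup>+y. F ?f x (x - y) \<partial>lborel) + 2 * (\<integral>\<^sup>+y. F ?g x (x + y) \<partial>lborel) \<partial>lborel)"
    by (intro nn_integral_cong) (simp add: nn_integral_add nn_integral_cmult)
  also have "\<dots> = (\<integral>\<^sup>+x. (\<integral>\<^sup>+y. F ?f x y \<partial>lborel) + 2 * (\<integral>\<^sup>+y. F ?g x y \<partial>lborel) \<partial>lborel)"
    by (simp add: nn_integral_lborel_shift)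
  also have "\<dots> = (\<integral>\<^sup>+x. (\<integral>\<^sup>+y. F ?f x y \<partial>lborel) \<partial>lborel) + 2 * (\<integral>\<^sup>+x. (\<integral>\<^sup>+y. F ?g x y \<partial>lborel) \<partial>lborel)"
    by (subst nn_integral_add) (auto simp: nn_integral_cmult)
  finally show ?thesis by (simp add: osc_form_def F_def n_def)
qed

lemma abs_comm_bounded:
  fixes \<alpha> p q r :: real
  assumes \<alpha>: "0 < \<alpha>" "\<alpha> < real DIM('a::euclidean_space)"
    and pq: "1 < p" "1 < q" "1 < r" "1 / p + 1 / q < 1"
    and r: "1 / r = 1 / p + 1 / q - \<alpha> / real DIM('a)" and K: "0 < K"
  obtains C :: real where "0 < C"
    "\<And>b f g :: 'a \<Rightarrow> real. ball_osc_le K b \<Longrightarrow> f \<in> borel_measurable borel \<Longrightarrow> g \<in> borel_measurable borel \<Longrightarrow>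
      (\<integral>\<^sup>+x. ennreal (\<bar>f x\<bar> powr p) \<partial>lborel) \<le> 1 \<Longrightarrow> (\<integral>\<^sup>+x. ennreal (\<bar>g x\<bar> powr q) \<partial>lborel) \<le> 1 \<Longrightarrow>
      (\<integral>\<^sup>+x. epowr (abs_comm \<alpha> b f g x) r \<partial>lborel) \<le> ennreal (C powr r)"
proof -
  \<comment> \<open>The exponent m = p/s and its conjugate q/s turn the unit bounds on the integrals
    of |f|^p and |g|^q into unit bounds on the s-th powers of |f|^m and |g|^(m/(m-1)).\<close>
  define s where "s = 1 / (1 / p + 1 / q)"
  define m where "m = p / s"
  have sum_pos: "0 < 1 / p + 1 / q" using pq by (intro add_pos_pos) auto
  have s: "1 < s" using pq(4) sum_pos by (simp add: s_def)
  have rs: "1 / r = 1 / s - \<alpha> / real DIM('a)" using r by (simp add: s_def)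
  have m_eq: "m = 1 + p / q" using pq by (simp add: m_def s_def distrib_left)
  have m: "1 < m" using pq by (simp add: m_eq)
  then have m0: "0 < m" by simp
  have ms: "m * s = p" using s by (simp add: m_def)
  have m's: "m / (m - 1) * s = q"
  proof -
    have "m - 1 = p / q" using m_eq by simp
    then have "m / (m - 1) = m * q / p" by simp
    then have "m / (m - 1) * s = (m * s) * q / p" by simp
    then show ?thesis using ms pq by simp
  qed
  obtain C :: real where C: "0 < C"
    "\<And>b \<phi> \<psi> :: 'a \<Rightarrow> real. ball_osc_le K b \<Longrightarrow> \<phi> \<in> borel_measurable borel \<Longrightarrow> (\<And>x. 0 \<le> \<phi> x) \<Longrightarrow>
      (\<integral>\<^sup>+x. ennreal (\<phi> x powr s) \<partial>lborel) \<le> 1 \<Longrightarrow> \<psi> \<in> borel_measurable borel \<Longrightarrow> (\<And>x. 0 \<le> \<psi> x) \<Longrightarrow>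
      (\<integral>\<^sup>+x. ennreal (\<psi> x powr (r / (r - 1))) \<partial>lborel) \<le> 1 \<Longrightarrow> osc_form \<alpha> m b \<phi> \<psi> \<le> ennreal C"
    using osc_form_bounded[OF \<alpha> s pq(3) rs K m0] by blast
  have "(\<integral>\<^sup>+x. epowr (abs_comm \<alpha> b f g x) r \<partial>lborel) \<le> ennreal ((3 * C) powr r)"
    if b: "ball_osc_le K b" and [measurable]: "f \<in> borel_measurable borel" "g \<in> borel_measurable borel"
      and f: "(\<integral>\<^sup>+x. ennreal (\<bar>f x\<bar> powr p) \<partial>lborel) \<le> 1" and g: "(\<integral>\<^sup>+x. ennreal (\<bar>g x\<bar> powr q) \<partial>lborel) \<le> 1" for b f g :: "'a \<Rightarrow> real"
  proof (rule dual_bound)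
    have bm[measurable]: "b \<in> borel_measurable borel" using ball_osc_leD[OF b] by auto
    then show "abs_comm \<alpha> b f g \<in> borel_measurable borel" by measurable
    fix \<psi> :: "'a \<Rightarrow> real" assume \<psi>: "\<psi> \<in> borel_measurable borel" "\<And>x. 0 \<le> \<psi> x" "(\<integral>\<^sup>+x. ennreal (\<psi> x powr (r / (r - 1))) \<partial>lborel) \<le> 1"
    have "(\<integral>\<^sup>+x. ennreal (\<psi> x) * abs_comm \<alpha> b f g x \<partial>lborel)
     \<le> osc_form \<alpha> m b (\<lambda>y. \<bar>f y\<bar> powr m) \<psi> + 2 * osc_form \<alpha> m b (\<lambda>y. \<bar>g y\<bar> powr (m / (m - 1))) \<psi>"
      by (rule nn_integral_abs_comm_le[OF bm _ _ \<psi>(1,2) m]) auto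
    also have "\<dots> \<le> ennreal C + 2 * ennreal C"
      using f g by (intro add_mono mult_left_mono C(2) b \<psi>) (auto simp: powr_powr ms m's simp del: times_divide_eq_left)
    also have "\<dots> = ennreal (3 * C)" using C(1) ennreal_plus[of C "2 * C"] by (simp add: ennreal_mult)
    finally show "(\<integral>\<^sup>+x. ennreal (\<psi> x) * abs_comm \<alpha> b f g x \<partial>lborel) \<le> ennreal (3 * C)" .
  qed (use pq C(1) in auto)
  with that[of "3 * C"] C(1) show ?thesis by auto
qed

section \<open>The bilinear fractional integral\<close>

text \<open>At y = 0 the two forms of the kernel agree as well: both are 0, by
  \<open>0 powr e = 0\<close> and the convention for division by 0.\<close>

lemma BI_eq_lborel:
  fixes f g :: "'a::euclidean_space \<Rightarrow> real"
  assumes [measurable]: "f \<in> borel_measurable borel" "g \<in> borel_measurable borel"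
  shows "BI \<alpha> f g x = (\<integral>y. f (x - y) * g (x + y) * norm y powr (\<alpha> - real DIM('a)) \<partial>lborel)"
proof -
  have k: "norm y powr (\<alpha> - real DIM('a)) = inverse (norm y powr (real DIM('a) - \<alpha>))" for y :: 'a
    by (metis minus_diff_eq powr_minus)
  show ?thesis unfolding BI_def k by (subst integral_completion) (auto simp: divide_inverse)
qed

lemma measurable_BI:
  fixes f g :: "'a::euclidean_space \<Rightarrow> real"
  assumes [measurable]: "f \<in> borel_measurable borel" "g \<in> borel_measurable borel"
  shows "BI \<alpha> f g \<in> borel_measurable borel"
proof -
  have "(\<lambda>x. \<integral>y. f (x - y) * g (x + y) * norm y powr (\<alpha> - real DIM('a)) \<partial>lborel) \<in> borel_measurable borel"
    by measurable
  moreover have "BI \<alpha> f g = (\<lambda>x. \<integral>y. f (x - y) * g (x + y) * norm y powr (\<alpha> - real DIM('a)) \<partial>lborel)"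
    by (rule ext) (simp add: BI_eq_lborel)
  ultimately show ?thesis by simp
qed

text \<open>The reflection y -> -y exchanges the two arguments and fixes the kernel; this reduces
  the second commutator to the first.\<close>

lemma BI_commute:
  fixes f g :: "'a::euclidean_space \<Rightarrow> real"
  assumes [measurable]: "f \<in> borel_measurable borel" "g \<in> borel_measurable borel"
  shows "BI \<alpha> f g x = BI \<alpha> g f x"
proof -
  let ?h = "\<lambda>y. f (x - y) * g (x + y) * norm y powr (\<alpha> - real DIM('a))"
  have "lborel = distr lborel borel (\<lambda>y::'a. - y)"
    using lborel_affine[of "-1" "0::'a"] by (simp add: density_1)
  then have "(\<integral>y. ?h y \<partial>lborel) = (\<integral>y. ?h y \<partial>distr lborel borel (\<lambda>y. - y))" by simp
  also have "\<dots> = (\<integral>y. ?h (- y) \<partial>lborel)" by (rule integral_distr) auto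
  finally show ?thesis by (simp add: BI_eq_lborel mult_ac)
qed

section \<open>Changes on null sets, scaling, and the bound for Borel functions\<close>

lemma AE_lborel_shift:
  fixes x :: "'a::euclidean_space"
  assumes "AE y in lborel. P y"
  shows "AE y in lborel. P (x - y)" "AE y in lborel. P (x + y)"
proof -
  obtain N where N: "N \<in> null_sets lborel" "{y. \<not> P y} \<subseteq> N" using assms by (auto elim!: AE_E simp: null_sets_def)
  have [measurable]: "N \<in> sets borel" using N by auto
  have "(\<integral>\<^sup>+y. indicator N (x - y) \<partial>lborel) = 0" "(\<integral>\<^sup>+y. indicator N (x + y) \<partial>lborel) = 0"
    using N nn_integral_lborel_shift[of "indicator N" x] by auto
  then have "AE y in lborel. indicator N (x - y) = (0::ennreal)" "AE y in lborel. indicator N (x + y) = (0::ennreal)"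
    by (simp_all add: nn_integral_0_iff_AE)
  then show "AE y in lborel. P (x - y)" "AE y in lborel. P (x + y)"
    by (eventually_elim, use N in \<open>auto simp: indicator_eq_0_iff\<close>)+
qed

text \<open>Translates and reflections of null sets are null, so equality holds at every x.\<close>

lemma BI_cong_AE:
  fixes f g f' g' :: "'a::euclidean_space \<Rightarrow> real"
  assumes [measurable]: "f' \<in> borel_measurable borel" "g' \<in> borel_measurable borel"
    and "AE y in lborel. f y = f' y" "AE y in lborel. g y = g' y"
  shows "BI \<alpha> f g x = BI \<alpha> f' g' x"
proof -
  let ?h = "\<lambda>f g y. f (x - y) * g (x + y) / (norm y powr (real DIM('a) - \<alpha>))"
  have "AE y in lborel. ?h f' g' y = ?h f g y"
    using AE_lborel_shift(1)[OF assms(3), of x] AE_lborel_shift(2)[OF assms(4), of x] by eventually_elim simp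
  then have ae: "AE y in lebesgue. ?h f' g' y = ?h f g y" by (rule AE_completion)
  have m: "?h f' g' \<in> borel_measurable lebesgue" by (intro measurable_completion) simp
  show ?thesis unfolding BI_def
    using borel_measurable_AE[OF m ae] m ae by (intro integral_cong_AE) auto
qed

text \<open>Only for almost every x, because the commutator also contains the value of
  \<open>b\<close> at x itself.\<close>

lemma bcomm_cong_AE:
  fixes f g b f' g' b' :: "'a::euclidean_space \<Rightarrow> real"
  assumes [measurable]: "f' \<in> borel_measurable borel" "g' \<in> borel_measurable borel" "b' \<in> borel_measurable borel"
    and f: "AE y in lborel. f y = f' y" and g: "AE y in lborel. g y = g' y" and b: "AE y in lborel. b y = b' y"
  shows "AE x in lborel. bcomm i (BI \<alpha>) b f g x = bcomm i (BI \<alpha>) b' f' g' x"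
  using b
proof eventually_elim
  case (elim x)
  have "AE y in lborel. b y * f y = b' y * f' y" "AE y in lborel. b y * g y = b' y * g' y"
    using b f g by (auto elim!: AE_mp)
  then have "BI \<alpha> (\<lambda>y. b y * f y) g x = BI \<alpha> (\<lambda>y. b' y * f' y) g' x"
    "BI \<alpha> f (\<lambda>y. b y * g y) x = BI \<alpha> f' (\<lambda>y. b' y * g' y) x"
    by (auto intro!: BI_cong_AE f g)
  moreover have "BI \<alpha> f g x = BI \<alpha> f' g' x" by (intro BI_cong_AE f g) auto
  ultimately show ?case using elim by (simp add: bcomm_def)
qed

lemma measurable_bcomm:
  fixes f g b :: "'a::euclidean_space \<Rightarrow> real"
  assumes [measurable]: "f \<in> borel_measurable borel" "g \<in> borel_measurable borel" "b \<in> borel_measurable borel"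
  shows "bcomm i (BI \<alpha>) b f g \<in> borel_measurable borel"
proof -
  note measurable_BI[measurable]
  show ?thesis by (cases "i = 1") (simp_all add: bcomm_def[abs_def])
qed

lemma bcomm_scale:
  "bcomm i (BI \<alpha>) (\<lambda>y. b y / \<beta>) (\<lambda>y. f y / F) (\<lambda>y. g y / G) x = bcomm i (BI \<alpha>) b f g x / (\<beta> * F * G)"
proof -
  have BI_scale: "BI \<alpha> (\<lambda>y. f y / c) (\<lambda>y. g y / d) x = BI \<alpha> f g x / (c * d)" for f g c d
    unfolding BI_def by (simp add: integral_divide_zero[symmetric] mult_ac)
  show ?thesis
    using BI_scale[of "\<lambda>y. b y * f y" "\<beta> * F" g G] BI_scale[of f F "\<lambda>y. b y * g y" "\<beta> * G"] BI_scale[of f F g G]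
    by (simp add: bcomm_def diff_divide_distrib mult_ac)
qed

text \<open>The two Bochner integrals of the commutator can be merged into one only when both
  converge, since a non-integrable function has integral 0 by default. Finiteness of
  \<open>abs_comm\<close> at x supplies this.\<close>

lemma bcomm_le_abs_comm:
  fixes f g b :: "'a::euclidean_space \<Rightarrow> real"
  assumes [measurable]: "f \<in> borel_measurable borel" "g \<in> borel_measurable borel" "b \<in> borel_measurable borel"
    and fin: "abs_comm \<alpha> b f g x < top"
  shows "ennreal \<bar>bcomm 1 (BI \<alpha>) b f g x\<bar> \<le> abs_comm \<alpha> b f g x"
proof -
  define k where "k y = norm y powr (\<alpha> - real DIM('a))" for y :: 'a
  have k0: "0 \<le> k y" for y by (simp add: k_def)
  have [measurable]: "k \<in> borel_measurable borel" unfolding k_def[abs_def] by measurable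
  define w where "w y = (1 + \<bar>b x - b (x - y)\<bar>) * \<bar>f (x - y)\<bar> * \<bar>g (x + y)\<bar> * k y" for y
  have [measurable]: "w \<in> borel_measurable borel" unfolding w_def[abs_def] by measurable
  have w0: "0 \<le> w y" for y by (simp add: w_def k0)
  have int_w: "(\<integral>\<^sup>+y. ennreal (w y) \<partial>lborel) = abs_comm \<alpha> b f g x"
    by (simp add: w_def k_def abs_comm_def)
  then have w_int: "integrable lborel w"
    using fin w0 by (intro integrableI_nonneg) auto
  have le: "\<bar>f (x - y)\<bar> * \<bar>g (x + y)\<bar> * k y \<le> w y" for y
    unfolding w_def by (simp add: k0 algebra_simps)
  have int1: "integrable lborel (\<lambda>y. f (x - y) * g (x + y) * k y)"
    by (rule Bochner_Integration.integrable_bound[OF w_int]) (use le w0 k0 in \<open>auto simp: abs_mult\<close>)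
  have le3: "norm ((b (x - y) - b x) * (f (x - y) * g (x + y) * k y)) \<le> w y" for y
  proof -
    have "norm ((b (x - y) - b x) * (f (x - y) * g (x + y) * k y)) = \<bar>b x - b (x - y)\<bar> * (\<bar>f (x - y)\<bar> * \<bar>g (x + y)\<bar> * k y)"
      by (simp add: abs_mult abs_minus_commute k0)
    also have "\<dots> \<le> (1 + \<bar>b x - b (x - y)\<bar>) * (\<bar>f (x - y)\<bar> * \<bar>g (x + y)\<bar> * k y)"
      by (intro mult_right_mono) (auto simp: k0)
    finally show ?thesis by (simp add: w_def mult.assoc)
  qed
  have int3: "integrable lborel (\<lambda>y. (b (x - y) - b x) * (f (x - y) * g (x + y) * k y))"
    by (rule Bochner_Integration.integrable_bound[OF w_int]) (use le3 w0 in auto)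
  \<comment> \<open>From b(x - y) = (b(x - y) - b(x)) + b(x): integrability of the term with the
    product b f is assembled from the other two.\<close>
  have int2: "integrable lborel (\<lambda>y. b (x - y) * f (x - y) * g (x + y) * k y)"
    using Bochner_Integration.integrable_add[OF int3 integrable_mult_right[OF int1, of "b x"]]
    by (simp add: algebra_simps)
  have "bcomm 1 (BI \<alpha>) b f g x = (\<integral>y. b (x - y) * f (x - y) * g (x + y) * k y \<partial>lborel) - (\<integral>y. b x * (f (x - y) * g (x + y) * k y) \<partial>lborel)"
    by (simp add: bcomm_def BI_eq_lborel k_def)
  also have "\<dots> = (\<integral>y. b (x - y) * f (x - y) * g (x + y) * k y - b x * (f (x - y) * g (x + y) * k y) \<partial>lborel)"
    by (intro Bochner_Integration.integral_diff[symmetric] int2 integrable_mult_right int1)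
  also have "\<dots> = (\<integral>y. (b (x - y) - b x) * (f (x - y) * g (x + y) * k y) \<partial>lborel)"
    by (simp add: algebra_simps)
  finally have "ennreal \<bar>bcomm 1 (BI \<alpha>) b f g x\<bar> \<le> (\<integral>\<^sup>+y. ennreal (norm ((b (x - y) - b x) * (f (x - y) * g (x + y) * k y))) \<partial>lborel)"
    using integral_norm_bound_ennreal[OF int3] by simp
  also have "\<dots> \<le> (\<integral>\<^sup>+y. ennreal (w y) \<partial>lborel)"
    by (intro nn_integral_mono ennreal_leI le3)
  finally show ?thesis by (simp add: int_w)
qed

lemma bcomm_2_eq_bcomm_1:
  fixes f g b :: "'a::euclidean_space \<Rightarrow> real"
  assumes [measurable]: "f \<in> borel_measurable borel" "g \<in> borel_measurable borel" "b \<in> borel_measurable borel"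
  shows "bcomm 2 (BI \<alpha>) b f g x = bcomm 1 (BI \<alpha>) b g f x"
  by (simp add: bcomm_def BI_commute[of f])

lemma bcomm_bounded_borel:
  fixes \<alpha> p q r :: real and i :: nat
  assumes \<alpha>: "0 < \<alpha>" "\<alpha> < real DIM('a::euclidean_space)"
    and pq: "1 < p" "1 < q" "1 < r" "1 / p + 1 / q < 1"
    and r: "1 / r = 1 / p + 1 / q - \<alpha> / real DIM('a)" and K: "0 < K" and i: "i \<in> {1, 2}"
  obtains C :: real where "0 < C"
    "\<And>b f g :: 'a \<Rightarrow> real. ball_osc_le K b \<Longrightarrow> f \<in> borel_measurable borel \<Longrightarrow> g \<in> borel_measurable borel \<Longrightarrow>
      (\<integral>\<^sup>+x. ennreal (\<bar>f x\<bar> powr p) \<partial>lborel) \<le> 1 \<Longrightarrow> (\<integral>\<^sup>+x. ennreal (\<bar>g x\<bar> powr q) \<partial>lborel) \<le> 1 \<Longrightarrow>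
      (\<integral>\<^sup>+x. ennreal (\<bar>bcomm i (BI \<alpha>) b f g x\<bar> powr r) \<partial>lborel) \<le> ennreal (C powr r)"
proof -
  have le: "(\<integral>\<^sup>+x. ennreal (\<bar>bcomm 1 (BI \<alpha>) b f g x\<bar> powr r) \<partial>lborel) \<le> ennreal (C powr r)"
    if b: "ball_osc_le K b" and [measurable]: "f \<in> borel_measurable borel" "g \<in> borel_measurable borel"
      and bound: "(\<integral>\<^sup>+x. epowr (abs_comm \<alpha> b f g x) r \<partial>lborel) \<le> ennreal (C powr r)" for b f g :: "'a \<Rightarrow> real" and C
  proof -
    have [measurable]: "b \<in> borel_measurable borel" using ball_osc_leD[OF b] by auto
    have "(\<integral>\<^sup>+x. ennreal (\<bar>bcomm 1 (BI \<alpha>) b f g x\<bar> powr r) \<partial>lborel) \<le> (\<integral>\<^sup>+x. epowr (abs_comm \<alpha> b f g x) r \<partial>lborel)"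
    proof (rule nn_integral_mono)
      fix x
      show "ennreal (\<bar>bcomm 1 (BI \<alpha>) b f g x\<bar> powr r) \<le> epowr (abs_comm \<alpha> b f g x) r"
      proof (cases "abs_comm \<alpha> b f g x < top")
        case True
        have "ennreal (\<bar>bcomm 1 (BI \<alpha>) b f g x\<bar> powr r) = epowr (ennreal \<bar>bcomm 1 (BI \<alpha>) b f g x\<bar>) r" by simp
        also have "\<dots> \<le> epowr (abs_comm \<alpha> b f g x) r"
          using pq True by (intro epowr_mono bcomm_le_abs_comm) auto
        finally show ?thesis .
      next
        case False
        then have "abs_comm \<alpha> b f g x = top" by (simp add: less_top[symmetric])
        then show ?thesis by simp
      qed
    qed
    with bound show ?thesis by (rule order_trans[rotated])
  qed
  show ?thesis
  proof (cases "i = 1")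
    case True
    obtain C :: real where C: "0 < C" "\<And>b f g :: 'a \<Rightarrow> real. ball_osc_le K b \<Longrightarrow> f \<in> borel_measurable borel \<Longrightarrow> g \<in> borel_measurable borel \<Longrightarrow>
      (\<integral>\<^sup>+x. ennreal (\<bar>f x\<bar> powr p) \<partial>lborel) \<le> 1 \<Longrightarrow> (\<integral>\<^sup>+x. ennreal (\<bar>g x\<bar> powr q) \<partial>lborel) \<le> 1 \<Longrightarrow>
      (\<integral>\<^sup>+x. epowr (abs_comm \<alpha> b f g x) r \<partial>lborel) \<le> ennreal (C powr r)"
      using abs_comm_bounded[OF \<alpha> pq r K] by blast
    show ?thesis by (rule that[OF C(1)]) (use True C(2) le in simp)
  next
    case False
    then have i2: "i = 2" using i by simp
    \<comment> \<open>The second commutator is the first with f and g exchanged, so the bound is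
      taken with p and q exchanged.\<close>
    have pq': "1 / q + 1 / p < 1" "1 / r = 1 / q + 1 / p - \<alpha> / real DIM('a)" using pq r by auto
    obtain C :: real where C: "0 < C" "\<And>b f g :: 'a \<Rightarrow> real. ball_osc_le K b \<Longrightarrow> f \<in> borel_measurable borel \<Longrightarrow> g \<in> borel_measurable borel \<Longrightarrow>
      (\<integral>\<^sup>+x. ennreal (\<bar>f x\<bar> powr q) \<partial>lborel) \<le> 1 \<Longrightarrow> (\<integral>\<^sup>+x. ennreal (\<bar>g x\<bar> powr p) \<partial>lborel) \<le> 1 \<Longrightarrow>
      (\<integral>\<^sup>+x. epowr (abs_comm \<alpha> b f g x) r \<partial>lborel) \<le> ennreal (C powr r)"
      using abs_comm_bounded[OF \<alpha> pq(2,1,3) pq' K] by blast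
    show ?thesis
    proof (rule that[OF C(1)])
      fix b f g :: "'a \<Rightarrow> real"
      assume *: "ball_osc_le K b" "f \<in> borel_measurable borel" "g \<in> borel_measurable borel"
        "(\<integral>\<^sup>+x. ennreal (\<bar>f x\<bar> powr p) \<partial>lborel) \<le> 1" "(\<integral>\<^sup>+x. ennreal (\<bar>g x\<bar> powr q) \<partial>lborel) \<le> 1"
      have "(\<integral>\<^sup>+x. ennreal (\<bar>bcomm 1 (BI \<alpha>) b g f x\<bar> powr r) \<partial>lborel) \<le> ennreal (C powr r)"
        by (rule le[OF *(1,3,2) C(2)[OF *(1,3,2,5,4)]])
      then show "(\<integral>\<^sup>+x. ennreal (\<bar>bcomm i (BI \<alpha>) b f g x\<bar> powr r) \<partial>lborel) \<le> ennreal (C powr r)"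
        using * ball_osc_leD(2)[OF *(1)] by (simp add: i2 bcomm_2_eq_bcomm_1)
    qed
  qed
qed

section \<open>From BMO on cubes to the theorem\<close>

lemma cball_subset_cube:
  fixes x :: "'a::euclidean_space"
  shows "cball x t \<subseteq> cube (x - t *\<^sub>R One) (2 * t)"
proof
  fix y assume "y \<in> cball x t"
  then have "norm (y - x) \<le> t" by (simp add: dist_norm norm_minus_commute)
  then have "\<bar>(y - x) \<bullet> i\<bar> \<le> t" if "i \<in> Basis" for i using Basis_le_norm[OF that, of "y - x"] by linarith
  then show "y \<in> cube (x - t *\<^sub>R One) (2 * t)"
    by (auto simp: cube_def mem_box inner_simps abs_le_iff) force+
qed

lemma measure_cube:
  fixes a :: "'a::euclidean_space"
  assumes "0 \<le> h"
  shows "measure lebesgue (cube a h) = h ^ DIM('a)"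
proof -
  have "cbox a (a + h *\<^sub>R One) \<noteq> {}" using assms by (auto simp: box_ne_empty inner_simps)
  then show ?thesis by (simp add: cube_def content_cbox' inner_simps)
qed

lemma mean_osc_le_BMO_norm:
  assumes "in_BMO b" "0 < h"
  shows "mean_osc b (cube a h) \<le> BMO_norm b"
  unfolding BMO_norm_def using assms by (intro cSup_upper) (auto simp: in_BMO_def)

lemma BMO_norm_nonneg:
  fixes b :: "'a::euclidean_space \<Rightarrow> real"
  assumes "in_BMO b"
  shows "0 \<le> BMO_norm b"
proof -
  have "0 \<le> mean_osc b (cube (0::'a) 1)"
    by (auto simp: mean_osc_def avg_def set_lebesgue_integral_def intro!: divide_nonneg_nonneg integral_nonneg_AE)
  then show ?thesis using mean_osc_le_BMO_norm[OF assms, of 1 0] by simp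
qed

lemma in_BMO_cube_nn_integral_le:
  fixes b :: "'a::euclidean_space \<Rightarrow> real"
  assumes b: "in_BMO b" and h: "0 < h"
  shows "(\<integral>\<^sup>+y\<in>cube a h. ennreal \<bar>b y - avg (cube a h) b\<bar> \<partial>lborel) \<le> ennreal (BMO_norm b * h ^ DIM('a))"
proof -
  define c where "c = avg (cube a h) b"
  let ?w = "\<lambda>y. indicator (cube a h) y * \<bar>b y - c\<bar>"
  have [measurable]: "cube a h \<in> sets lebesgue" by (simp add: cube_def)
  have "integrable lebesgue (\<lambda>y. indicator (cube a h) y * b y)"
    using b h by (auto simp: in_BMO_def set_integrable_def)
  moreover have "integrable lebesgue (\<lambda>y. indicator (cube a h) y * c)"
    by (intro integrable_mult_left integrable_real_indicator)
      (use emeasure_bounded_finite[OF bounded_cbox, of a "a + h *\<^sub>R One"] in \<open>auto simp: cube_def\<close>)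
  ultimately have "integrable lebesgue (\<lambda>y. \<bar>indicator (cube a h) y * b y - indicator (cube a h) y * c\<bar>)"
    by (intro integrable_abs Bochner_Integration.integrable_diff)
  also have "(\<lambda>y. \<bar>indicator (cube a h) y * b y - indicator (cube a h) y * c\<bar>) = ?w"
    by (auto split: split_indicator)
  finally have int: "integrable lebesgue ?w" .
  have "(\<integral>\<^sup>+y\<in>cube a h. ennreal \<bar>b y - c\<bar> \<partial>lborel) = (\<integral>\<^sup>+y. ennreal (?w y) \<partial>lebesgue)"
    unfolding nn_integral_completion by (intro nn_integral_cong) (auto split: split_indicator)
  also have "\<dots> = ennreal (\<integral>y. ?w y \<partial>lebesgue)"
    by (rule nn_integral_eq_integral[OF int]) auto
  also have "(\<integral>y. ?w y \<partial>lebesgue) = mean_osc b (cube a h) * h ^ DIM('a)"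
    unfolding mean_osc_def c_def[symmetric]
    by (subst avg_def) (use h in \<open>simp add: set_lebesgue_integral_def measure_cube\<close>)
  also have "ennreal \<dots> \<le> ennreal (BMO_norm b * h ^ DIM('a))"
    using h mean_osc_le_BMO_norm[OF b h] by (intro ennreal_leI mult_right_mono) auto
  finally show ?thesis by (simp add: c_def)
qed

text \<open>The cube of side 2 t circumscribed about a ball of radius t has 2^n / V times its
  volume; the further factor 2 pays for replacing the cube mean by the ball mean. A positive upper
  bound \<open>\<beta>\<close> is used since the norm itself may vanish.\<close>

lemma in_BMO_ball_osc_le:
  fixes b b' :: "'a::euclidean_space \<Rightarrow> real"
  assumes b: "in_BMO b" and b'[measurable]: "b' \<in> borel_measurable borel" and ae: "AE y in lborel. b y = b' y"
    and \<beta>: "0 < \<beta>" "BMO_norm b \<le> \<beta>"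
  shows "ball_osc_le (2 * 2 ^ DIM('a) / unit_ball_vol (real DIM('a))) (\<lambda>y. b' y / \<beta>)"
proof -
  have loc: "loc_integrable (\<lambda>y. b' y / \<beta>)" unfolding loc_integrable_def
  proof (intro conjI allI)
    fix x :: 'a and t :: real
    \<comment> \<open>Integrability over balls is claimed for every real \<open>t\<close>, while
      cubes must have positive side.\<close>
    define s where "s = max t 1"
    define Q where "Q = cube (x - s *\<^sub>R One) (2 * s)"
    have s: "0 < s" "cball x t \<subseteq> cball x s" by (auto simp: s_def)
    have sub: "cball x t \<subseteq> Q" unfolding Q_def by (rule order_trans[OF s(2) cball_subset_cube])
    have [measurable]: "Q \<in> sets borel" by (simp add: Q_def cube_def)
    have "integrable lebesgue (\<lambda>y. indicator Q y * b y)"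
      using b s(1) by (auto simp: in_BMO_def set_integrable_def Q_def)
    moreover have "(\<lambda>y. indicator Q y * b' y) \<in> borel_measurable lebesgue"
      by (intro measurable_completion) simp
    moreover have "AE y in lebesgue. indicator Q y * b y = indicator Q y * b' y"
      using AE_completion[OF ae] by eventually_elim simp
    ultimately have "integrable lebesgue (\<lambda>y. indicator Q y * b' y)"
      by (rule integrable_cong_AE_imp)
    then have "integrable lborel (\<lambda>y. indicator Q y * b' y)"
      by (subst (asm) integrable_completion) auto
    then have "integrable lborel (\<lambda>y. indicator (cball x t) y * b' y)"
      by (rule Bochner_Integration.integrable_bound)
        (use subsetD[OF sub] in \<open>auto split: split_indicator\<close>)
    then have "integrable lborel (\<lambda>y. indicator (cball x t) y * b' y / \<beta>)"
      by (intro integrable_divide_zero)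
    then show "integrable lborel (\<lambda>y. indicator (cball x t) y * (b' y / \<beta>))" by simp
  qed auto
  show ?thesis unfolding ball_osc_le_def
  proof (intro conjI allI impI loc)
    fix x :: 'a and t :: real assume t: "0 < t"
    define V where "V = unit_ball_vol (real DIM('a))"
    have V: "0 < V" by (simp add: V_def)
    define Q where "Q = cube (x - t *\<^sub>R One) (2 * t)"
    define c where "c = avg Q b"
    have sub: "cball x t \<subseteq> Q" unfolding Q_def by (rule cball_subset_cube)
    have "(\<integral>\<^sup>+y\<in>cball x t. ennreal \<bar>b' y / \<beta> - c / \<beta>\<bar> \<partial>lborel) \<le> (\<integral>\<^sup>+y. ennreal (1 / \<beta>) * (ennreal \<bar>b' y - c\<bar> * indicator Q y) \<partial>lborel)"
    proof (rule nn_integral_mono)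
      fix y
      have "\<bar>b' y / \<beta> - c / \<beta>\<bar> = (1 / \<beta>) * \<bar>b' y - c\<bar>"
        using \<beta> by (simp add: abs_divide flip: diff_divide_distrib)
      then have "ennreal \<bar>b' y / \<beta> - c / \<beta>\<bar> = ennreal (1 / \<beta>) * ennreal \<bar>b' y - c\<bar>"
        using \<beta> by (simp only: ennreal_mult zero_le_divide_1_iff abs_ge_zero less_imp_le)
      then show "ennreal \<bar>b' y / \<beta> - c / \<beta>\<bar> * indicator (cball x t) y \<le> ennreal (1 / \<beta>) * (ennreal \<bar>b' y - c\<bar> * indicator Q y)"
        using subsetD[OF sub, of y] by (auto split: split_indicator)
    qed
    also have "\<dots> = ennreal (1 / \<beta>) * (\<integral>\<^sup>+y\<in>Q. ennreal \<bar>b' y - c\<bar> \<partial>lborel)"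
      by (intro nn_integral_cmult) (simp add: Q_def cube_def)
    also have "(\<integral>\<^sup>+y\<in>Q. ennreal \<bar>b' y - c\<bar> \<partial>lborel) = (\<integral>\<^sup>+y\<in>Q. ennreal \<bar>b y - c\<bar> \<partial>lborel)"
      using ae by (intro nn_integral_cong_AE) (auto elim!: eventually_mono)
    also have "ennreal (1 / \<beta>) * \<dots> \<le> ennreal (1 / \<beta>) * ennreal (\<beta> * (2 * t) ^ DIM('a))"
    proof (rule mult_left_mono)
      have "(\<integral>\<^sup>+y\<in>Q. ennreal \<bar>b y - c\<bar> \<partial>lborel) \<le> ennreal (BMO_norm b * (2 * t) ^ DIM('a))"
        using in_BMO_cube_nn_integral_le[OF b, of "2 * t" "x - t *\<^sub>R One"] t by (simp add: Q_def c_def)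
      also have "\<dots> \<le> ennreal (\<beta> * (2 * t) ^ DIM('a))"
        using \<beta> t by (intro ennreal_leI mult_right_mono) auto
      finally show "(\<integral>\<^sup>+y\<in>Q. ennreal \<bar>b y - c\<bar> \<partial>lborel) \<le> ennreal (\<beta> * (2 * t) ^ DIM('a))" .
    qed simp
    also have "\<dots> = ennreal ((2 * t) ^ DIM('a))" using \<beta> t by (simp flip: ennreal_mult)
    finally have "2 * (\<integral>\<^sup>+y\<in>cball x t. ennreal \<bar>b' y / \<beta> - c / \<beta>\<bar> \<partial>lborel) \<le> 2 * ennreal ((2 * t) ^ DIM('a))"
      by (rule mult_left_mono) simp
    also have "\<dots> = ennreal (2 * 2 ^ DIM('a) / V) * emeasure lborel (cball x t)"
    proof -
      have "2 * (2 * t) ^ DIM('a) = (2 * 2 ^ DIM('a) / V) * (V * t ^ DIM('a))" using V by (simp add: power_mult_distrib)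
      then have "ennreal (2 * (2 * t) ^ DIM('a)) = ennreal (2 * 2 ^ DIM('a) / V) * ennreal (V * t ^ DIM('a))"
        using V t by (simp only: ennreal_mult divide_nonneg_nonneg mult_nonneg_nonneg zero_le_power less_imp_le zero_le_numeral)
      moreover have "ennreal (2 * (2 * t) ^ DIM('a)) = 2 * ennreal ((2 * t) ^ DIM('a))" using t by (simp add: ennreal_mult)
      ultimately show ?thesis using t by (simp add: emeasure_cball V_def)
    qed
    finally show "(\<integral>\<^sup>+y\<in>cball x t. ennreal \<bar>b' y / \<beta> - ball_avg (\<lambda>y. b' y / \<beta>) x t\<bar> \<partial>lborel)
        \<le> ennreal (2 * 2 ^ DIM('a) / unit_ball_vol (real DIM('a))) * emeasure lborel (cball x t)"
      unfolding V_def by (rule order_trans[OF ball_osc_le_const[OF loc t]])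
  qed
qed

section \<open>Normalisation in L^p and the conclusion\<close>

lemma in_Lp_normalized:
  fixes f f' :: "'a::euclidean_space \<Rightarrow> real"
  assumes f: "in_Lp p f" and p: "0 < p" and ae: "AE y in lborel. f y = f' y" and F: "0 < F" "Lp_norm p f \<le> F"
  shows "(\<integral>\<^sup>+x. ennreal (\<bar>f' x / F\<bar> powr p) \<partial>lborel) \<le> 1"
proof -
  have int: "integrable lebesgue (\<lambda>x. \<bar>f x\<bar> powr p)" using f by (simp add: in_Lp_def)
  let ?I = "\<integral>x. \<bar>f x\<bar> powr p \<partial>lebesgue"
  have I0: "0 \<le> ?I" by (intro integral_nonneg_AE) simp
  have "?I = (?I powr (1 / p)) powr p" using p I0 by (simp add: powr_powr)
  also have "\<dots> \<le> F powr p" using F p by (intro powr_mono2) (auto simp: Lp_norm_def)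
  finally have I: "?I \<le> F powr p" .
  have "AE x in lborel. ennreal (\<bar>f' x / F\<bar> powr p) = ennreal (\<bar>f x\<bar> powr p / F powr p)"
    using ae by eventually_elim (use F in \<open>simp add: powr_divide\<close>)
  then have "(\<integral>\<^sup>+x. ennreal (\<bar>f' x / F\<bar> powr p) \<partial>lborel) = (\<integral>\<^sup>+x. ennreal (\<bar>f x\<bar> powr p / F powr p) \<partial>lebesgue)"
    unfolding nn_integral_completion by (rule nn_integral_cong_AE)
  also have "\<dots> = ennreal (?I / F powr p)"
    using int by (subst nn_integral_eq_integral) auto
  also have "\<dots> \<le> ennreal 1" using I F by (intro ennreal_leI) simp
  finally show ?thesis by simp
qed

lemma in_Lp_of_bound:
  fixes h h' :: "'a::euclidean_space \<Rightarrow> real"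
  assumes h'[measurable]: "h' \<in> borel_measurable borel" and ae: "AE x in lborel. h x = h' x" and r: "0 < r" and c: "0 < c" "0 \<le> C"
    and bound: "(\<integral>\<^sup>+x. ennreal (\<bar>h' x / c\<bar> powr r) \<partial>lborel) \<le> ennreal (C powr r)"
  shows "in_Lp r h \<and> Lp_norm r h \<le> C * c"
proof -
  have hm[measurable]: "h \<in> borel_measurable lebesgue"
  proof (rule borel_measurable_AE)
    show "h' \<in> borel_measurable lebesgue" by (intro measurable_completion) simp
    show "AE x in lebesgue. h' x = h x" using AE_completion[OF ae] by eventually_elim simp
  qed
  have "AE x in lborel. ennreal (\<bar>h x\<bar> powr r) = ennreal (c powr r) * ennreal (\<bar>h' x / c\<bar> powr r)"
    using ae by eventually_elim (use c in \<open>simp add: powr_divide flip: ennreal_mult\<close>)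
  then have "(\<integral>\<^sup>+x. ennreal (\<bar>h x\<bar> powr r) \<partial>lebesgue) = (\<integral>\<^sup>+x. ennreal (c powr r) * ennreal (\<bar>h' x / c\<bar> powr r) \<partial>lborel)"
    unfolding nn_integral_completion by (rule nn_integral_cong_AE)
  also have "\<dots> = ennreal (c powr r) * (\<integral>\<^sup>+x. ennreal (\<bar>h' x / c\<bar> powr r) \<partial>lborel)"
    by (intro nn_integral_cmult) simp
  also have "\<dots> \<le> ennreal (c powr r) * ennreal (C powr r)" by (intro mult_left_mono bound) simp
  also have "\<dots> = ennreal ((C * c) powr r)" using c by (simp add: powr_mult mult.commute flip: ennreal_mult)
  finally have le: "(\<integral>\<^sup>+x. ennreal (\<bar>h x\<bar> powr r) \<partial>lebesgue) \<le> ennreal ((C * c) powr r)" .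
  have int: "integrable lebesgue (\<lambda>x. \<bar>h x\<bar> powr r)"
    by (rule integrableI_nonneg) (use le in \<open>auto simp: le_less_trans[OF _ ennreal_less_top]\<close>)
  then have "ennreal (\<integral>x. \<bar>h x\<bar> powr r \<partial>lebesgue) \<le> ennreal ((C * c) powr r)"
    using le by (subst (asm) nn_integral_eq_integral) auto
  then have "(\<integral>x. \<bar>h x\<bar> powr r \<partial>lebesgue) \<le> (C * c) powr r" by simp
  then have "Lp_norm r h \<le> ((C * c) powr r) powr (1 / r)"
    unfolding Lp_norm_def using r by (intro powr_mono2) (auto intro: integral_nonneg_AE)
  also have "\<dots> = C * c" using r c by (simp add: powr_powr)
  finally show ?thesis using int hm by (simp add: in_Lp_def)
qed

theorem theorem3p1:
  fixes \<alpha> p q r :: real and i :: nat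
  assumes "0 < \<alpha>" "\<alpha> < real DIM('a::euclidean_space)"
    and "1 < p" "1 < q" "1 < r"
    and "1 / p + 1 / q < 1"
    and "1 / r = 1 / p + 1 / q - \<alpha> / real DIM('a)"
    and "i \<in> {1, 2}"
  shows "\<exists>C. \<forall>(b :: 'a \<Rightarrow> real) f g. in_BMO b \<and> in_Lp p f \<and> in_Lp q g \<longrightarrow>
           in_Lp r (bcomm i (BI \<alpha>) b f g) \<and>
           Lp_norm r (bcomm i (BI \<alpha>) b f g) \<le> C * BMO_norm b * Lp_norm p f * Lp_norm q g"
proof -
  define K where "K = 2 * 2 ^ DIM('a) / unit_ball_vol (real DIM('a))"
  have K: "0 < K" by (simp add: K_def)
  obtain C :: real where C: "0 < C"
    "\<And>b f g :: 'a \<Rightarrow> real. ball_osc_le K b \<Longrightarrow> f \<in> borel_measurable borel \<Longrightarrow> g \<in> borel_measurable borel \<Longrightarrow>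
      (\<integral>\<^sup>+x. ennreal (\<bar>f x\<bar> powr p) \<partial>lborel) \<le> 1 \<Longrightarrow> (\<integral>\<^sup>+x. ennreal (\<bar>g x\<bar> powr q) \<partial>lborel) \<le> 1 \<Longrightarrow>
      (\<integral>\<^sup>+x. ennreal (\<bar>bcomm i (BI \<alpha>) b f g x\<bar> powr r) \<partial>lborel) \<le> ennreal (C powr r)"
    using bcomm_bounded_borel[OF assms(1-7) K assms(8)] by blast
  have "in_Lp r (bcomm i (BI \<alpha>) b f g) \<and> Lp_norm r (bcomm i (BI \<alpha>) b f g) \<le> C * BMO_norm b * Lp_norm p f * Lp_norm q g"
    if b: "in_BMO b" and f: "in_Lp p f" and g: "in_Lp q g" for b f g :: "'a \<Rightarrow> real"
  proof -
    \<comment> \<open>The inputs are only Lebesgue measurable; the estimates are carried out for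
      Borel representatives, and the final norm ignores null sets.\<close>
    obtain b' where b': "b' \<in> borel_measurable borel" "AE x in lborel. b x = b' x"
      using b completion_ex_borel_measurable_real[of b lborel] by (auto simp: in_BMO_def)
    obtain f' where f': "f' \<in> borel_measurable borel" "AE x in lborel. f x = f' x"
      using f completion_ex_borel_measurable_real[of f lborel] by (auto simp: in_Lp_def)
    obtain g' where g': "g' \<in> borel_measurable borel" "AE x in lborel. g x = g' x"
      using g completion_ex_borel_measurable_real[of g lborel] by (auto simp: in_Lp_def)
    define B where "B = BMO_norm b"
    define F where "F = Lp_norm p f"
    define G where "G = Lp_norm q g"
    have nonneg: "0 \<le> B" "0 \<le> F" "0 \<le> G" using BMO_norm_nonneg[OF b] by (auto simp: B_def F_def G_def Lp_norm_def)
    let ?h = "bcomm i (BI \<alpha>) b f g"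
    \<comment> \<open>the slack \<open>e\<close> makes all normalising factors positive, also when some norm vanishes\<close>
    have eps: "in_Lp r ?h \<and> Lp_norm r ?h \<le> C * ((B + e) * (F + e) * (G + e))" if e: "0 < e" for e
    proof (rule in_Lp_of_bound)
      have pos: "0 < B + e" "0 < F + e" "0 < G + e" using nonneg e by auto
      show "bcomm i (BI \<alpha>) b' f' g' \<in> borel_measurable borel" by (rule measurable_bcomm[OF f'(1) g'(1) b'(1)])
      show "AE x in lborel. ?h x = bcomm i (BI \<alpha>) b' f' g' x"
        by (rule bcomm_cong_AE[OF f'(1) g'(1) b'(1) f'(2) g'(2) b'(2)])
      show "0 < (B + e) * (F + e) * (G + e)" using pos by simp
      have "ball_osc_le K (\<lambda>y. b' y / (B + e))"
        unfolding K_def by (rule in_BMO_ball_osc_le[OF b b' pos(1)]) (use e in \<open>simp add: B_def\<close>)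
      moreover have "(\<integral>\<^sup>+x. ennreal (\<bar>f' x / (F + e)\<bar> powr p) \<partial>lborel) \<le> 1"
        by (rule in_Lp_normalized[OF f _ f'(2) pos(2)]) (use e assms in \<open>auto simp: F_def\<close>)
      moreover have "(\<integral>\<^sup>+x. ennreal (\<bar>g' x / (G + e)\<bar> powr q) \<partial>lborel) \<le> 1"
        by (rule in_Lp_normalized[OF g _ g'(2) pos(3)]) (use e assms in \<open>auto simp: G_def\<close>)
      ultimately have "(\<integral>\<^sup>+x. ennreal (\<bar>bcomm i (BI \<alpha>) (\<lambda>y. b' y / (B + e)) (\<lambda>y. f' y / (F + e)) (\<lambda>y. g' y / (G + e)) x\<bar> powr r) \<partial>lborel) \<le> ennreal (C powr r)"
        using f'(1) g'(1) by (intro C(2)) auto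
      then show "(\<integral>\<^sup>+x. ennreal (\<bar>bcomm i (BI \<alpha>) b' f' g' x / ((B + e) * (F + e) * (G + e))\<bar> powr r) \<partial>lborel) \<le> ennreal (C powr r)"
        by (simp only: bcomm_scale)
    qed (use assms C(1) in auto)
    \<comment> \<open>\<open>C\<close> does not depend on \<open>e\<close>, so the slack disappears
      as \<open>e\<close> tends to 0 from the right; membership in L^r is read off from one value of
      \<open>e\<close>.\<close>
    have "((\<lambda>e. C * ((B + e) * (F + e) * (G + e))) \<longlongrightarrow> C * ((B + 0) * (F + 0) * (G + 0))) (at_right 0)"
      by (intro tendsto_intros)
    moreover have "eventually (\<lambda>e. Lp_norm r ?h \<le> C * ((B + e) * (F + e) * (G + e))) (at_right 0)"
      using eps by (auto simp: eventually_at_right_field intro: exI[of _ 1])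
    ultimately have "Lp_norm r ?h \<le> C * ((B + 0) * (F + 0) * (G + 0))"
      by (rule tendsto_lowerbound) simp
    then show ?thesis using eps[of 1] by (simp add: B_def F_def G_def mult.assoc)
  qed
  then show ?thesis by blast
qed

end
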